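(* Let $p$ be a power of $2$, let $n$ be a positive even integer and let $q=p^{4n}$. Let $t\in\mathbb{F}_q$ be an element such that $\mathrm{Tr}_{\mathbb{F}_q/\mathbb{F}_2}(t)=1$. Define $$R_t(x):=\sum_{i=1}^{n/2}x^{p^{2i-1}}+\Bigl(\sum_{i=0}^{n-1}t^{p^{-i}}\Bigr)^2x .$$ Then the curve $\overline{C}_{R_t}$, i.e. the smooth compactification of the affine curve $y^p-y=xR_t(x)$ over $\mathbb{F}_q$, is $\mathbb{F}_{q^2}$-maximal.
   Context: For $t\in\mathbb{F}_q$, $t^{p^{-i}}\in\mathbb{F}_q$ is the unique $p^i$-th root of $t$. A smooth projective geometrically connected curve $C$ of genus $g$ over $\mathbb{F}_q$ is $\mathbb{F}_{q^2}$-maximal if $|C(\mathbb{F}_{q^2})|=q^2+1+2gq$. *)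

theory Defs
  imports "HOL-Algebra.Algebraic_Closure_Type" "HOL-Library.FuncSet" "HOL-Library.Cardinality"
begin

text \<open>
  A smooth projective curve over a perfect field \<open>k\<close> is represented by its function field:
  a subfield \<open>F\<close> of an ambient field type \<open>'f\<close>, together with the embedding
  \<open>\<iota>\<close> of \<open>k\<close>, the universe of the type \<open>'k\<close>, into \<open>F\<close>. The closed points of the curve are the
  places of \<open>F\<close>, given by their valuation rings; the local ring of the curve at a closed point is
  that valuation ring. The smooth compactification of an integral affine plane curve
  \<open>G(x,y) = 0\<close> is the curve belonging to the fraction field of \<open>k[x,y]/(G)\<close>.
\<close>

text \<open>In a bivariate polynomial, of type \<open>'k poly poly\<close>, the inner variable is \<open>x\<close> and the outer
  one is \<open>y\<close>.\<close>

definition eval2 :: "('k::field \<Rightarrow> 'f::field) \<Rightarrow> 'k poly poly \<Rightarrow> 'f \<Rightarrow> 'f \<Rightarrow> 'f" where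
  "eval2 \<iota> H x y = poly (map_poly (\<lambda>h. poly (map_poly \<iota> h) x) H) y"

text \<open>The condition on \<open>H\<close> says that \<open>k[X,Y] \<rightarrow> F\<close> has kernel \<open>(G)\<close>; as \<open>F\<close> lies in a field,
  it can hold only if \<open>G\<close> generates a prime ideal. Quotients with zero denominator are \<open>0\<close> and
  do no harm.\<close>

definition is_function_field_of ::
    "('k::field \<Rightarrow> 'f::field) \<Rightarrow> 'k poly poly \<Rightarrow> 'f set \<Rightarrow> bool" where
  "is_function_field_of \<iota> G F \<longleftrightarrow>
     (\<exists>x y. (\<forall>H. eval2 \<iota> H x y = 0 \<longleftrightarrow> G dvd H) \<and>
            F = {eval2 \<iota> A x y / eval2 \<iota> B x y | A B. True})"

text \<open>An algebraic closure of \<open>k(X)\<close>, with the embedding below, is an ambient field in which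
  every function field of one variable over \<open>k\<close> occurs up to \<open>k\<close>-isomorphism.\<close>

definition const :: "'k::field \<Rightarrow> 'k poly fract alg_closure" where
  "const c = to_ac (to_fract [:c:])"

definition is_place :: "('k::field \<Rightarrow> 'f::field) \<Rightarrow> 'f set \<Rightarrow> 'f set \<Rightarrow> bool" where
  "is_place \<iota> F P \<longleftrightarrow>
     range \<iota> \<subset> P \<and> P \<subset> F \<and>
     (\<forall>a\<in>P. \<forall>b\<in>P. a - b \<in> P \<and> a * b \<in> P) \<and>
     (\<forall>z\<in>F. z \<in> P \<or> inverse z \<in> P)"

definition max_ideal :: "'f::field set \<Rightarrow> 'f set" where
  "max_ideal P = {z\<in>P. z = 0 \<or> inverse z \<notin> P}"

text \<open>The normalised discrete valuation, meaningful for \<open>z \<noteq> 0\<close> in \<open>F\<close>: the \<open>n\<close> with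
  \<open>z = \<pi>\<^sup>n u\<close> for a generator \<open>\<pi>\<close> of the maximal ideal and a unit \<open>u\<close> of the valuation ring.\<close>

definition place_val :: "'f::field set \<Rightarrow> 'f \<Rightarrow> int" where
  "place_val P z =
     (THE n. \<exists>\<pi> u. \<pi> \<in> P \<and> max_ideal P = (\<lambda>a. \<pi> * a) ` P \<and>
                   u \<in> P - max_ideal P \<and> z = \<pi> powi n * u)"

text \<open>The degree of the residue field over \<open>k\<close>: the number of elements of a set \<open>B\<close> whose
  residue classes form a \<open>k\<close>-basis.\<close>

definition place_degree :: "('k::field \<Rightarrow> 'f::field) \<Rightarrow> 'f set \<Rightarrow> nat" where
  "place_degree \<iota> P =
     (THE d. \<exists>B. finite B \<and> card B = d \<and> B \<subseteq> P \<and>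
        (\<forall>a\<in>P. \<exists>!c. c \<in> B \<rightarrow>\<^sub>E UNIV \<and> a - (\<Sum>b\<in>B. \<iota> (c b) * b) \<in> max_ideal P))"

definition divisors :: "('k::field \<Rightarrow> 'f::field) \<Rightarrow> 'f set \<Rightarrow> ('f set \<Rightarrow> int) set" where
  "divisors \<iota> F = {A. finite {P. A P \<noteq> 0} \<and> (\<forall>P. A P \<noteq> 0 \<longrightarrow> is_place \<iota> F P)}"

definition divisor_degree :: "('k::field \<Rightarrow> 'f::field) \<Rightarrow> ('f set \<Rightarrow> int) \<Rightarrow> int" where
  "divisor_degree \<iota> A = (\<Sum>P | A P \<noteq> 0. A P * int (place_degree \<iota> P))"

definition riemann_roch_space ::
    "('k::field \<Rightarrow> 'f::field) \<Rightarrow> 'f set \<Rightarrow> ('f set \<Rightarrow> int) \<Rightarrow> 'f set" where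
  "riemann_roch_space \<iota> F A =
     {z\<in>F. z = 0 \<or> (\<forall>P. is_place \<iota> F P \<longrightarrow> place_val P z \<ge> - A P)}"

definition ell :: "('k::field \<Rightarrow> 'f::field) \<Rightarrow> 'f set \<Rightarrow> ('f set \<Rightarrow> int) \<Rightarrow> nat" where
  "ell \<iota> F A = vector_space.dim (\<lambda>c z. \<iota> c * z) (riemann_roch_space \<iota> F A)"

text \<open>The maximum of \<open>deg A - \<ell>(A) + 1\<close> over all divisors \<open>A\<close>; it exists by Riemann's theorem, and
  is the genus of the curve when \<open>k\<close> is algebraically closed in \<open>F\<close>.\<close>

definition genus :: "('k::field \<Rightarrow> 'f::field) \<Rightarrow> 'f set \<Rightarrow> int" where
  "genus \<iota> F =
     (GREATEST g. \<exists>A\<in>divisors \<iota> F. g = divisor_degree \<iota> A - int (ell \<iota> F A) + 1)"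

text \<open>For a field extension \<open>L\<close> of \<open>k\<close> via \<open>\<kappa>\<close>, an \<open>L\<close>-point over \<open>k\<close> is a closed
  point together with a \<open>k\<close>-embedding of its residue field into \<open>L\<close>, i.e. a local
  \<open>k\<close>-homomorphism from its valuation ring to \<open>L\<close>. (If \<open>L\<close> is algebraic over \<open>k\<close>, no \<open>L\<close>-point
  lies over the generic point.)\<close>

definition rational_points ::
    "('k::field \<Rightarrow> 'f::field) \<Rightarrow> 'f set \<Rightarrow> ('k \<Rightarrow> 'l::field) \<Rightarrow> 'l set \<Rightarrow> ('f set \<times> ('f \<Rightarrow> 'l)) set" where
  "rational_points \<iota> F \<kappa> L =
     {(P, \<phi>). is_place \<iota> F P \<and> \<phi> \<in> P \<rightarrow>\<^sub>E L \<and>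
        (\<forall>a\<in>P. \<forall>b\<in>P. \<phi> (a + b) = \<phi> a + \<phi> b \<and> \<phi> (a * b) = \<phi> a * \<phi> b) \<and>
        (\<forall>c. \<phi> (\<iota> c) = \<kappa> c) \<and>
        (\<forall>a\<in>max_ideal P. \<phi> a = 0)}"

text \<open>For perfect \<open>k\<close>, the curve is geometrically connected iff \<open>k\<close> is algebraically closed
  in \<open>F\<close>.\<close>

definition geometrically_connected :: "('k::field \<Rightarrow> 'f::field) \<Rightarrow> 'f set \<Rightarrow> bool" where
  "geometrically_connected \<iota> F \<longleftrightarrow>
     (\<forall>z\<in>F. (\<exists>h. h \<noteq> 0 \<and> poly (map_poly \<iota> h) z = 0) \<longrightarrow> z \<in> range \<iota>)"

text \<open>The field with \<open>q\<^sup>2\<close> elements, as a subfield of an algebraic closure of the field \<open>'k\<close>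
  with \<open>q\<close> elements.\<close>

definition quadratic_ext :: "'k::{field,finite} alg_closure set" where
  "quadratic_ext = {z. z ^ (CARD('k)\<^sup>2) = z}"

definition is_maximal :: "('k::{field,finite} \<Rightarrow> 'f::field) \<Rightarrow> 'f set \<Rightarrow> bool" where
  "is_maximal \<iota> F \<longleftrightarrow>
     geometrically_connected \<iota> F \<and>
     int (card (rational_points \<iota> F to_ac quadratic_ext)) =
       (int CARD('k))\<^sup>2 + 1 + 2 * genus \<iota> F * int CARD('k)"

text \<open>\<open>frob_root p i t\<close> is the unique \<open>p\<^sup>i\<close>-th root of \<open>t\<close>, for \<open>p\<close> a power of the characteristic
  of the finite field \<open>'k\<close>.\<close>

definition frob_root :: "nat \<Rightarrow> nat \<Rightarrow> 'k::{field,finite} \<Rightarrow> 'k" where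
  "frob_root p i t = (THE s. s ^ (p ^ i) = t)"

text \<open>The trace from a field with \<open>2\<^sup>d\<close> elements to the prime field, as the sum of conjugates.\<close>

definition trace_F2 :: "'k::{field,finite} \<Rightarrow> 'k" where
  "trace_F2 t = (\<Sum>i < (THE d. CARD('k) = 2 ^ d). t ^ (2 ^ i))"

definition R_poly :: "nat \<Rightarrow> nat \<Rightarrow> 'k::{field,finite} \<Rightarrow> 'k poly" where
  "R_poly p n t =
     (\<Sum>i = 1..n div 2. monom 1 (p ^ (2 * i - 1))) + monom ((\<Sum>i<n. frob_root p i t)\<^sup>2) 1"

definition artin_schreier :: "nat \<Rightarrow> 'k::field poly \<Rightarrow> 'k poly poly" where
  "artin_schreier p R = monom 1 p - monom 1 1 - [:monom 1 1 * R:]"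

end

theory Submission
  imports Defs
begin

text \<open>
  Write \<open>f = x R(x)\<close> and \<open>d = p\<^sup>n\<^sup>-\<^sup>1 + 1\<close>, the degree of \<open>f\<close>, which is prime to \<open>p\<close>. In the function
  field of \<open>y\<^sup>p - y = f(x)\<close> the monomials \<open>x\<^sup>i y\<^sup>j\<close> with \<open>j < p\<close> form a \<open>k\<close>-basis of the affine coordinate
  ring and have pairwise different pole orders \<open>p i + d j\<close> at the single place at infinity. All other
  places are the local rings of affine points, with a uniformizer \<open>x\<^bsup>q\<^sup>r\<^esup> - x\<close>. Every divisor is
  dominated by \<open>e Z + w \<infinity>\<close>, where \<open>Z\<close> is the divisor of zeros of \<open>x\<^bsup>q\<^sup>r\<^esup> - x\<close>, for suitable \<open>r\<close>, \<open>e\<close>, \<open>w\<close>,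
  and the Riemann-Roch space of this divisor is spanned by monomials divided by \<open>(x\<^bsup>q\<^sup>r\<^esup> - x)\<^sup>e\<close>. Counting
  monomials gives the genus \<open>(p - 1)(d - 1)/2\<close>. It remains to count affine points.

  Let \<open>\<sigma>\<close> be the \<open>p\<close>-power map, \<open>N = 4n\<close>, \<open>L = 1 + \<sigma> + \<dots> + \<sigma>\<^sup>n\<^sup>-\<^sup>1\<close>, \<open>T = 1 + \<sigma> + \<dots> + \<sigma>\<^sup>N\<^sup>-\<^sup>1\<close>,
  and let \<open>Q(x)\<close> be the trace of \<open>x R(x)\<close> from \<open>q\<^sup>2\<close> to \<open>p\<close> elements. A point \<open>x\<close> lifts to
  \<open>p\<close> points of the curve if \<open>Q(x) = 0\<close> and to none otherwise. The polar form of \<open>Q\<close> is the trace of \<open>L(x) L(x')\<close>.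
  Put \<open>A = T L\<close> and \<open>\<beta> = A + \<sigma> A\<close>. If \<open>\<beta>(x)\<close> lies in the field with \<open>p\<close> elements, then
  \<open>Q(x) = A\<^sup>2 + \<beta> A + \<beta>\<^sup>2 T(t)\<^sup>2\<close>. As \<open>t\<close> has absolute trace 1, a root \<open>\<epsilon>\<close> of \<open>\<epsilon>\<^sup>2 + \<epsilon> = T(t)\<^sup>2\<close> satisfies
  \<open>\<sigma> \<epsilon> = \<epsilon> + 1\<close>, so that \<open>Q\<close> splits into the factors \<open>A + \<epsilon> \<beta>\<close> and \<open>A + (\<epsilon> + 1) \<beta>\<close> with values in that
  field. For all other \<open>x\<close> the form \<open>Q\<close> is equidistributed on the coset of \<open>x\<close> modulo the kernel of \<open>A\<close>.
\<close>

section \<open>Ring homomorphisms and polynomial evaluation\<close>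

text \<open>Since \<open>genus\<close> is a maximum over all divisors, no ramification formula can
  be quoted: the places have to be classified and an inequality proved for every divisor. Over a
  finite field dimensions become cardinalities, powers of \<open>q\<close>, so that inequality is
  obtained by counting functions.

  In the point count the kernel \<open>Ker\<close> of \<open>A\<close> is totally singular for
  \<open>Q\<close>, and its orthogonal complement is \<open>H\<close>, the set where
  \<open>\<beta>\<close> takes values in the field with \<open>p\<close> elements. On each coset of
  \<open>Ker\<close> outside \<open>H\<close> exactly one value in \<open>p\<close> is zero, so the
  deviation from \<open>q^2\<close> is decided by the plane \<open>H / Ker\<close>, which
  \<open>A\<close> identifies with the field of \<open>p^2\<close> elements. If \<open>T(t)\<close>
  were 0, the form there would be the norm \<open>A * \<sigma> A\<close>, which is anisotropic and
  has a single zero. The trace condition on \<open>t\<close> turns it into a hyperbolic plane with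
  \<open>2p - 1\<close> zeros, and this gives the deviation its positive sign. As \<open>Ker\<close>
  has dimension \<open>5n - 2\<close>, the excess is
  \<open>(p - 1) p^(5n-1) = (p - 1) p^(n-1) q = 2 g q\<close>.\<close>

locale ring_map =
  fixes g :: "'a::comm_ring_1 \<Rightarrow> 'b::comm_ring_1"
  assumes map_1 [simp]: "g 1 = 1"
    and map_add [simp]: "g (a + b) = g a + g b"
    and map_mult [simp]: "g (a * b) = g a * g b"
begin

lemma map_0 [simp]: "g 0 = 0"
  using map_add[of 0 0] by simp

lemma map_minus [simp]: "g (- a) = - g a"
  using map_add[of a "- a"] by (simp add: eq_neg_iff_add_eq_0 add.commute)

lemma map_diff [simp]: "g (a - b) = g a - g b"
  using map_add[of a "- b"] by simp

lemma map_power [simp]: "g (a ^ n) = g a ^ n"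
  by (induction n) auto

lemma map_sum [simp]: "g (\<Sum>i\<in>A. h i) = (\<Sum>i\<in>A. g (h i))"
  by (induction A rule: infinite_finite_induct) auto

lemma map_prod [simp]: "g (\<Prod>i\<in>A. h i) = (\<Prod>i\<in>A. g (h i))"
  by (induction A rule: infinite_finite_induct) auto

lemma map_poly_add [simp]: "map_poly g (A + B) = map_poly g A + map_poly g B"
  by (intro poly_eqI) (simp add: coeff_map_poly)

lemma map_poly_mult [simp]: "map_poly g (A * B) = map_poly g A * map_poly g B"
  by (intro poly_eqI) (simp add: coeff_map_poly coeff_mult)

lemma ring_map_map_poly: "ring_map (map_poly g)"
  by unfold_locales (simp_all add: map_poly_1')

lemma ring_map_eval: "ring_map (\<lambda>A. poly (map_poly g A) z)"
  by unfold_locales (simp_all add: map_poly_1')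

lemma eval_pCons [simp]: "poly (map_poly g (pCons a A)) z = g a + z * poly (map_poly g A) z"
  by (simp add: map_poly_pCons)

lemma eval_monom [simp]: "poly (map_poly g (monom a n)) z = g a * z ^ n"
  by (simp add: map_poly_monom poly_monom)

lemma eval_altdef:
  assumes "degree A \<le> n"
  shows "poly (map_poly g A) z = (\<Sum>i\<le>n. g (coeff A i) * z ^ i)"
proof -
  have "poly (map_poly g A) z = (\<Sum>i\<le>degree (map_poly g A). g (coeff A i) * z ^ i)"
    by (simp add: poly_altdef coeff_map_poly)
  also have "\<dots> = (\<Sum>i\<le>n. g (coeff A i) * z ^ i)"
  proof (rule sum.mono_neutral_left)
    show "{..degree (map_poly g A)} \<subseteq> {..n}"
      using map_poly_degree_leq[of g A] assms by auto
    show "\<forall>i\<in>{..n} - {..degree (map_poly g A)}. g (coeff A i) * z ^ i = 0"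
    proof
      fix i assume "i \<in> {..n} - {..degree (map_poly g A)}"
      hence "coeff (map_poly g A) i = 0" by (intro coeff_eq_0) auto
      thus "g (coeff A i) * z ^ i = 0" by (simp add: coeff_map_poly)
    qed
  qed simp
  finally show ?thesis .
qed

end

lemma eval2_C:
  assumes "ring_map \<iota>"
  shows "eval2 \<iota> [:h:] u v = poly (map_poly \<iota> h) u"
  by (simp add: eval2_def map_poly_pCons)

lemma ring_map_eval2:
  assumes "ring_map \<iota>"
  shows "ring_map (\<lambda>A. eval2 \<iota> A u v)"
  unfolding eval2_def by (intro ring_map.ring_map_eval assms)

lemma eval2_monom:
  assumes "ring_map \<iota>"
  shows "eval2 \<iota> (monom h n) u v = poly (map_poly \<iota> h) u * v ^ n"
proof -
  interpret ring_map "\<lambda>h. poly (map_poly \<iota> h) u"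
    by (rule ring_map.ring_map_eval[OF assms])
  show ?thesis unfolding eval2_def by simp
qed

lemma eval2_altdef:
  assumes "ring_map \<iota>" "degree A \<le> n"
  shows "eval2 \<iota> A u v = (\<Sum>j\<le>n. poly (map_poly \<iota> (coeff A j)) u * v ^ j)"
proof -
  interpret ring_map "\<lambda>h. poly (map_poly \<iota> h) u"
    by (rule ring_map.ring_map_eval[OF assms(1)])
  show ?thesis unfolding eval2_def by (rule eval_altdef[OF assms(2)])
qed

lemma ring_map_to_ac: "ring_map (to_ac :: 'k::field \<Rightarrow> _)"
  by unfold_locales auto

lemma ring_map_const: "ring_map (const :: 'k::field \<Rightarrow> _)"
proof
  show "const (1 :: 'k) = 1" unfolding const_def one_pCons[symmetric] by simp
  fix a b :: 'k
  have "[:a + b:] = [:a:] + [:b:]" "[:a * b:] = [:a:] * [:b:]" by simp_all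
  thus "const (a + b) = const a + const b" "const (a * b) = const a * const b"
    unfolding const_def by (simp_all only: to_fract_add to_fract_mult to_ac_add to_ac_mult)
qed

section \<open>Roots of separable polynomials\<close>

text \<open>A repeated root would make the derivative vanish there, which a nonzero constant never
  does. The exact counts of subfields, of Artin-Schreier fibres and of fibres of \<open>A\<close>
  all rest on this.\<close>

lemma card_roots_separable:
  fixes P :: "'a::alg_closed_field poly"
  assumes "pderiv P = [:c:]" "c \<noteq> 0"
  shows "card {z. poly P z = 0} = degree P"
proof -
  have P0: "P \<noteq> 0" using assms by auto
  obtain A where A: "size A = degree P" "P = smult (lead_coeff P) (\<Prod>x\<in>#A. [:- x, 1:])"
    using alg_closed_imp_factorization[OF P0] by blast
  have "count A a \<le> 1" for a
  proof (rule ccontr)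
    assume "\<not> count A a \<le> 1"
    hence "{#a, a#} \<subseteq># A" by (auto simp: subseteq_mset_def)
    then obtain B where "A = {#a, a#} + B" by (metis subset_mset.add_diff_inverse)
    hence "P = [:- a, 1:] * ([:- a, 1:] * smult (lead_coeff P) (\<Prod>x\<in>#B. [:- x, 1:]))"
      by (subst A(2)) (simp add: mult_ac)
    moreover have "poly [:- a, 1:] a = 0" by simp
    ultimately obtain L Q where "poly L a = 0" "P = L * (L * Q)" by blast
    hence "poly (pderiv P) a = 0" by (simp add: pderiv_mult)
    thus False using assms by simp
  qed
  hence "A = mset_set (set_mset A)"
    by (intro multiset_eqI) (metis count_eq_zero_iff count_mset_set(1) count_mset_set(3) finite_set_mset
        le_antisym less_one not_less)
  hence "card (set_mset A) = degree P" using A(1) by (metis size_mset_set)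
  moreover have "poly P z = 0 \<longleftrightarrow> z \<in># A" for z
    by (subst A(2)) (auto simp: P0 poly_prod_mset prod_mset_zero_iff)
  ultimately show ?thesis by simp
qed

section \<open>Finite fields and their algebraic closure\<close>

text \<open>Multiplication by a nonzero \<open>x\<close> permutes the nonzero elements, so it leaves
  their product unchanged.\<close>

lemma finite_field_power_card:
  fixes x :: "'k::{field,finite}"
  shows "x ^ CARD('k) = x"
proof (cases "x = 0")
  case False
  have "(\<Prod>y\<in>UNIV-{0}. y) = (\<Prod>y\<in>UNIV-{0}. x * y)"
    by (rule prod.reindex_bij_witness[of _ "\<lambda>y. x * y" "\<lambda>y. y / x"]) (use False in auto)
  also have "\<dots> = x ^ (CARD('k) - 1) * (\<Prod>y\<in>UNIV-{0}. y)"
    by (simp add: prod.distrib card_Diff_singleton)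
  finally have "x ^ (CARD('k) - 1) = 1" by simp
  hence "x * x ^ (CARD('k) - 1) = x" by simp
  thus ?thesis
    by (metis Suc_diff_1 finite_UNIV_card_ge_0 finite power_Suc)
qed (simp add: finite_UNIV_card_ge_0)

lemma of_nat_card_finite_field: "of_nat CARD('k) = (0::'k::{field,finite})"
proof -
  have "(\<Sum>z\<in>UNIV. z) = (\<Sum>z\<in>UNIV. z + (1::'k))"
    by (rule sum.reindex_bij_witness[of _ "\<lambda>z. z + 1" "\<lambda>z. z - 1"]) auto
  thus ?thesis by (simp add: sum.distrib)
qed

lemma card_finite_field_ge_2: "CARD('k::{field,finite}) \<ge> 2"
proof -
  have "card {0, 1::'k} \<le> CARD('k)" by (rule card_mono) auto
  thus ?thesis by simp
qed

lemma prime_CHAR_finite_field: "prime CHAR('k::{field,finite})"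
  by (rule prime_CHAR_semidom) (rule finite_imp_CHAR_pos, simp)

lemma power_eq_imp_eq_prime_char:
  fixes a b :: "'a::idom"
  assumes "prime CHAR('a)" "a ^ (CHAR('a) ^ n) = b ^ (CHAR('a) ^ n)"
  shows "a = b"
proof -
  have "(a - b + b) ^ (CHAR('a) ^ n) = (a - b) ^ (CHAR('a) ^ n) + b ^ (CHAR('a) ^ n)"
    by (rule freshmans_dream'[OF assms(1) refl])
  thus ?thesis using assms(2) by simp
qed

text \<open>The assumption holds for every finite field.\<close>

locale finite_field_closure =
  fixes q m :: nat and K :: "'k::{field,finite} itself"
  assumes q_def: "q = CARD('k)" and q_char: "q = CHAR('k) ^ m"
begin

lemma q_ge_2: "q \<ge> 2"
  unfolding q_def by (rule card_finite_field_ge_2)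

lemma prime_CHAR_ac: "prime CHAR('k alg_closure)"
  by (simp add: prime_CHAR_finite_field)

lemma q_power: "q ^ i = CHAR('k alg_closure) ^ (m * i)"
  by (simp add: q_char power_mult)

lemma frob_add: "(a + b :: 'k alg_closure) ^ (q ^ i) = a ^ (q ^ i) + b ^ (q ^ i)"
  by (rule freshmans_dream'[OF prime_CHAR_ac q_power])

lemma ring_map_frob: "ring_map (\<lambda>a :: 'k alg_closure. a ^ (q ^ i))"
  by unfold_locales (auto simp: frob_add power_mult_distrib)

lemma frob_inj: "a ^ (q ^ i) = b ^ (q ^ i) \<Longrightarrow> a = (b :: 'k alg_closure)"
  unfolding q_power by (rule power_eq_imp_eq_prime_char[OF prime_CHAR_ac])

lemma frob_const [simp]: "to_ac (c :: 'k) ^ (q ^ i) = to_ac c"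
  by (induction i) (simp_all add: q_def finite_field_power_card power_mult flip: to_ac_power)

lemma frob_eval: "poly (map_poly to_ac (h :: 'k poly)) a ^ (q ^ i) = poly (map_poly to_ac h) (a ^ (q ^ i))"
proof -
  interpret t: ring_map "to_ac :: 'k \<Rightarrow> _" by (rule ring_map_to_ac)
  interpret F: ring_map "\<lambda>a :: 'k alg_closure. a ^ (q ^ i)" by (rule ring_map_frob)
  show ?thesis by (induction h) (simp_all add: frob_add power_mult_distrib)
qed

lemma frob_eval2: "eval2 to_ac (A :: 'k poly poly) a b ^ (q ^ i) = eval2 to_ac A (a ^ (q ^ i)) (b ^ (q ^ i))"
proof -
  interpret t: ring_map "to_ac :: 'k \<Rightarrow> _" by (rule ring_map_to_ac)
  interpret t2: ring_map "\<lambda>h. poly (map_poly (to_ac :: 'k \<Rightarrow> _) h) c" for c by (rule t.ring_map_eval)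
  interpret F: ring_map "\<lambda>a :: 'k alg_closure. a ^ (q ^ i)" by (rule ring_map_frob)
  show ?thesis unfolding eval2_def
    by (induction A) (simp_all add: frob_add power_mult_distrib frob_eval)
qed

lemma power_q_power_mult:
  fixes a :: "'k alg_closure"
  assumes "a ^ (q ^ i) = a"
  shows "a ^ (q ^ (i * j)) = a"
proof (induction j)
  case (Suc j)
  have "a ^ (q ^ (i * Suc j)) = (a ^ (q ^ (i * j))) ^ (q ^ i)"
    by (simp add: power_add power_mult power_commutes[symmetric] mult.commute[of "q ^ i"])
  thus ?case using Suc assms by simp
qed simp

text \<open>All Frobenius images of \<open>a\<close> are roots of one nonzero polynomial over the
  finite field, so two of them agree; injectivity of the Frobenius map cancels the common part of
  the exponents.\<close>

lemma in_finite_subfield: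
  fixes a :: "'k alg_closure"
  obtains r where "r > 0" "a ^ (q ^ r) = a"
proof -
  obtain h :: "'k poly" where h: "h \<noteq> 0" "poly (map_poly to_ac h) a = 0"
    using alg_closure_algebraic by blast
  define S where "S = {z. poly (map_poly to_ac h) z = 0}"
  have "map_poly to_ac h \<noteq> 0" using h(1) by (simp add: map_poly_eq_0_iff)
  hence fin: "finite S" unfolding S_def by (rule poly_roots_finite)
  have "a ^ (q ^ i) \<in> S" for i
    unfolding S_def using frob_eval[of h a i] h(2) q_ge_2 by (auto simp: zero_power)
  hence "range (\<lambda>i. a ^ (q ^ i)) \<subseteq> S" by blast
  hence "\<not> inj (\<lambda>i::nat. a ^ (q ^ i))"
    using fin by (meson finite_imageD finite_subset infinite_UNIV_nat)
  then obtain i j :: nat where ij: "i < j" "a ^ (q ^ i) = a ^ (q ^ j)"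
    unfolding inj_def by (metis linorder_neqE_nat)
  have "(a ^ (q ^ (j - i))) ^ (q ^ i) = a ^ (q ^ j)"
    using ij(1) by (simp flip: power_mult power_add)
  hence "a ^ (q ^ (j - i)) = a" using ij(2) frob_inj[of "a ^ (q ^ (j - i))" i a] by simp
  with ij(1) show ?thesis by (intro that[of "j - i"]) auto
qed

lemma in_finite_subfield2:
  fixes a b :: "'k alg_closure"
  obtains r where "r > 0" "a ^ (q ^ r) = a" "b ^ (q ^ r) = b"
proof -
  obtain r1 where r1: "r1 > 0" "a ^ (q ^ r1) = a" by (rule in_finite_subfield)
  obtain r2 where r2: "r2 > 0" "b ^ (q ^ r2) = b" by (rule in_finite_subfield)
  show ?thesis
    using r1 r2 power_q_power_mult[OF r1(2), of r2] power_q_power_mult[OF r2(2), of r1]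
    by (intro that[of "r1 * r2"]) (auto simp: mult.commute)
qed

lemma finite_subfield: "r > 0 \<Longrightarrow> finite {a :: 'k alg_closure. a ^ (q ^ r) = a}"
  and card_subfield: "r > 0 \<Longrightarrow> card {a :: 'k alg_closure. a ^ (q ^ r) = a} = q ^ r"
proof -
  assume r: "r > 0"
  define P :: "'k alg_closure poly" where "P = monom 1 (q ^ r) - monom 1 1"
  have qr: "q ^ r > 1" using r q_ge_2 by (intro one_less_power) auto
  have "of_nat (q ^ r) = (0 :: 'k)" using r of_nat_card_finite_field[where ?'k = 'k] by (simp add: q_def)
  hence "to_ac (of_nat (q ^ r) :: 'k) = 0" by (simp only: to_ac_0)
  hence "of_nat (q ^ r) = (0 :: 'k alg_closure)" by (simp only: to_ac_of_nat)
  hence "pderiv P = [:- 1:]" unfolding P_def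
    by (simp add: pderiv_diff pderiv_monom monom_0 del: of_nat_power)
  hence "card {z. poly P z = 0} = degree P" by (rule card_roots_separable) simp
  also have "degree P = q ^ r" unfolding P_def using qr
    by (intro antisym degree_diff_le le_degree) (auto simp: degree_monom_eq)
  finally show "card {a :: 'k alg_closure. a ^ (q ^ r) = a} = q ^ r"
    by (simp add: P_def poly_monom)
  moreover have "q ^ r > 0" using qr by linarith
  ultimately show "finite {a :: 'k alg_closure. a ^ (q ^ r) = a}"
    by (metis card_gt_0_iff)
qed

lemma minimal_polynomial:
  fixes a :: "'k alg_closure"
  obtains h :: "'k poly" where "h \<noteq> 0" "poly (map_poly to_ac h) a = 0"
    "\<And>c. poly (map_poly to_ac c) a = 0 \<Longrightarrow> h dvd c"
proof -
  interpret t: ring_map "to_ac :: 'k \<Rightarrow> _" by (rule ring_map_to_ac)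
  interpret e: ring_map "\<lambda>h. poly (map_poly (to_ac :: 'k \<Rightarrow> _) h) a" by (rule t.ring_map_eval)
  obtain h0 :: "'k poly" where h0: "h0 \<noteq> 0" "poly (map_poly to_ac h0) a = 0"
    using alg_closure_algebraic by blast
  define R where "R h \<longleftrightarrow> h \<noteq> 0 \<and> poly (map_poly to_ac h) a = 0" for h :: "'k poly"
  have "R h0" using h0 by (simp add: R_def)
  then obtain h where h: "R h" "\<And>c. R c \<Longrightarrow> degree h \<le> degree c"
    using ex_has_least_nat[of R h0 degree] by blast
  show ?thesis
  proof (rule that)
    show "h \<noteq> 0" "poly (map_poly to_ac h) a = 0" using h(1) by (auto simp: R_def)
    fix c :: "'k poly" assume c: "poly (map_poly to_ac c) a = 0"
    have "c mod h = c - h * (c div h)" by (simp add: minus_mult_div_eq_mod)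
    hence "poly (map_poly to_ac (c mod h)) a = 0" using c h(1) by (simp add: R_def)
    moreover have "c mod h = 0 \<or> degree (c mod h) < degree h"
      using degree_mod_less[of h c] h(1) by (auto simp: R_def)
    ultimately have "c mod h = 0" using h(2)[of "c mod h"] by (force simp: R_def)
    thus "h dvd c" by (simp add: mod_eq_0_iff_dvd)
  qed
qed

end

section \<open>Weighted degrees\<close>

lemma coeff_pcompose_monom:
  fixes h :: "'a::comm_ring_1 poly"
  assumes "n > 0"
  shows "coeff (h \<circ>\<^sub>p monom 1 n) w = (if n dvd w then coeff h (w div n) else 0)"
proof (induction h arbitrary: w)
  case (pCons a h)
  have "coeff (pCons a h \<circ>\<^sub>p monom 1 n) w = coeff [:a:] w + (if w < n then 0 else coeff (h \<circ>\<^sub>p monom 1 n) (w - n))"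
    by (simp add: pcompose_pCons coeff_monom_mult)
  also have "\<dots> = (if n dvd w then coeff (pCons a h) (w div n) else 0)"
  proof (cases "w < n")
    case True
    thus ?thesis using assms by (cases "w = 0") (auto simp: coeff_pCons split: nat.splits dest: dvd_imp_le)
  next
    case False
    hence "w div n = Suc ((w - n) div n)" "n dvd w - n \<longleftrightarrow> n dvd w" "w > 0"
      using assms by (simp_all add: le_div_geq dvd_minus_self)
    thus ?thesis using False pCons.IH[of "w - n"] by (auto simp: coeff_pCons split: nat.splits)
  qed
  finally show ?case .
qed simp

lemma coeff_mult_degree_le:
  fixes A B :: "'a::comm_ring_1 poly"
  assumes "degree A \<le> v" "degree B \<le> w"
  shows "coeff (A * B) (v + w) = coeff A v * coeff B w"
proof (cases "degree A = v \<and> degree B = w")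
  case True
  thus ?thesis using coeff_mult_degree_sum[of A B] by simp
next
  case False
  hence *: "degree A < v \<or> degree B < w" using assms by auto
  hence "degree (A * B) < v + w" using assms degree_mult_le[of A B] by linarith
  thus ?thesis using * by (auto simp: coeff_eq_0)
qed

text \<open>\<open>of_nat_p\<close> makes \<open>y ^ p - y - c\<close> separable in
  \<open>y\<close>; coprimality keeps the weights of monomials with \<open>y\<close>-degree below
  \<open>p\<close> distinct; monicity makes the top terms \<open>y ^ p\<close> and
  \<open>x ^ d\<close> of the equation cancel in weight \<open>p * d\<close>.\<close>

locale as_curve = finite_field_closure q m K for q m and K :: "'k::{field,finite} itself" +
  fixes f :: "'k poly" and p d :: nat
  assumes p_ge_2: "p \<ge> 2" and of_nat_p: "of_nat p = (0::'k)"
    and d_pos: "d > 0" and degree_f: "degree f = d" and monic_f: "lead_coeff f = 1"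
    and coprime_p_d: "coprime p d"
begin

definition G :: "'k poly poly" where "G = monom 1 p - monom 1 1 - [:f:]"

lemma coeff_G: "coeff G j = (if j = p then 1 else if j = 1 then - 1 else if j = 0 then - f else 0)"
  using p_ge_2 by (auto simp: G_def coeff_pCons split: nat.splits)

lemma degree_G [simp]: "degree G = p"
  by (intro antisym degree_le le_degree) (use p_ge_2 in \<open>auto simp: coeff_G\<close>)

lemma lead_coeff_G [simp]: "coeff G p = 1"
  by (simp add: coeff_G)

lemma G_nz [simp]: "G \<noteq> 0"
  using degree_G p_ge_2 by (metis degree_0 not_numeral_le_zero)

lemma G_dvd_imp_0:
  assumes "G dvd C" "degree C < p"
  shows "C = 0"
  using assms dvd_imp_degree_le[of G C] by (auto simp: not_less)

text \<open>The monomial \<open>x\<^sup>i y\<^sup>j\<close> gets the weight \<open>p i + d j\<close>, its pole order at infinity.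
  \<open>lam w A\<close> is the sum of the coefficients of \<open>A\<close> of weight \<open>w\<close>.\<close>

definition wle :: "nat \<Rightarrow> 'k poly poly \<Rightarrow> bool" where
  "wle w A \<longleftrightarrow> (\<forall>i j. coeff (coeff A j) i \<noteq> 0 \<longrightarrow> p * i + d * j \<le> w)"

text \<open>The substitution \<open>x = T ^ p\<close>, \<open>y = T ^ d\<close> turns a monomial of
  weight \<open>w\<close> into \<open>T ^ w\<close>. Being a ring map, it gives \<open>lam\<close>
  its additivity and multiplicativity.\<close>

definition Psi :: "'k poly poly \<Rightarrow> 'k poly" where
  "Psi A = poly (map_poly (\<lambda>h. h \<circ>\<^sub>p monom 1 p) A) (monom 1 d)"

definition lam :: "nat \<Rightarrow> 'k poly poly \<Rightarrow> 'k" where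
  "lam w A = coeff (Psi A) w"

lemma ring_map_pcompose: "ring_map (\<lambda>h :: 'k poly. h \<circ>\<^sub>p monom 1 p)"
  by unfold_locales (auto simp: pcompose_add pcompose_mult pcompose_1)

lemma ring_map_Psi: "ring_map Psi"
  unfolding Psi_def by (intro ring_map.ring_map_eval ring_map_pcompose)

sublocale Psi: ring_map Psi by (rule ring_map_Psi)

lemma wleD: "wle w A \<Longrightarrow> coeff (coeff A j) i \<noteq> 0 \<Longrightarrow> p * i + d * j \<le> w"
  by (auto simp: wle_def)

lemma wle_mono: "wle v A \<Longrightarrow> v \<le> w \<Longrightarrow> wle w A"
  by (auto simp: wle_def intro: order_trans)

lemma wle_0 [simp]: "wle w 0"
  by (simp add: wle_def)

lemma wle_add: "wle w A \<Longrightarrow> wle w B \<Longrightarrow> wle w (A + B)"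
  by (auto simp: wle_def) (metis add.right_neutral)

lemma wle_diff: "wle w A \<Longrightarrow> wle w B \<Longrightarrow> wle w (A - B)"
  by (auto simp: wle_def) (metis diff_0_right)

lemma wle_mult:
  assumes "wle v A" "wle w B"
  shows "wle (v + w) (A * B)"
  unfolding wle_def
proof (intro allI impI)
  fix i j assume "coeff (coeff (A * B) j) i \<noteq> 0"
  hence "(\<Sum>a\<le>j. \<Sum>b\<le>i. coeff (coeff A a) b * coeff (coeff B (j - a)) (i - b)) \<noteq> 0"
    by (simp add: coeff_mult coeff_sum)
  then obtain a b where ab: "a \<le> j" "b \<le> i" "coeff (coeff A a) b * coeff (coeff B (j - a)) (i - b) \<noteq> 0"
    by (metis (no_types, lifting) atMost_iff sum.neutral)
  hence "p * b + d * a \<le> v" "p * (i - b) + d * (j - a) \<le> w"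
    using assms by (auto dest: wleD)
  moreover have "p * i = p * b + p * (i - b)" "d * j = d * a + d * (j - a)"
    using ab by (simp_all flip: distrib_left)
  ultimately show "p * i + d * j \<le> v + w" by linarith
qed

lemma wle_C: "wle (p * degree h) [:h:]"
  by (auto simp: wle_def coeff_pCons le_degree split: nat.splits)

lemma wle_monom: "wle (p * degree h + d * j) (monom h j)"
  by (auto simp: wle_def le_degree)

lemma wle_G: "wle (p * d) G"
  unfolding wle_def
proof (intro allI impI)
  fix i j assume ij: "coeff (coeff G j) i \<noteq> 0"
  have "d * 1 \<le> d * p" using p_ge_2 by (intro mult_le_mono2) simp
  thus "p * i + d * j \<le> p * d"
    using ij degree_f le_degree[of f i]
    by (auto simp: coeff_G mult.commute[of d] split: if_splits)
qed

lemma exists_wle: "\<exists>w. wle w A"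
proof (induction A)
  case (pCons a A)
  then obtain w where w: "wle w A" by blast
  have "pCons a A = [:a:] + monom 1 1 * A" by (simp add: monom_altdef)
  moreover have "wle (p * degree a + ((p * degree (1::'k poly) + d * 1) + w)) ([:a:] + monom 1 1 * A)"
    by (intro wle_add wle_mono[OF wle_C] wle_mono[OF wle_mult[OF wle_monom w]]) auto
  ultimately show ?case by metis
qed auto

lemma lam_altdef:
  assumes "degree A \<le> n"
  shows "lam w A = (\<Sum>j\<le>n. if d * j \<le> w \<and> p dvd (w - d * j) then coeff (coeff A j) ((w - d * j) div p) else 0)"
proof -
  interpret ring_map "\<lambda>h :: 'k poly. h \<circ>\<^sub>p monom 1 p" by (rule ring_map_pcompose)
  have "Psi A = (\<Sum>j\<le>n. (coeff A j \<circ>\<^sub>p monom 1 p) * monom 1 (d * j))"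
    unfolding Psi_def eval_altdef[OF assms] by (simp add: monom_power)
  hence "lam w A = (\<Sum>j\<le>n. coeff (monom 1 (d * j) * (coeff A j \<circ>\<^sub>p monom 1 p)) w)"
    by (simp add: lam_def coeff_sum mult.commute)
  also have "\<dots> = (\<Sum>j\<le>n. if d * j \<le> w \<and> p dvd (w - d * j) then coeff (coeff A j) ((w - d * j) div p) else 0)"
    using p_ge_2 by (intro sum.cong) (auto simp: coeff_monom_mult coeff_pcompose_monom)
  finally show ?thesis .
qed

lemma lam_eq_0:
  assumes "wle v A" "v < w"
  shows "lam w A = 0"
proof -
  have "coeff (coeff A j) ((w - d * j) div p) = 0" if "d * j \<le> w" "p dvd (w - d * j)" for j
  proof (rule ccontr)
    assume "coeff (coeff A j) ((w - d * j) div p) \<noteq> 0"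
    from wleD[OF assms(1) this] have "p * ((w - d * j) div p) + d * j \<le> v" .
    thus False using that assms(2) by simp
  qed
  thus ?thesis unfolding lam_altdef[OF order_refl] by (intro sum.neutral) auto
qed

lemma degree_Psi_le: "wle w A \<Longrightarrow> degree (Psi A) \<le> w"
  using lam_eq_0 by (intro degree_le) (auto simp: lam_def)

lemma lam_diff: "lam w (A - B) = lam w A - lam w B"
  by (simp add: lam_def)

lemma lam_mult:
  assumes "wle v A" "wle w B"
  shows "lam (v + w) (A * B) = lam v A * lam w B"
  unfolding lam_def Psi.map_mult
  by (intro coeff_mult_degree_le degree_Psi_le assms)

text \<open>If two monomials with \<open>y\<close>-exponents below \<open>p\<close> have equal
  weight, \<open>p\<close> divides \<open>d\<close> times the difference of these exponents, hence
  the difference itself. So a weight determines its reduced monomial.\<close>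

lemma lam_reduced:
  assumes "degree A < p" "j < p"
  shows "lam (p * i + d * j) A = coeff (coeff A j) i"
proof -
  let ?w = "p * i + d * j"
  have uniq: "j' = j" if "d * j' \<le> ?w" "p dvd (?w - d * j')" "j' < p" for j'
  proof -
    have "int p dvd int (?w - d * j')" using that(2) by (simp only: int_dvd_int_iff)
    hence "int p dvd int ?w - int (d * j')" by (simp only: of_nat_diff[OF that(1)])
    hence "int p dvd (int ?w - int (d * j')) - int p * int i" by (rule dvd_diff) simp
    moreover have "int ?w - int (d * j') - int p * int i = int d * (int j - int j')"
      by (simp add: algebra_simps)
    ultimately have "int p dvd int d * (int j - int j')" by simp
    hence "int p dvd int j - int j'" using coprime_p_d
      by (metis coprime_dvd_mult_right_iff coprime_int_iff)
    moreover have "\<bar>int j - int j'\<bar> < int p" using that(3) assms(2) by linarith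
    ultimately show ?thesis
      by (metis dvd_imp_le_int eq_iff_diff_eq_0 int_eq_iff int_int_eq linorder_not_le abs_of_nat)
  qed
  have "lam ?w A = (\<Sum>j'\<le>p - 1. if d * j' \<le> ?w \<and> p dvd (?w - d * j') then coeff (coeff A j') ((?w - d * j') div p) else 0)"
    using assms by (intro lam_altdef) auto
  also have "\<dots> = (\<Sum>j'\<le>p - 1. if j' = j then coeff (coeff A j) i else 0)"
    using assms p_ge_2 uniq by (intro sum.cong) auto
  also have "\<dots> = coeff (coeff A j) i" using assms by (subst sum.delta) auto
  finally show ?thesis .
qed

text \<open>In the top weight \<open>p * d\<close> only \<open>y ^ p\<close> and the leading term of
  \<open>- f\<close> occur, with coefficients 1 and -1; the term \<open>- y\<close> has the smaller
  weight \<open>d\<close>.\<close>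

lemma lam_G: "lam (p * d) G = 0"
proof -
  have "Psi G = monom 1 (d * p) - monom 1 d - (f \<circ>\<^sub>p monom 1 p)"
  proof -
    interpret ring_map "\<lambda>h :: 'k poly. h \<circ>\<^sub>p monom 1 p" by (rule ring_map_pcompose)
    have "Psi [:f:] = f \<circ>\<^sub>p monom 1 p" "Psi (monom 1 j) = monom 1 (d * j)" for j
      unfolding Psi_def by (simp_all add: monom_power)
    thus ?thesis unfolding G_def by simp
  qed
  moreover have "d \<noteq> p * d" using d_pos p_ge_2 by simp
  ultimately show ?thesis
    using p_ge_2 degree_f monic_f by (simp add: lam_def coeff_pcompose_monom mult.commute[of d])
qed

lemma lam_mult_G: "wle v A \<Longrightarrow> lam (v + p * d) (A * G) = 0"
  by (simp add: lam_mult wle_G lam_G)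

text \<open>For the least bound \<open>w\<close> some monomial has weight exactly \<open>w\<close>,
  and in a reduced polynomial no other monomial can cancel it.\<close>

lemma exists_weight:
  assumes "A \<noteq> 0" "degree A < p"
  obtains w where "wle w A" "lam w A \<noteq> 0"
proof -
  define w where "w = (LEAST w. wle w A)"
  have w: "wle w A" unfolding w_def using exists_wle by (rule LeastI_ex)
  obtain i j where ij: "coeff (coeff A j) i \<noteq> 0" "p * i + d * j = w"
  proof (cases "w = 0")
    case True
    from assms(1) obtain i j where "coeff (coeff A j) i \<noteq> 0" by (metis leading_coeff_0_iff)
    with wleD[OF w this] True show ?thesis by (intro that) auto
  next
    case False
    hence "\<not> wle (w - 1) A" unfolding w_def by (metis diff_less not_less_Least zero_less_one neq0_conv)
    then obtain i j where "coeff (coeff A j) i \<noteq> 0" "\<not> p * i + d * j \<le> w - 1" by (auto simp: wle_def)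
    with wleD[OF w this(1)] show ?thesis by (intro that) auto
  qed
  hence "j \<le> degree A" by (metis coeff_0 le_degree)
  hence "lam w A \<noteq> 0" using lam_reduced[OF assms(2), of j i] ij assms(2) by simp
  with w show ?thesis by (rule that)
qed

text \<open>Division by \<open>G\<close>, which is monic in \<open>y\<close>. Each subtracted
  multiple of \<open>G\<close> obeys the weight bounds that the removed top term obeys, and
  \<open>lam\<close> does not see it by \<open>lam_mult_G\<close>.\<close>

lemma reduce:
  obtains C where "degree C < p" "G dvd A - C" "\<And>w. wle w A \<Longrightarrow> wle w C \<and> lam w C = lam w A"
proof -
  have "\<exists>C. degree C < p \<and> G dvd A - C \<and> (\<forall>w. wle w A \<longrightarrow> wle w C \<and> lam w C = lam w A)"
  proof (induction "degree A" arbitrary: A rule: less_induct)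
    case less
    show ?case
    proof (cases "degree A < p")
      case False
      define D where "D = degree A"
      define M where "M = monom (lead_coeff A) (D - p)"
      have D: "D \<ge> p" "D > 0" using False p_ge_2 by (auto simp: D_def)
      have nz: "lead_coeff A \<noteq> 0" using D(2) by (auto simp: D_def)
      define A' where "A' = A - M * G"
      have dM: "degree M = D - p" using nz by (simp add: M_def degree_monom_eq)
      have "degree (M * G) \<le> D" using degree_mult_le[of M G] dM D by simp
      hence "degree A' \<le> D" unfolding A'_def by (intro degree_diff_le) (auto simp: D_def)
      moreover have "coeff (M * G) D = lead_coeff A"
        using coeff_mult_degree_sum[of M G] dM D by (simp add: M_def)
      hence "coeff A' D = 0" by (simp add: A'_def D_def)
      ultimately have "degree A' < D" using D(2)
        by (metis degree_0 leading_coeff_0_iff le_neq_implies_less)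
      from less[OF this[unfolded D_def]] obtain C where
        C: "degree C < p" "G dvd A' - C" "\<And>w. wle w A' \<Longrightarrow> wle w C \<and> lam w C = lam w A'" by blast
      have "wle w C \<and> lam w C = lam w A" if w: "wle w A" for w
      proof -
        have "coeff (coeff A D) (degree (coeff A D)) \<noteq> 0" using nz unfolding D_def by simp
        from wleD[OF w this] have le: "p * degree (coeff A D) + d * D \<le> w" .
        moreover have "d * D = d * (D - p) + p * d" using D by (simp add: algebra_simps)
        ultimately have le2: "p * degree (lead_coeff A) + d * (D - p) \<le> w - p * d" "p * d \<le> w"
          by (auto simp: D_def)
        have wM: "wle (w - p * d) M" unfolding M_def by (rule wle_mono[OF wle_monom le2(1)])
        have MG: "wle w (M * G)" "lam w (M * G) = 0"
          using wle_mult[OF wM wle_G] lam_mult_G[OF wM] le2(2) by auto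
        hence "wle w A'" "lam w A' = lam w A" using w
          unfolding A'_def by (auto intro: wle_diff simp: lam_diff)
        thus ?thesis using C(3) by simp
      qed
      moreover have "A - C = (A' - C) + M * G" by (simp add: A'_def)
      hence "G dvd A - C" using C(2) by (metis dvd_add dvd_triv_right)
      ultimately show ?thesis using C(1) by blast
    qed (auto intro!: exI[of _ A])
  qed
  thus ?thesis using that by blast
qed

text \<open>A multiple of \<open>G\<close> reduces to 0, and reduction preserves \<open>lam\<close>.
  Hence \<open>lam w\<close> is well defined on the coordinate ring and can serve as the leading
  coefficient at infinity.\<close>

lemma lam_dvd:
  assumes "G dvd A" "wle w A"
  shows "lam w A = 0"
proof -
  obtain C where C: "degree C < p" "G dvd A - C" "\<And>w. wle w A \<Longrightarrow> wle w C \<and> lam w C = lam w A"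
    using reduce[of A] by blast
  have "G dvd A - (A - C)" using assms(1) C(2) by (rule dvd_diff)
  hence "C = 0" using C(1) by (intro G_dvd_imp_0) auto
  thus ?thesis using C(3)[OF assms(2)] by (simp add: lam_def)
qed

text \<open>This is the irreducibility of \<open>G\<close> over \<open>k(x)\<close>.\<close>

lemma factor_degree_0:
  assumes "[:a:] * G = Q * H" "a \<noteq> 0" "degree H < p"
  shows "degree H = 0"
proof (rule ccontr)
  assume D: "degree H \<noteq> 0"
  have "Q * H \<noteq> 0" using assms(1,2) by (metis G_nz mult_eq_0_iff pCons_eq_0_iff)
  hence nz: "Q \<noteq> 0" "H \<noteq> 0" by auto
  have "degree Q + degree H = degree ([:a:] * G)" using nz assms(1) by (simp add: degree_mult_eq)
  also have "\<dots> = p" using assms(2) by (subst degree_mult_eq) auto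
  finally have dQ: "degree Q < p" using D by simp
  obtain v where v: "wle v Q" "lam v Q \<noteq> 0" using exists_weight[OF nz(1) dQ] .
  obtain w where w: "wle w H" "lam w H \<noteq> 0" using exists_weight[OF nz(2) assms(3)] .
  \<comment> \<open>Leading coefficients multiply, so that of \<open>Q * H\<close> is nonzero. But
    the product is \<open>[:a:] * G\<close>, whose coefficient in its only possible top weight is
    0.\<close>
  have vw: "wle (v + w) ([:a:] * G)" "lam (v + w) ([:a:] * G) \<noteq> 0"
    unfolding assms(1) using wle_mult[OF v(1) w(1)] lam_mult[OF v(1) w(1)] v(2) w(2) by auto
  have "coeff (coeff ([:a:] * G) p) (degree a) \<noteq> 0" using assms(2) by simp
  from wleD[OF vw(1) this] have "p * degree a + p * d \<le> v + w" by (simp add: mult.commute)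
  moreover have "wle (p * degree a + p * d) ([:a:] * G)" by (intro wle_mult wle_C wle_G)
  ultimately have "v + w = p * degree a + p * d" using lam_eq_0 vw(2)
    by (metis le_neq_implies_less)
  thus False using vw(2) lam_mult_G[OF wle_C, of a] by simp
qed

text \<open>For a nonzero reduced element \<open>H\<close> of least \<open>y\<close>-degree, the
  pseudo-remainder of \<open>G\<close> by \<open>H\<close> must vanish. So \<open>H\<close> divides
  a multiple of \<open>G\<close>, and irreducibility forces \<open>y\<close>-degree 0.\<close>

lemma ideal_contains_polynomial_in_x:
  assumes mult: "\<And>A B. A \<in> I \<Longrightarrow> A * B \<in> I" and diff: "\<And>A B. A \<in> I \<Longrightarrow> B \<in> I \<Longrightarrow> A - B \<in> I"
    and "G \<in> I" "C \<in> I" "C \<noteq> 0" "degree C < p"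
  obtains N where "N \<noteq> 0" "[:N:] \<in> I"
proof -
  define R where "R H \<longleftrightarrow> H \<noteq> 0 \<and> degree H < p \<and> H \<in> I" for H
  have "R C" using assms by (simp add: R_def)
  then obtain H where H: "R H" "\<And>H'. R H' \<Longrightarrow> degree H \<le> degree H'"
    using ex_has_least_nat[of R C degree] by blast
  obtain a Q where aQ: "a \<noteq> 0" "smult a G = H * Q + pseudo_mod G H"
    using pseudo_mod(1)[of H G] H(1) by (auto simp: R_def)
  have "pseudo_mod G H = G * [:a:] - H * Q" using aQ(2) by simp
  also have "\<dots> \<in> I" using H(1) \<open>G \<in> I\<close> by (intro diff mult) (auto simp: R_def)
  finally have "pseudo_mod G H \<in> I" .
  moreover have "pseudo_mod G H = 0 \<or> degree (pseudo_mod G H) < degree H"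
    using pseudo_mod(2)[of H G] H(1) by (auto simp: R_def)
  ultimately have "pseudo_mod G H = 0"
    using H(2)[of "pseudo_mod G H"] H(1) unfolding R_def by (metis less_trans not_less)
  hence "[:a:] * G = Q * H" using aQ(2) by (simp add: mult.commute)
  hence "degree H = 0" using aQ(1) H(1) by (intro factor_degree_0) (auto simp: R_def)
  then obtain N where "H = [:N:]" by (rule degree_eq_zeroE)
  thus ?thesis using H(1) by (intro that[of N]) (auto simp: R_def)
qed

end

text \<open>An arbitrary generic point in an arbitrary field, because the theorem quantifies over
  every \<open>F\<close> with the given equation and not only over one constructed model.\<close>

locale as_function_field = as_curve q m K f p d
  for q m and K :: "'k::{field,finite} itself" and f p d +
  fixes \<iota> :: "'k \<Rightarrow> 'f::field" and x y :: 'f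
  assumes ring_map_\<iota>: "ring_map \<iota>"
    and kernel: "eval2 \<iota> H x y = 0 \<longleftrightarrow> G dvd H"
begin

sublocale \<iota>: ring_map \<iota> by (rule ring_map_\<iota>)

abbreviation ev :: "'k poly poly \<Rightarrow> 'f" where "ev A \<equiv> eval2 \<iota> A x y"

sublocale ev: ring_map ev by (intro ring_map_eval2 ring_map_\<iota>)

definition F :: "'f set" where "F = {ev A / ev B | A B. True}"

lemma ev_eq_0_iff: "degree C < p \<Longrightarrow> ev C = 0 \<longleftrightarrow> C = 0"
  using kernel G_dvd_imp_0 by auto

lemma ev_eq_iff: "ev A = ev B \<longleftrightarrow> G dvd A - B"
  using kernel[of "A - B"] by simp

lemma ev_reduce:
  obtains C where "degree C < p" "ev C = ev A" "\<And>w. wle w A \<Longrightarrow> wle w C \<and> lam w C = lam w A"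
proof -
  obtain C where C: "degree C < p" "G dvd A - C" "\<And>w. wle w A \<Longrightarrow> wle w C \<and> lam w C = lam w A"
    using reduce[of A] by blast
  from C(2) have "ev C = ev A" by (simp flip: ev_eq_iff)
  with C show ?thesis by (intro that)
qed

lemma ev_nz: "wle w A \<Longrightarrow> lam w A \<noteq> 0 \<Longrightarrow> ev A \<noteq> 0"
  using lam_dvd kernel by blast

lemma ev_C: "ev [:h:] = poly (map_poly \<iota> h) x"
  by (rule eval2_C[OF ring_map_\<iota>])

lemma ev_const [simp]: "ev [:[:c:]:] = \<iota> c"
  by (simp add: ev_C)

lemma ev_x: "ev [:monom 1 1:] = x" and ev_y: "ev (monom 1 1) = y"
  by (simp_all add: ev_C eval2_monom ring_map_\<iota> one_pCons)

lemma ev_C_eq_0_iff [simp]: "ev [:h:] = 0 \<longleftrightarrow> h = 0"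
  using p_ge_2 by (subst ev_eq_0_iff) auto

lemma \<iota>_eq_0_iff [simp]: "\<iota> c = 0 \<longleftrightarrow> c = 0"
  using ev_C_eq_0_iff[of "[:c:]"] by simp

text \<open>A substitute for the norm to the rational functions in \<open>x\<close>: the polynomials
  whose values are multiples of \<open>ev B\<close> form an ideal that contains \<open>G\<close> and
  a nonzero reduced polynomial, so it meets the polynomials in \<open>x\<close> alone.\<close>

lemma rationalize:
  assumes "ev B \<noteq> 0"
  obtains B' N where "N \<noteq> 0" "ev B * ev B' = ev [:N:]"
proof -
  define I where "I = {A. \<exists>B'. ev A = ev B * ev B'}"
  have mult: "A * A' \<in> I" if "A \<in> I" for A A'
    using that unfolding I_def mem_Collect_eq ev.map_mult by (metis ev.map_mult mult.assoc)
  have diff: "A - A' \<in> I" if "A \<in> I" "A' \<in> I" for A A'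
    using that unfolding I_def mem_Collect_eq ev.map_diff by (metis ev.map_diff right_diff_distrib)
  have "ev G = ev B * ev 0" by (simp add: kernel)
  hence G: "G \<in> I" unfolding I_def by blast
  obtain C where C: "degree C < p" "ev C = ev B" by (rule ev_reduce)
  have "ev C = ev B * ev 1" using C by simp
  hence "C \<in> I" unfolding I_def by blast
  moreover have "C \<noteq> 0" using C assms by auto
  ultimately obtain N where N: "N \<noteq> 0" "[:N:] \<in> I"
    using ideal_contains_polynomial_in_x[OF mult diff G _ _ C(1)] by blast
  then obtain B' where "ev [:N:] = ev B * ev B'" unfolding I_def by blast
  from that[OF N(1) this[symmetric]] show ?thesis .
qed

lemma F_rep:
  assumes "z \<in> F"
  obtains A N where "degree A < p" "N \<noteq> 0" "z = ev A / ev [:N:]"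
proof -
  obtain A B where z: "z = ev A / ev B" using assms by (auto simp: F_def)
  show ?thesis
  proof (cases "ev B = 0")
    \<comment> \<open>A quotient with zero denominator is 0 by convention.\<close>
    case True
    thus ?thesis using z p_ge_2 by (intro that[of 0 1]) auto
  next
    case False
    then obtain B' N where N: "N \<noteq> 0" "ev B * ev B' = ev [:N:]" by (rule rationalize)
    obtain C where C: "degree C < p" "ev C = ev (A * B')" by (rule ev_reduce)
    have "ev [:N:] \<noteq> 0" using N(1) by simp
    hence "z = ev C / ev [:N:]" using z False C(2) N(2)
      by (simp add: field_simps) (metis mult.assoc mult.commute)
    with C N show ?thesis by (intro that)
  qed
qed

lemma ev_in_F: "ev A \<in> F"
  unfolding F_def mem_Collect_eq by (rule exI[of _ A], rule exI[of _ 1]) simp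

lemma ev_divide_in_F: "ev A / ev B \<in> F"
  unfolding F_def by auto

lemma F_mult: "z \<in> F \<Longrightarrow> w \<in> F \<Longrightarrow> z * w \<in> F"
proof -
  assume "z \<in> F" "w \<in> F"
  then obtain A B A' B' where "z = ev A / ev B" "w = ev A' / ev B'" by (auto simp: F_def)
  hence "z * w = ev (A * A') / ev (B * B')" by simp
  thus ?thesis unfolding F_def by blast
qed

lemma F_inverse: "z \<in> F \<Longrightarrow> inverse z \<in> F"
  unfolding F_def by clarsimp (metis ring_class.ring_distribs(1))

lemma F_diff: "z \<in> F \<Longrightarrow> w \<in> F \<Longrightarrow> z - w \<in> F"
proof -
  assume "z \<in> F" "w \<in> F"
  obtain A N where z: "N \<noteq> 0" "z = ev A / ev [:N:]" using \<open>z \<in> F\<close> by (rule F_rep)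
  obtain A' N' where w: "N' \<noteq> 0" "w = ev A' / ev [:N':]" using \<open>w \<in> F\<close> by (rule F_rep)
  have "ev [:N:] \<noteq> 0" "ev [:N':] \<noteq> 0" using z w by auto
  hence "z - w = ev (A * [:N':] - A' * [:N:]) / ev ([:N:] * [:N':])"
    unfolding z w ev.map_diff ev.map_mult by (simp add: field_simps)
  thus ?thesis unfolding F_def by blast
qed

lemma F_const: "\<iota> c \<in> F"
  using ev_in_F[of "[:[:c:]:]"] by simp

lemma F_0: "0 \<in> F" and F_1: "1 \<in> F"
  using F_const[of 0] F_const[of 1] by auto

lemma F_powi: "z \<in> F \<Longrightarrow> z powi n \<in> F"
proof -
  assume z: "z \<in> F"
  have "w ^ n \<in> F" if "w \<in> F" for w n by (induction n) (auto simp: F_1 F_mult that)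
  with z show ?thesis by (auto simp: power_int_def F_inverse)
qed

end

section \<open>Finite vector spaces\<close>

lemma bij_betw_linear_combinations:
  fixes scale :: "'a::{field,finite} \<Rightarrow> 'b::ab_group_add \<Rightarrow> 'b"
  assumes "vector_space scale" "\<not> module.dependent scale B" "finite B"
  shows "bij_betw (\<lambda>c. \<Sum>b\<in>B. scale (c b) b) (B \<rightarrow>\<^sub>E UNIV) (module.span scale B)"
proof -
  interpret vector_space scale by fact
  show ?thesis unfolding bij_betw_def
  proof
    show "inj_on (\<lambda>c. \<Sum>b\<in>B. scale (c b) b) (B \<rightarrow>\<^sub>E UNIV)"
    proof (rule inj_onI)
      fix c c' assume c: "c \<in> B \<rightarrow>\<^sub>E UNIV" "c' \<in> B \<rightarrow>\<^sub>E UNIV"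
        and eq: "(\<Sum>b\<in>B. scale (c b) b) = (\<Sum>b\<in>B. scale (c' b) b)"
      have "(\<Sum>b\<in>B. scale (c b - c' b) b) = 0"
        using eq by (simp add: scale_left_diff_distrib sum_subtractf)
      hence "c b - c' b = 0" if "b \<in> B" for b
        using independentD[OF assms(2) assms(3) order_refl _ that, of "\<lambda>b. c b - c' b"] by simp
      thus "c = c'" using c by (intro PiE_ext[of _ B "\<lambda>_. UNIV"]) auto
    qed
    show "(\<lambda>c. \<Sum>b\<in>B. scale (c b) b) ` (B \<rightarrow>\<^sub>E UNIV) = span B"
      unfolding span_finite[OF assms(3)]
    proof safe
      fix u :: "'b \<Rightarrow> 'a"
      show "(\<Sum>v\<in>B. scale (u v) v) \<in> (\<lambda>c. \<Sum>b\<in>B. scale (c b) b) ` (B \<rightarrow>\<^sub>E UNIV)"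
        by (intro image_eqI[of _ _ "restrict u B"]) auto
    qed auto
  qed
qed

text \<open>This is what allows \<open>ell\<close> to be read off from a count of elements.\<close>

lemma card_finite_subspace:
  fixes scale :: "'a::{field,finite} \<Rightarrow> 'b::ab_group_add \<Rightarrow> 'b"
  assumes "vector_space scale" "module.subspace scale W" "finite W"
  shows "card W = CARD('a) ^ vector_space.dim scale W"
proof -
  interpret vector_space scale by fact
  obtain B where B: "B \<subseteq> W" "independent B" "W \<subseteq> span B" "card B = dim W"
    using basis_exists[of W] by blast
  have "finite B" using B(1) assms(3) by (rule finite_subset)
  have "span B = W" using B(1,3) assms(2) by (simp add: span_minimal subset_antisym)
  moreover have "card (B \<rightarrow>\<^sub>E (UNIV :: 'a set)) = CARD('a) ^ card B"
    using \<open>finite B\<close> by (simp add: card_PiE)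
  ultimately show ?thesis
    using bij_betw_same_card[OF bij_betw_linear_combinations[OF assms(1) B(2) \<open>finite B\<close>]] B(4) by simp
qed

lemma vector_space_ring_map:
  fixes g :: "'a::field \<Rightarrow> 'b::field"
  assumes "ring_map g"
  shows "vector_space (\<lambda>c z. g c * z)"
proof -
  interpret ring_map g by fact
  show ?thesis by unfold_locales (simp_all add: algebra_simps)
qed

section \<open>Discrete valuation rings with a residue map\<close>

text \<open>A valuation ring \<open>P\<close> with uniformizer \<open>\<pi>\<close> and with its residue field
  embedded into the algebraic closure of \<open>k\<close> by \<open>\<phi>\<close>.\<close>

locale dvr = as_function_field q m K f p d \<iota> x y
  for q m and K :: "'k::{field,finite} itself" and f p d and \<iota> :: "'k \<Rightarrow> 'f::field" and x y +
  fixes P :: "'f set" and \<phi> :: "'f \<Rightarrow> 'k alg_closure" and \<pi> :: 'f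
  assumes P_F: "P \<subseteq> F"
    and P_const: "\<iota> c \<in> P" and \<phi>_const [simp]: "\<phi> (\<iota> c) = to_ac c"
    and P_diff: "a \<in> P \<Longrightarrow> b \<in> P \<Longrightarrow> a - b \<in> P"
    and \<phi>_diff: "a \<in> P \<Longrightarrow> b \<in> P \<Longrightarrow> \<phi> (a - b) = \<phi> a - \<phi> b"
    and P_mult: "a \<in> P \<Longrightarrow> b \<in> P \<Longrightarrow> a * b \<in> P"
    and \<phi>_mult: "a \<in> P \<Longrightarrow> b \<in> P \<Longrightarrow> \<phi> (a * b) = \<phi> a * \<phi> b"
    and unit_inverse: "a \<in> P \<Longrightarrow> \<phi> a \<noteq> 0 \<Longrightarrow> inverse a \<in> P"
    and \<pi>_P: "\<pi> \<in> P" and \<pi>_nz: "\<pi> \<noteq> 0" and \<phi>_\<pi>: "\<phi> \<pi> = 0"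
    and rep: "z \<in> F \<Longrightarrow> z \<noteq> 0 \<Longrightarrow> \<exists>n u. u \<in> P \<and> \<phi> u \<noteq> 0 \<and> z = \<pi> powi n * u"
    and finite_residue: "finite (\<phi> ` P)"
begin

lemma P_0: "0 \<in> P" and P_1: "1 \<in> P" and \<phi>_0 [simp]: "\<phi> 0 = 0" and \<phi>_1 [simp]: "\<phi> 1 = 1"
  using P_const[of 0] P_const[of 1] \<phi>_const[of 0] \<phi>_const[of 1] by (simp_all del: \<phi>_const)

lemma P_add: "a \<in> P \<Longrightarrow> b \<in> P \<Longrightarrow> a + b \<in> P"
  using P_diff[of a "0 - b"] P_diff[of 0 b] P_0 by simp

lemma \<phi>_add: "a \<in> P \<Longrightarrow> b \<in> P \<Longrightarrow> \<phi> (a + b) = \<phi> a + \<phi> b"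
  using \<phi>_diff[of a "0 - b"] \<phi>_diff[of 0 b] P_diff[of 0 b] P_0 by simp

lemma P_sum: "(\<And>i. i \<in> A \<Longrightarrow> g i \<in> P) \<Longrightarrow> (\<Sum>i\<in>A. g i) \<in> P"
  by (induction A rule: infinite_finite_induct) (auto simp: P_0 P_add)

lemma \<phi>_sum: "(\<And>i. i \<in> A \<Longrightarrow> g i \<in> P) \<Longrightarrow> \<phi> (\<Sum>i\<in>A. g i) = (\<Sum>i\<in>A. \<phi> (g i))"
  by (induction A rule: infinite_finite_induct) (auto simp: P_sum \<phi>_add)

lemma P_power: "a \<in> P \<Longrightarrow> a ^ n \<in> P" and \<phi>_power: "a \<in> P \<Longrightarrow> \<phi> (a ^ n) = \<phi> a ^ n"
proof -
  assume a: "a \<in> P"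
  show "a ^ n \<in> P" for n by (induction n) (auto simp: P_1 P_mult a)
  thus "\<phi> (a ^ n) = \<phi> a ^ n" by (induction n) (auto simp: \<phi>_mult a)
qed

lemma unit_nz: "\<phi> u \<noteq> 0 \<Longrightarrow> u \<noteq> 0"
  by auto

lemma \<phi>_inverse: "u \<in> P \<Longrightarrow> \<phi> u \<noteq> 0 \<Longrightarrow> \<phi> (inverse u) = inverse (\<phi> u)"
  using \<phi>_mult[of u "inverse u"] unit_inverse[of u] unit_nz[of u] by (simp add: field_simps)

lemma unit_divide: "u \<in> P \<Longrightarrow> w \<in> P \<Longrightarrow> \<phi> w \<noteq> 0 \<Longrightarrow> u / w \<in> P \<and> \<phi> (u / w) = \<phi> u / \<phi> w"
  by (simp add: divide_inverse P_mult \<phi>_mult unit_inverse \<phi>_inverse)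

lemma \<phi>_\<pi>_power: "n > 0 \<Longrightarrow> \<phi> (\<pi> ^ n) = 0"
  by (simp add: \<phi>_power \<pi>_P \<phi>_\<pi>)

lemma powi_unit_in_P_iff:
  assumes "u \<in> P" "\<phi> u \<noteq> 0"
  shows "\<pi> powi n * u \<in> P \<longleftrightarrow> n \<ge> 0"
proof
  assume "n \<ge> 0"
  thus "\<pi> powi n * u \<in> P" by (auto simp: power_int_def P_mult P_power \<pi>_P assms)
next
  assume "\<pi> powi n * u \<in> P"
  show "n \<ge> 0"
  proof (rule ccontr)
    assume "\<not> n \<ge> 0"
    hence n: "nat (- n) > 0" by simp
    have "\<pi> ^ nat (- n) * (\<pi> powi n * u) = u"
      using \<open>\<not> n \<ge> 0\<close> \<pi>_nz by (simp add: power_int_def power_inverse)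
    hence "\<phi> u = \<phi> (\<pi> ^ nat (- n)) * \<phi> (\<pi> powi n * u)"
      using \<phi>_mult P_power[OF \<pi>_P] \<open>\<pi> powi n * u \<in> P\<close> by metis
    thus False using \<phi>_\<pi>_power[OF n] assms(2) by simp
  qed
qed

lemma valuation_ring: "z \<in> F \<Longrightarrow> z \<in> P \<or> inverse z \<in> P"
proof (cases "z = 0")
  case False
  assume "z \<in> F"
  then obtain n u where u: "u \<in> P" "\<phi> u \<noteq> 0" "z = \<pi> powi n * u" using rep False by blast
  have "inverse z = \<pi> powi (- n) * inverse u" using u(3) by (simp add: power_int_minus)
  thus ?thesis
    using powi_unit_in_P_iff[OF u(1,2), of n] u(3) \<phi>_inverse[OF u(1,2)]
      powi_unit_in_P_iff[OF unit_inverse[OF u(1,2)], of "- n"] u(2) by force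
qed (simp add: P_0)

lemma max_ideal_eq: "max_ideal P = {a \<in> P. \<phi> a = 0}"
proof -
  have "z = 0 \<or> inverse z \<notin> P \<longleftrightarrow> \<phi> z = 0" if z: "z \<in> P" for z
  proof (cases "z = 0")
    case False
    have "\<phi> z \<noteq> 0" if "inverse z \<in> P"
      using \<phi>_mult[OF z that] False by auto
    thus ?thesis using False unit_inverse[OF z] by blast
  qed simp
  thus ?thesis unfolding max_ideal_def by blast
qed

lemma max_ideal_generator: "max_ideal P = (\<lambda>a. \<pi> * a) ` P"
  unfolding max_ideal_eq
proof safe
  fix z assume z: "z \<in> P" "\<phi> z = 0"
  show "z \<in> (*) \<pi> ` P"
  proof (cases "z = 0")
    case False
    then obtain n u where u: "u \<in> P" "\<phi> u \<noteq> 0" "z = \<pi> powi n * u" using rep P_F z(1) by blast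
    have "n \<ge> 0" using powi_unit_in_P_iff[OF u(1,2)] z(1) u(3) by simp
    moreover have "n \<noteq> 0" using z(2) u by auto
    ultimately have "\<pi> powi (n - 1) * u \<in> P" by (subst powi_unit_in_P_iff[OF u(1,2)]) simp
    moreover have "z = \<pi> * (\<pi> powi (n - 1) * u)"
      using u(3) \<pi>_nz by (simp add: power_int_diff)
    ultimately show ?thesis by blast
  qed (auto intro!: image_eqI[of _ _ 0] P_0)
qed (auto simp: P_mult \<pi>_P \<phi>_mult \<phi>_\<pi>)

lemma inverse_\<pi>_notin: "inverse \<pi> \<notin> P"
  using powi_unit_in_P_iff[of 1 "- 1"] P_1 by simp

lemma place: "is_place \<iota> F P"
proof -
  have "\<pi> \<notin> range \<iota>" using \<phi>_\<pi> \<pi>_nz by auto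
  moreover have "inverse \<pi> \<in> F" using \<pi>_P P_F F_inverse by blast
  ultimately have "range \<iota> \<subset> P" "P \<subset> F"
    using P_const P_F \<pi>_P inverse_\<pi>_notin by auto
  thus ?thesis unfolding is_place_def by (intro conjI ballI P_diff P_mult valuation_ring)
qed

text \<open>An element outside \<open>P\<close> has negative order, so a larger valuation ring would
  contain the inverse of \<open>\<pi>\<close> and then all of \<open>F\<close>. Identifying a place
  therefore takes a single inclusion, and nothing about discreteness of \<open>P'\<close> has to be
  known.\<close>

lemma maximal:
  assumes "is_place \<iota> F P'" "P \<subseteq> P'"
  shows "P' = P"
proof (rule ccontr)
  assume "P' \<noteq> P"
  then obtain z where z: "z \<in> P'" "z \<notin> P" using assms(2) by blast
  have P': "P' \<subset> F" "\<And>a b. a \<in> P' \<Longrightarrow> b \<in> P' \<Longrightarrow> a * b \<in> P'"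
    using assms(1) by (auto simp: is_place_def)
  hence pow: "a ^ n \<in> P'" if "a \<in> P'" for a n
    using that assms(2) P_1 by (induction n) auto
  have "z \<in> F" "z \<noteq> 0" using z P'(1) P_0 by auto
  then obtain n u where u: "u \<in> P" "\<phi> u \<noteq> 0" "z = \<pi> powi n * u" using rep by blast
  have n: "n < 0" using powi_unit_in_P_iff[OF u(1,2), of n] z(2) u(3) by simp
  define w where "w = \<pi> ^ nat (- n - 1) * inverse u"
  have "w \<in> P'" unfolding w_def using assms(2) P_mult[OF P_power[OF \<pi>_P] unit_inverse[OF u(1,2)]] by blast
  hence "z * w \<in> P'" using z(1) P'(2) by blast
  also have "z * w = \<pi> powi n * \<pi> powi (- n - 1)"
    using u unit_nz n by (simp add: w_def power_int_def)
  also have "\<dots> = \<pi> powi (n + (- n - 1))" using \<pi>_nz by (intro power_int_add[symmetric]) simp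
  also have "\<dots> = inverse \<pi>" by simp
  finally have inv: "inverse \<pi> \<in> P'" .
  have "F \<subseteq> P'"
  proof
    fix a assume "a \<in> F"
    show "a \<in> P'"
    proof (cases "a = 0")
      case False
      then obtain n u where u: "u \<in> P" "\<phi> u \<noteq> 0" "a = \<pi> powi n * u" using rep \<open>a \<in> F\<close> by blast
      have "\<pi> powi n \<in> P'" using pow[OF inv] pow[of \<pi>] \<pi>_P assms(2) by (auto simp: power_int_def)
      thus ?thesis using u assms(2) P'(2) by blast
    qed (use assms(2) P_0 in blast)
  qed
  thus False using P'(1) by blast
qed

text \<open>The definite description admits every generator of the maximal ideal. Two generators
  divide each other, so they differ by a unit, and a power of \<open>\<pi>\<close> is a unit only
  for exponent 0.\<close>

lemma place_val_eqI:
  assumes "u \<in> P" "\<phi> u \<noteq> 0" "z = \<pi> powi n * u"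
  shows "place_val P z = n"
  unfolding place_val_def
proof (rule the_equality)
  have "u \<in> P - max_ideal P" using assms by (simp add: max_ideal_eq)
  thus "\<exists>\<pi> u. \<pi> \<in> P \<and> max_ideal P = (\<lambda>a. \<pi> * a) ` P \<and> u \<in> P - max_ideal P \<and> z = \<pi> powi n * u"
    using max_ideal_generator \<pi>_P assms(3) by (intro exI conjI)
  fix n' assume "\<exists>\<pi> u. \<pi> \<in> P \<and> max_ideal P = (\<lambda>a. \<pi> * a) ` P \<and> u \<in> P - max_ideal P \<and> z = \<pi> powi n' * u"
  then obtain \<pi>' u' where *: "\<pi>' \<in> P" "max_ideal P = (\<lambda>a. \<pi>' * a) ` P" "u' \<in> P" "\<phi> u' \<noteq> 0"
    "z = \<pi>' powi n' * u'" by (auto simp: max_ideal_eq)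
  have "\<pi>' * 1 \<in> max_ideal P" unfolding *(2) using P_1 by blast
  then obtain a where a: "a \<in> P" "\<pi>' = \<pi> * a" unfolding max_ideal_generator by auto
  have "\<pi> * 1 \<in> max_ideal P" unfolding max_ideal_generator using P_1 by blast
  then obtain b where b: "b \<in> P" "\<pi> = \<pi>' * b" unfolding *(2) by auto
  have "a * b = 1" using a(2) b(2) \<pi>_nz by (metis mult.assoc mult_cancel_left1)
  hence \<phi>a: "\<phi> a \<noteq> 0" using \<phi>_mult[OF a(1) b(1)] by auto
  have "a powi n' \<in> P \<and> \<phi> (a powi n') \<noteq> 0"
    using a(1) \<phi>a by (auto simp: power_int_def P_power \<phi>_power unit_inverse \<phi>_inverse)
  hence v: "a powi n' * u' / u \<in> P" "\<phi> (a powi n' * u' / u) \<noteq> 0" "inverse (a powi n' * u' / u) \<in> P"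
    using unit_divide[of "a powi n' * u'" u] *(3,4) assms(1,2) unit_inverse[of "a powi n' * u' / u"]
    by (auto simp: P_mult \<phi>_mult)
  have nz: "u \<noteq> 0" "u' \<noteq> 0" "a \<noteq> 0" using assms *(4) \<phi>a by auto
  have "\<pi> powi n * u = \<pi> powi n' * (a powi n' * u')"
    using assms(3) *(5) a(2) by (simp add: power_int_mult_distrib mult.assoc)
  hence eq: "\<pi> powi (n - n') = a powi n' * u' / u"
    using nz \<pi>_nz by (simp add: power_int_diff field_simps)
  have eq': "\<pi> powi (n' - n) = inverse (a powi n' * u' / u)"
    unfolding eq[symmetric] by (metis minus_diff_eq power_int_minus)
  have iff: "\<pi> powi k \<in> P \<longleftrightarrow> k \<ge> 0" for k
    using powi_unit_in_P_iff[OF P_1, of k] by simp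
  have "n - n' \<ge> 0" unfolding iff[symmetric] eq by (rule v(1))
  moreover have "n' - n \<ge> 0" unfolding iff[symmetric] eq' by (rule v(3))
  ultimately show "n' = n" by simp
qed

lemma val_rep:
  assumes "z \<in> F" "z \<noteq> 0"
  obtains u where "u \<in> P" "\<phi> u \<noteq> 0" "z = \<pi> powi (place_val P z) * u"
proof -
  obtain n u where u: "u \<in> P" "\<phi> u \<noteq> 0" "z = \<pi> powi n * u" using rep assms by blast
  with place_val_eqI[OF this] show ?thesis by (intro that) auto
qed

lemma val_mult:
  assumes "z \<in> F" "z \<noteq> 0" "w \<in> F" "w \<noteq> 0"
  shows "place_val P (z * w) = place_val P z + place_val P w"
proof -
  obtain u where u: "u \<in> P" "\<phi> u \<noteq> 0" "z = \<pi> powi (place_val P z) * u" using val_rep assms(1,2) .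
  obtain v where v: "v \<in> P" "\<phi> v \<noteq> 0" "w = \<pi> powi (place_val P w) * v" using val_rep assms(3,4) .
  have "z * w = \<pi> powi (place_val P z + place_val P w) * (u * v)"
    by (subst u(3), subst v(3)) (simp add: power_int_add \<pi>_nz mult_ac)
  thus ?thesis using u v by (intro place_val_eqI[of "u * v"]) (auto simp: P_mult \<phi>_mult)
qed

lemma val_\<pi>_powi: "place_val P (\<pi> powi n) = n"
  by (rule place_val_eqI[OF P_1]) auto

lemma val_unit: "u \<in> P \<Longrightarrow> \<phi> u \<noteq> 0 \<Longrightarrow> place_val P u = 0"
  by (rule place_val_eqI[of u]) auto

lemma in_P_iff: "z \<in> F \<Longrightarrow> z \<noteq> 0 \<Longrightarrow> z \<in> P \<longleftrightarrow> place_val P z \<ge> 0"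
  by (metis powi_unit_in_P_iff val_rep)

lemma val_ge_iff:
  assumes "z \<in> F" "z \<noteq> 0"
  shows "place_val P z \<ge> - a \<longleftrightarrow> z * \<pi> powi a \<in> P"
proof -
  have "\<pi> powi a \<in> F" using \<pi>_P P_F F_powi by blast
  moreover have "\<pi> powi a \<noteq> 0" using \<pi>_nz by simp
  ultimately show ?thesis
    using assms by (subst in_P_iff) (auto simp: val_mult val_\<pi>_powi F_mult)
qed

lemma card_residue_field: "card (\<phi> ` P) = q ^ place_degree \<iota> P"
proof -
  let ?scale = "\<lambda>(c::'k) z. to_ac c * z"
  have vs: "vector_space ?scale" by (intro vector_space_ring_map ring_map_to_ac)
  interpret V: vector_space ?scale by (rule vs)
  define good where "good B \<longleftrightarrow> finite B \<and> B \<subseteq> P \<and>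
    (\<forall>a\<in>P. \<exists>!c. c \<in> B \<rightarrow>\<^sub>E UNIV \<and> a - (\<Sum>b\<in>B. \<iota> (c b) * b) \<in> max_ideal P)" for B
  have sum_P: "(\<Sum>b\<in>B. \<iota> (c b) * b) \<in> P"
    and \<phi>_comb: "\<phi> (\<Sum>b\<in>B. \<iota> (c b) * b) = (\<Sum>b\<in>B. to_ac (c b) * \<phi> b)"
    if "B \<subseteq> P" for B c
    using that by (auto simp: \<phi>_sum \<phi>_mult P_mult P_const P_sum subset_iff)
  have max_iff: "a - (\<Sum>b\<in>B. \<iota> (c b) * b) \<in> max_ideal P \<longleftrightarrow> \<phi> a = (\<Sum>b\<in>B. to_ac (c b) * \<phi> b)"
    if "B \<subseteq> P" "a \<in> P" for B c a
    using sum_P[OF that(1)] \<phi>_comb[OF that(1)] that(2) by (simp add: max_ideal_eq P_diff \<phi>_diff)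
  have card: "card (\<phi> ` P) = q ^ card B" if B: "good B" for B
  proof -
    have BP: "B \<subseteq> P" "finite B" using B by (auto simp: good_def)
    have "bij_betw (\<lambda>c. \<Sum>b\<in>B. to_ac (c b) * \<phi> b) (B \<rightarrow>\<^sub>E UNIV) (\<phi> ` P)"
      unfolding bij_betw_def
    proof
      show "inj_on (\<lambda>c. \<Sum>b\<in>B. to_ac (c b) * \<phi> b) (B \<rightarrow>\<^sub>E UNIV)"
      proof (rule inj_onI)
        fix c c' :: "'f \<Rightarrow> 'k" assume c: "c \<in> B \<rightarrow>\<^sub>E UNIV" "c' \<in> B \<rightarrow>\<^sub>E UNIV"
          and eq: "(\<Sum>b\<in>B. to_ac (c b) * \<phi> b) = (\<Sum>b\<in>B. to_ac (c' b) * \<phi> b)"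
        let ?a = "\<Sum>b\<in>B. \<iota> (c b) * b"
        have "\<phi> ?a = (\<Sum>b\<in>B. to_ac (c b) * \<phi> b)" by (rule \<phi>_comb[OF BP(1)])
        moreover from this have "\<phi> ?a = (\<Sum>b\<in>B. to_ac (c' b) * \<phi> b)" unfolding eq .
        ultimately have "?a - (\<Sum>b\<in>B. \<iota> (c b) * b) \<in> max_ideal P"
          "?a - (\<Sum>b\<in>B. \<iota> (c' b) * b) \<in> max_ideal P"
          by (simp_all only: max_iff[OF BP(1) sum_P[OF BP(1)]])
        thus "c = c'" using B sum_P[OF BP(1), of c] c unfolding good_def by blast
      qed
      show "(\<lambda>c. \<Sum>b\<in>B. to_ac (c b) * \<phi> b) ` (B \<rightarrow>\<^sub>E UNIV) = \<phi> ` P"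
      proof safe
        fix c :: "'f \<Rightarrow> 'k"
        show "(\<Sum>b\<in>B. to_ac (c b) * \<phi> b) \<in> \<phi> ` P"
          by (rule image_eqI[OF _ sum_P[OF BP(1), of c]]) (simp add: \<phi>_comb[OF BP(1)])
      next
        fix a assume a: "a \<in> P"
        then obtain c where "c \<in> B \<rightarrow>\<^sub>E UNIV" "a - (\<Sum>b\<in>B. \<iota> (c b) * b) \<in> max_ideal P"
          using B unfolding good_def by blast
        thus "\<phi> a \<in> (\<lambda>c. \<Sum>b\<in>B. to_ac (c b) * \<phi> b) ` (B \<rightarrow>\<^sub>E UNIV)"
          using max_iff[OF BP(1) a] by blast
      qed
    qed
    from bij_betw_same_card[OF this] show ?thesis
      using BP(2) by (simp add: card_PiE q_def)
  qed
  have "\<exists>B. good B"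
  proof -
    have sub: "V.subspace (\<phi> ` P)"
    proof (rule V.subspaceI)
      show "0 \<in> \<phi> ` P" using P_0 by (intro image_eqI[of _ _ 0]) auto
      show "u + v \<in> \<phi> ` P" if "u \<in> \<phi> ` P" "v \<in> \<phi> ` P" for u v
        using that P_add by (auto simp flip: \<phi>_add)
      show "to_ac c * u \<in> \<phi> ` P" if u: "u \<in> \<phi> ` P" for u c
      proof -
        obtain v where v: "v \<in> P" "u = \<phi> v" using u by blast
        hence "to_ac c * u = \<phi> (\<iota> c * v)" by (simp add: \<phi>_mult P_const)
        thus ?thesis using P_mult[OF P_const v(1)] by blast
      qed
    qed
    obtain B where B: "B \<subseteq> \<phi> ` P" "V.independent B" "\<phi> ` P \<subseteq> V.span B"
      "card B = V.dim (\<phi> ` P)"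
      by (rule V.basis_exists)
    have "finite B" using B(1) finite_residue by (rule finite_subset)
    have span: "V.span B = \<phi> ` P" using B(1,3) sub by (simp add: V.span_minimal subset_antisym)
    obtain C where C: "C \<subseteq> P" "inj_on \<phi> C" "\<phi> ` C = B"
      using B(1) by (metis subset_image_inj)
    have "finite C" using C \<open>finite B\<close> finite_image_iff by blast
    have bij: "bij_betw (\<lambda>c. \<Sum>b\<in>B. to_ac (c b) * b) (B \<rightarrow>\<^sub>E UNIV) (\<phi> ` P)"
      using bij_betw_linear_combinations[OF vs B(2) \<open>finite B\<close>] span by simp
    have sumC: "(\<Sum>b\<in>C. to_ac (c (\<phi> b)) * \<phi> b) = (\<Sum>b\<in>B. to_ac (c b) * b)" for c
      using C by (simp add: sum.reindex flip: C(3))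
    have "\<exists>!c. c \<in> C \<rightarrow>\<^sub>E UNIV \<and> a - (\<Sum>b\<in>C. \<iota> (c b) * b) \<in> max_ideal P" if a: "a \<in> P" for a
    proof -
      have "\<phi> a \<in> (\<lambda>c. \<Sum>b\<in>B. to_ac (c b) * b) ` (B \<rightarrow>\<^sub>E UNIV)"
        using bij a unfolding bij_betw_def by blast
      then obtain c where c: "c \<in> B \<rightarrow>\<^sub>E UNIV" "\<phi> a = (\<Sum>b\<in>B. to_ac (c b) * b)" by blast
      have "c' = restrict (\<lambda>b. c (\<phi> b)) C" if c': "c' \<in> C \<rightarrow>\<^sub>E UNIV" "\<phi> a = (\<Sum>b\<in>C. to_ac (c' b) * \<phi> b)" for c'
      proof -
        define c'' where "c'' = restrict (\<lambda>b. c' (inv_into C \<phi> b)) B"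
        have c''_\<phi>: "c'' (\<phi> b) = c' b" if "b \<in> C" for b
          using that C by (auto simp: c''_def)
        have "(\<Sum>b\<in>B. to_ac (c'' b) * b) = (\<Sum>b\<in>C. to_ac (c' b) * \<phi> b)"
          unfolding sumC[symmetric] by (intro sum.cong) (auto simp: c''_\<phi>)
        hence "(\<Sum>b\<in>B. to_ac (c'' b) * b) = (\<Sum>b\<in>B. to_ac (c b) * b)" using c(2) c'(2) by simp
        moreover have "c'' \<in> B \<rightarrow>\<^sub>E UNIV" by (auto simp: c''_def)
        ultimately have "c'' = c" using bij c(1) by (auto simp: bij_betw_def dest: inj_onD)
        thus ?thesis using c'(1) c''_\<phi> by (intro PiE_ext[OF c'(1)]) auto
      qed
      moreover have "\<phi> a = (\<Sum>b\<in>C. to_ac (restrict (\<lambda>b. c (\<phi> b)) C b) * \<phi> b)"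
        using c(2) sumC[of c] by simp
      ultimately show ?thesis unfolding max_iff[OF C(1) a]
        by (intro ex1I[of _ "restrict (\<lambda>b. c (\<phi> b)) C"]) auto
    qed
    with C(1) \<open>finite C\<close> have "good C" unfolding good_def by (intro conjI ballI)
    thus ?thesis by (rule exI)
  qed
  then obtain B where B: "good B" by blast
  have "place_degree \<iota> P = card B"
    unfolding place_degree_def
  proof (rule the_equality)
    show "\<exists>B'. finite B' \<and> card B' = card B \<and> B' \<subseteq> P \<and>
      (\<forall>a\<in>P. \<exists>!c. c \<in> B' \<rightarrow>\<^sub>E UNIV \<and> a - (\<Sum>b\<in>B'. \<iota> (c b) * b) \<in> max_ideal P)"
      using B by (auto simp: good_def)
    fix n assume "\<exists>B'. finite B' \<and> card B' = n \<and> B' \<subseteq> P \<and>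
      (\<forall>a\<in>P. \<exists>!c. c \<in> B' \<rightarrow>\<^sub>E UNIV \<and> a - (\<Sum>b\<in>B'. \<iota> (c b) * b) \<in> max_ideal P)"
    then obtain B' where "good B'" "card B' = n" by (auto simp: good_def)
    hence "q ^ n = q ^ card B" using card[of B'] card[OF B] by simp
    thus "n = card B" using q_ge_2 by (simp add: power_inject_exp)
  qed
  thus ?thesis using card[OF B] by simp
qed

end

section \<open>Local rings of points\<close>

text \<open>The local ring at an affine point and at infinity arise in the same way from an
  increasing family of spaces of polynomials with compatible values \<open>h w\<close>; for an affine point
  the family is constant.\<close>

locale point_data = as_function_field q m K f p d \<iota> x y
  for q m and K :: "'k::{field,finite} itself" and f p d and \<iota> :: "'k \<Rightarrow> 'f::field" and x y +
  fixes U :: "nat \<Rightarrow> 'k poly poly set" and h :: "nat \<Rightarrow> 'k poly poly \<Rightarrow> 'k alg_closure"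
  assumes U_diff: "A \<in> U w \<Longrightarrow> B \<in> U w \<Longrightarrow> A - B \<in> U w"
    and h_diff: "A \<in> U w \<Longrightarrow> B \<in> U w \<Longrightarrow> h w (A - B) = h w A - h w B"
    and U_mult: "A \<in> U v \<Longrightarrow> B \<in> U w \<Longrightarrow> A * B \<in> U (v + w)"
    and h_mult: "A \<in> U v \<Longrightarrow> B \<in> U w \<Longrightarrow> h (v + w) (A * B) = h v A * h w B"
    and h_dvd: "A \<in> U w \<Longrightarrow> G dvd A \<Longrightarrow> h w A = 0"
    and U_const: "[:[:c:]:] \<in> U 0" and h_const: "h 0 [:[:c:]:] = to_ac c"
begin

text \<open>Numerator and denominator are measured in the same level \<open>w\<close>. At infinity
  this says that the numerator has no larger pole than the denominator, and the residue is the
  quotient of the leading coefficients.\<close>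

definition is_frac :: "'f \<Rightarrow> 'k alg_closure \<Rightarrow> bool" where
  "is_frac z a \<longleftrightarrow> (\<exists>A B w. A \<in> U w \<and> B \<in> U w \<and> h w B \<noteq> 0 \<and> z = ev A / ev B \<and> a = h w A / h w B)"

definition loc :: "'f set" where "loc = {z. \<exists>a. is_frac z a}"

definition res :: "'f \<Rightarrow> 'k alg_closure" where "res z = (SOME a. is_frac z a)"

lemma h_nz: "B \<in> U w \<Longrightarrow> h w B \<noteq> 0 \<Longrightarrow> ev B \<noteq> 0"
  using h_dvd kernel by blast

lemma is_fracI: "A \<in> U w \<Longrightarrow> B \<in> U w \<Longrightarrow> h w B \<noteq> 0 \<Longrightarrow> is_frac (ev A / ev B) (h w A / h w B)"
  unfolding is_frac_def by blast

lemma is_frac_unique: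
  assumes "is_frac z a" "is_frac z b"
  shows "a = b"
proof -
  obtain A B v where 1: "A \<in> U v" "B \<in> U v" "h v B \<noteq> 0" "z = ev A / ev B" "a = h v A / h v B"
    using assms(1) by (auto simp: is_frac_def)
  obtain A' B' w where 2: "A' \<in> U w" "B' \<in> U w" "h w B' \<noteq> 0" "z = ev A' / ev B'" "b = h w A' / h w B'"
    using assms(2) by (auto simp: is_frac_def)
  have nz: "ev B \<noteq> 0" "ev B' \<noteq> 0" using h_nz 1 2 by auto
  have "ev (A * B' - B * A') = 0" using 1(4) 2(4) nz by (simp add: field_simps)
  hence "G dvd A * B' - B * A'" using kernel by blast
  moreover have "A * B' \<in> U (v + w)" "B * A' \<in> U (v + w)" using 1 2 by (auto intro: U_mult)
  ultimately have "h (v + w) (A * B') - h (v + w) (B * A') = 0"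
    by (simp add: h_dvd U_diff flip: h_diff)
  hence "h v A * h w B' = h v B * h w A'" using 1 2 by (simp only: h_mult right_minus_eq)
  thus ?thesis unfolding 1(5) 2(5) using 1(3) 2(3) by (simp add: frac_eq_eq mult.commute)
qed

lemma res_eqI: "is_frac z a \<Longrightarrow> res z = a"
  unfolding res_def using is_frac_unique by blast

lemma locI: "is_frac z a \<Longrightarrow> z \<in> loc"
  by (auto simp: loc_def)

lemma is_frac_res: "z \<in> loc \<Longrightarrow> is_frac z (res z)"
  unfolding loc_def using res_eqI by blast

lemma is_frac_diff:
  assumes "is_frac z a" "is_frac z' a'"
  shows "is_frac (z - z') (a - a')"
proof -
  obtain A B v where 1: "A \<in> U v" "B \<in> U v" "h v B \<noteq> 0" "z = ev A / ev B" "a = h v A / h v B"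
    using assms(1) by (auto simp: is_frac_def)
  obtain A' B' w where 2: "A' \<in> U w" "B' \<in> U w" "h w B' \<noteq> 0" "z' = ev A' / ev B'" "a' = h w A' / h w B'"
    using assms(2) by (auto simp: is_frac_def)
  have nz: "ev B \<noteq> 0" "ev B' \<noteq> 0" using h_nz 1 2 by auto
  have U: "A * B' \<in> U (v + w)" "B * A' \<in> U (v + w)" "B * B' \<in> U (v + w)" using 1 2 by (auto intro: U_mult)
  have "h (v + w) (B * B') \<noteq> 0" using 1 2 by (simp add: h_mult)
  note frac = is_fracI[OF U_diff[OF U(1,2)] U(3) this]
  have "z - z' = ev (A * B' - B * A') / ev (B * B')"
    unfolding 1(4) 2(4) using nz by (simp add: diff_frac_eq mult.commute)
  moreover have "a - a' = h (v + w) (A * B' - B * A') / h (v + w) (B * B')"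
    unfolding 1(5) 2(5) h_diff[OF U(1,2)] h_mult[OF 1(1) 2(2)] h_mult[OF 1(2) 2(1)] h_mult[OF 1(2) 2(2)]
    using 1(3) 2(3) by (simp add: diff_frac_eq mult.commute)
  ultimately show ?thesis using frac by simp
qed

lemma is_frac_mult:
  assumes "is_frac z a" "is_frac z' a'"
  shows "is_frac (z * z') (a * a')"
proof -
  obtain A B v where 1: "A \<in> U v" "B \<in> U v" "h v B \<noteq> 0" "z = ev A / ev B" "a = h v A / h v B"
    using assms(1) by (auto simp: is_frac_def)
  obtain A' B' w where 2: "A' \<in> U w" "B' \<in> U w" "h w B' \<noteq> 0" "z' = ev A' / ev B'" "a' = h w A' / h w B'"
    using assms(2) by (auto simp: is_frac_def)
  have U: "A * A' \<in> U (v + w)" "B * B' \<in> U (v + w)" using 1 2 by (auto intro: U_mult)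
  have "h (v + w) (B * B') \<noteq> 0" using 1 2 by (simp add: h_mult)
  from is_fracI[OF U this] show ?thesis using 1 2 by (simp add: h_mult)
qed

lemma is_frac_inverse: "is_frac z a \<Longrightarrow> a \<noteq> 0 \<Longrightarrow> is_frac (inverse z) (inverse a)"
  unfolding is_frac_def by clarsimp blast

lemma is_frac_const: "is_frac (\<iota> c) (to_ac c)"
proof -
  have "[:[:1:]:] \<in> U 0" "h 0 [:[:1:]:] = 1" using h_const[of 1] U_const[of 1] by simp_all
  with is_fracI[OF U_const[of c] U_const[of 1]] show ?thesis
    by (simp add: h_const)
qed

lemma loc_subset: "loc \<subseteq> F"
  by (auto simp: loc_def is_frac_def ev_divide_in_F)

lemma dvrI:
  assumes "is_frac \<pi> 0" "\<pi> \<noteq> 0"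
    and "\<And>z. z \<in> F \<Longrightarrow> z \<noteq> 0 \<Longrightarrow> \<exists>n u a. is_frac u a \<and> a \<noteq> 0 \<and> z = \<pi> powi n * u"
    and "finite (res ` loc)"
  shows "dvr q m f p d \<iota> x y loc res \<pi>"
proof unfold_locales
  show "loc \<subseteq> F" by (rule loc_subset)
  show "\<iota> c \<in> loc" "res (\<iota> c) = to_ac c" for c
    using is_frac_const by (auto intro: locI res_eqI)
  show "a - b \<in> loc" "res (a - b) = res a - res b" if "a \<in> loc" "b \<in> loc" for a b
    using is_frac_diff[OF is_frac_res is_frac_res] that by (auto intro: locI res_eqI)
  show "a * b \<in> loc" "res (a * b) = res a * res b" if "a \<in> loc" "b \<in> loc" for a b
    using is_frac_mult[OF is_frac_res is_frac_res] that by (auto intro: locI res_eqI)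
  show "inverse a \<in> loc" if "a \<in> loc" "res a \<noteq> 0" for a
    using is_frac_inverse[OF is_frac_res] that by (auto intro: locI)
  show "\<pi> \<in> loc" "\<pi> \<noteq> 0" "res \<pi> = 0" using assms(1,2) by (auto intro: locI res_eqI)
  show "\<exists>n u. u \<in> loc \<and> res u \<noteq> 0 \<and> z = \<pi> powi n * u" if "z \<in> F" "z \<noteq> 0" for z
    using assms(3)[OF that] locI res_eqI by metis
  show "finite (res ` loc)" by fact
qed

end

subsection \<open>Affine points\<close>

context as_curve
begin

abbreviation evs :: "'k alg_closure \<times> 'k alg_closure \<Rightarrow> 'k poly poly \<Rightarrow> 'k alg_closure" where
  "evs s A \<equiv> eval2 to_ac A (fst s) (snd s)"

sublocale to_ac: ring_map "to_ac :: 'k \<Rightarrow> _" by (rule ring_map_to_ac)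

sublocale evs: ring_map "evs s" for s by (intro ring_map_eval2 ring_map_to_ac)

sublocale ev1: ring_map "\<lambda>h :: 'k poly. poly (map_poly to_ac h) a" for a by (rule to_ac.ring_map_eval)

definition pts :: "('k alg_closure \<times> 'k alg_closure) set" where
  "pts = {s. snd s ^ p - snd s = poly (map_poly to_ac f) (fst s)}"

lemma evs_C [simp]: "evs s [:h:] = poly (map_poly to_ac h) (fst s)"
  by (rule eval2_C[OF ring_map_to_ac])

lemma evs_monom: "evs s (monom h j) = poly (map_poly to_ac h) (fst s) * snd s ^ j"
  by (rule eval2_monom[OF ring_map_to_ac])

lemma evs_G: "s \<in> pts \<Longrightarrow> evs s G = 0"
  by (simp add: G_def evs_monom pts_def)

lemma evs_dvd: "s \<in> pts \<Longrightarrow> G dvd A \<Longrightarrow> evs s A = 0"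
  using evs_G by (auto elim!: dvdE)

lemma frob_evs: "evs s A ^ (q ^ i) = evs (fst s ^ (q ^ i), snd s ^ (q ^ i)) A"
  using frob_eval2 by simp

lemma frob_pts:
  assumes "s \<in> pts"
  shows "(fst s ^ (q ^ i), snd s ^ (q ^ i)) \<in> pts"
proof -
  interpret F: ring_map "\<lambda>a :: 'k alg_closure. a ^ (q ^ i)" by (rule ring_map_frob)
  have "(snd s ^ p - snd s) ^ (q ^ i) = poly (map_poly to_ac f) (fst s) ^ (q ^ i)"
    using assms by (simp add: pts_def)
  thus ?thesis unfolding pts_def frob_eval F.map_diff by (simp flip: power_mult add: mult.commute)
qed

text \<open>The derivative of \<open>Y ^ p - Y - c\<close> is -1: the cover is unramified over the
  affine line.\<close>

lemma card_fibre: "card {b. (a, b) \<in> pts} = p" and finite_fibre: "finite {b. (a, b) \<in> pts}"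
proof -
  define c where "c = poly (map_poly to_ac f) a"
  define Q :: "'k alg_closure poly" where "Q = monom 1 p - monom 1 1 - [:c:]"
  have "of_nat p = (0 :: 'k alg_closure)" using of_nat_p by (metis to_ac_0 to_ac_of_nat)
  hence "pderiv Q = [:- 1:]" unfolding Q_def
    by (simp add: pderiv_diff pderiv_monom monom_0 pderiv_pCons)
  hence "card {b. poly Q b = 0} = degree Q" by (rule card_roots_separable) simp
  also have "degree Q = p" unfolding Q_def using p_ge_2
    by (intro antisym degree_diff_le le_degree) (auto simp: degree_monom_eq coeff_pCons split: nat.splits)
  also have "{b. poly Q b = 0} = {b. (a, b) \<in> pts}"
    by (simp add: Q_def poly_monom pts_def c_def)
  finally show "card {b. (a, b) \<in> pts} = p" .
  thus "finite {b. (a, b) \<in> pts}" using p_ge_2 by (metis card.infinite not_numeral_le_zero)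
qed

text \<open>On the fibre over \<open>a\<close> a reduced \<open>A\<close> is a polynomial in
  \<open>y\<close> of degree below \<open>p\<close> with \<open>p\<close> distinct roots, so all its
  coefficients vanish at \<open>a\<close>.\<close>

lemma vanish_fibre:
  assumes "degree A < p" "\<And>b. (a, b) \<in> pts \<Longrightarrow> evs (a, b) A = 0"
  shows "poly (map_poly to_ac (coeff A j)) a = 0"
proof -
  define Q where "Q = map_poly (\<lambda>h. poly (map_poly to_ac h) a) A"
  have "{b. (a, b) \<in> pts} \<subseteq> {b. poly Q b = 0}"
    using assms(2) by (auto simp: Q_def eval2_def)
  have "Q = 0"
  proof (rule ccontr)
    assume "Q \<noteq> 0"
    hence "p \<le> card {b. poly Q b = 0}"
      using \<open>_ \<subseteq> _\<close> card_fibre[of a] poly_roots_finite by (metis card_mono)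
    also have "\<dots> \<le> degree Q" using \<open>Q \<noteq> 0\<close> by (rule card_poly_roots_bound)
    also have "\<dots> < p" using assms(1) map_poly_degree_leq[of _ A] le_less_trans unfolding Q_def by blast
    finally show False by simp
  qed
  thus ?thesis using coeff_map_poly[of "\<lambda>h. poly (map_poly to_ac h) a" A j] by (simp add: Q_def)
qed

text \<open>Unlike \<open>x - a\<close> this has coefficients in the base field, so it defines an
  element of the function field; its zeros are simple and are exactly the elements of the subfield
  of order \<open>q ^ r\<close>.\<close>

definition pi_r :: "nat \<Rightarrow> 'k poly" where "pi_r r = monom 1 (q ^ r) - monom 1 1"

lemma eval_pi_r [simp]: "poly (map_poly to_ac (pi_r r)) a = a ^ (q ^ r) - a"
  by (simp add: pi_r_def)

lemma one_less_qr: "r > 0 \<Longrightarrow> q ^ r > 1"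
  using q_ge_2 by (intro one_less_power) auto

lemma degree_pi_r: "r > 0 \<Longrightarrow> degree (pi_r r) = q ^ r"
  using one_less_qr[of r] unfolding pi_r_def
  by (intro antisym degree_diff_le le_degree) (auto simp: degree_monom_eq)

lemma pi_r_nz: "r > 0 \<Longrightarrow> pi_r r \<noteq> 0"
  using degree_pi_r[of r] one_less_qr[of r] by (metis degree_0 not_one_less_zero)

lemma pi_r_dvd:
  assumes "r > 0" "\<And>a. a ^ (q ^ r) = a \<Longrightarrow> poly (map_poly to_ac h) a = 0"
  shows "pi_r r dvd h"
proof (rule ccontr)
  assume "\<not> pi_r r dvd h"
  define g where "g = h mod pi_r r"
  have g: "g \<noteq> 0" using \<open>\<not> pi_r r dvd h\<close> by (simp add: g_def mod_eq_0_iff_dvd)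
  hence deg: "degree g < q ^ r" using degree_mod_less[OF pi_r_nz[OF assms(1)], of h] degree_pi_r[OF assms(1)]
    by (simp add: g_def)
  have "g = h - pi_r r * (h div pi_r r)" by (simp add: g_def minus_mult_div_eq_mod)
  hence sub: "{a. a ^ (q ^ r) = a} \<subseteq> {a. poly (map_poly to_ac g) a = 0}" using assms(2) by auto
  have nz: "map_poly to_ac g \<noteq> 0" using g by (simp add: map_poly_eq_0_iff)
  have "q ^ r \<le> card {a. poly (map_poly to_ac g) a = 0}"
    using card_mono[OF poly_roots_finite[OF nz] sub] card_subfield[OF assms(1)] by simp
  also have "\<dots> \<le> degree (map_poly to_ac g)" using nz by (rule card_poly_roots_bound)
  also have "\<dots> \<le> degree g" by (rule map_poly_degree_leq)
  finally show False using deg by simp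
qed

definition pts_r :: "nat \<Rightarrow> ('k alg_closure \<times> 'k alg_closure) set" where
  "pts_r r = {s \<in> pts. fst s ^ (q ^ r) = fst s}"

lemma finite_pts_r: "r > 0 \<Longrightarrow> finite (pts_r r)" and card_pts_r: "r > 0 \<Longrightarrow> card (pts_r r) = p * q ^ r"
proof -
  assume r: "r > 0"
  have *: "pts_r r = (SIGMA a:{a. a ^ (q ^ r) = a}. {b. (a, b) \<in> pts})"
    by (auto simp: pts_r_def)
  show "finite (pts_r r)" unfolding *
    by (intro finite_SigmaI finite_subfield[OF r] finite_fibre)
  show "card (pts_r r) = p * q ^ r" unfolding *
    using r by (subst card_SigmaI) (auto simp: finite_subfield finite_fibre card_fibre card_subfield)
qed

lemma vanish_pts_r:
  assumes "r > 0" "degree A < p" "\<And>s. s \<in> pts_r r \<Longrightarrow> evs s A = 0"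
  shows "[:pi_r r:] dvd A"
  unfolding const_poly_dvd_iff
  using assms(3) by (intro allI pi_r_dvd assms(1) vanish_fibre[OF assms(2)]) (auto simp: pts_r_def)

lemma evs_subfield:
  obtains r where "r > 0" "fst s ^ (q ^ r) = fst s" "\<And>A. evs s A ^ (q ^ r) = evs s A"
proof -
  obtain r where r: "r > 0" "fst s ^ (q ^ r) = fst s" "snd s ^ (q ^ r) = snd s"
    by (rule in_finite_subfield2)
  thus ?thesis by (intro that[of r]) (auto simp: frob_evs)
qed

text \<open>The values at \<open>s\<close> lie in one finite field, and \<open>M\<close> is an
  exponent of its unit group. Thus \<open>1 - A ^ M\<close> vanishes at \<open>s\<close> when
  \<open>A\<close> does not, which replaces inverting \<open>A\<close> modulo the point.\<close>

lemma evs_power_one: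
  obtains M where "\<And>A. evs s A \<noteq> 0 \<Longrightarrow> evs s (A ^ M) = 1" "M > 0"
proof -
  obtain r where r: "r > 0" "\<And>A. evs s A ^ (q ^ r) = evs s A"
    by (rule evs_subfield[of s]) (rule that)
  have "evs s (A ^ (q ^ r - 1)) = 1" if "evs s A \<noteq> 0" for A
  proof -
    have "evs s A * evs s A ^ (q ^ r - 1) = evs s A"
      using r(2)[of A] one_less_qr[OF r(1)] by (metis Suc_diff_1 less_imp_Suc_add less_trans power_Suc zero_less_one zero_less_Suc)
    thus ?thesis using that by simp
  qed
  with one_less_qr[OF r(1)] show ?thesis by (intro that[of "q ^ r - 1"]) auto
qed

text \<open>The kernel of evaluation is a maximal ideal, so inclusion of two such kernels is
  equality.\<close>

lemma evs_kernel_maximal: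
  assumes "\<And>B. evs s' B = 0 \<Longrightarrow> evs s B = 0" "evs s A = 0"
  shows "evs s' A = 0"
proof (rule ccontr)
  assume "evs s' A \<noteq> 0"
  obtain M where M: "\<And>A. evs s' A \<noteq> 0 \<Longrightarrow> evs s' (A ^ M) = 1" "M > 0" 
    by (rule evs_power_one[of s']) (rule that)
  have "evs s' (1 - A ^ M) = 0" using M(1)[OF \<open>evs s' A \<noteq> 0\<close>] by simp
  hence "evs s (1 - A ^ M) = 0" by (rule assms(1))
  thus False using assms(2) M(2) by (simp add: zero_power)
qed

end

section \<open>Uniformizers and orders at affine points\<close>

context as_function_field
begin

text \<open>\<open>B\<close> is a product of polynomials that kill the points of
  \<open>pts_r r\<close> distinguishable from \<open>s\<close> but not \<open>s\<close> itself. At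
  the remaining points, the conjugates of \<open>s\<close>, \<open>A\<close> vanishes by itself. So
  \<open>A * B\<close> vanishes on all of \<open>pts_r r\<close>, and its reduced form is divisible
  by \<open>pi_r r\<close>.\<close>

lemma local_uniformizer:
  assumes s: "s \<in> pts" "fst s ^ (q ^ r) = fst s" "r > 0" and A: "evs s A = 0"
  obtains B C where "evs s B \<noteq> 0" "ev A * ev B = ev [:pi_r r:] * ev C"
proof -
  define S where "S = {s' \<in> pts_r r. \<exists>B. evs s' B = 0 \<and> evs s B \<noteq> 0}"
  have fin: "finite S" using finite_pts_r[OF s(3)] by (simp add: S_def)
  define b where "b s' = (SOME B. evs s' B = 0 \<and> evs s B \<noteq> 0)" for s'
  have b: "evs s' (b s') = 0" "evs s (b s') \<noteq> 0" if "s' \<in> S" for s'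
  proof -
    have "\<exists>B. evs s' B = 0 \<and> evs s B \<noteq> 0" using that by (simp add: S_def)
    from someI_ex[OF this] show "evs s' (b s') = 0" "evs s (b s') \<noteq> 0" by (auto simp: b_def)
  qed
  define B where "B = (\<Prod>s'\<in>S. b s')"
  have B: "evs s B \<noteq> 0" using b(2) fin by (simp add: B_def)
  obtain C where C: "degree C < p" "ev C = ev (A * B)" by (rule ev_reduce)
  have "evs s' C = 0" if s': "s' \<in> pts_r r" for s'
  proof -
    have "G dvd A * B - C" using C(2) by (metis ev_eq_iff)
    hence "evs s' (A * B - C) = 0" using s' by (intro evs_dvd) (auto simp: pts_r_def)
    moreover have "evs s' (A * B) = 0"
    proof (cases "s' \<in> S")
      case True
      hence "evs s' B = 0" using b(1)[OF True] fin by (auto simp: B_def)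
      thus ?thesis by simp
    next
      case False
      hence "\<And>B. evs s' B = 0 \<Longrightarrow> evs s B = 0" using s' by (auto simp: S_def)
      from evs_kernel_maximal[OF this A] show ?thesis by simp
    qed
    ultimately show ?thesis by simp
  qed
  hence "[:pi_r r:] dvd C" by (intro vanish_pts_r s(3) C(1))
  then obtain D where "C = [:pi_r r:] * D" by (elim dvdE)
  hence "ev C = ev [:pi_r r:] * ev D" by (simp only: ev.map_mult)
  hence "ev A * ev B = ev [:pi_r r:] * ev D" using C(2) by simp
  with B show ?thesis by (rule that)
qed

text \<open>Some \<open>y\<close>-coefficient of the reduced form of \<open>B\<close> is nonzero at
  the \<open>x\<close>-coordinate \<open>a\<close> of the point. Comparing coefficients, the
  \<open>n\<close>-th power of \<open>X - a\<close> divides \<open>N\<close> times it, so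
  \<open>N\<close> itself has order at least \<open>n\<close> at \<open>a\<close>.\<close>

lemma local_order_bound:
  assumes s: "s \<in> pts" "fst s ^ (q ^ r) = fst s" "r > 0" and "N \<noteq> 0"
    and B: "evs s B \<noteq> 0" and eq: "ev [:N:] * ev B = ev [:pi_r r:] ^ n * ev C"
  shows "n \<le> degree N"
proof -
  let ?m = "map_poly (to_ac :: 'k \<Rightarrow> _)" and ?a = "fst s"
  interpret m: ring_map ?m by (rule to_ac.ring_map_map_poly)
  obtain B1 where B1: "degree B1 < p" "ev B1 = ev B" by (rule ev_reduce)
  obtain C1 where C1: "degree C1 < p" "ev C1 = ev C" by (rule ev_reduce)
  have "[:pi_r r ^ n:] = [:pi_r r:] ^ n"
  proof (induction n)
    case (Suc n)
    have "[:pi_r r ^ Suc n:] = [:pi_r r:] * [:pi_r r ^ n:]" by simp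
    thus ?case unfolding Suc.IH by simp
  qed (simp add: one_pCons)
  hence "ev ([:N:] * B1 - [:pi_r r ^ n:] * C1) = 0"
    unfolding ev.map_diff ev.map_mult B1(2) C1(2) using eq by simp
  moreover have "degree ([:N:] * B1 - [:pi_r r ^ n:] * C1) < p"
    using B1(1) C1(1) degree_mult_le[of "[:N:]" B1] degree_mult_le[of "[:pi_r r ^ n:]" C1]
    by (intro degree_diff_less) auto
  ultimately have "[:N:] * B1 - [:pi_r r ^ n:] * C1 = 0" using ev_eq_0_iff by blast
  hence eq1: "N * coeff B1 j = pi_r r ^ n * coeff C1 j" for j
    by (metis (no_types) coeff_smult eq_iff_diff_eq_0 mult_pCons_left pCons_0_0 add_0_right mult_zero_left)
  have "G dvd B1 - B" using B1(2) by (simp add: ev_eq_iff)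
  hence "evs s (B1 - B) = 0" using s(1) evs_dvd by blast
  hence "evs s B1 \<noteq> 0" using B by simp
  then obtain j where j: "poly (?m (coeff B1 j)) ?a \<noteq> 0"
    using eval2_altdef[OF ring_map_to_ac order_refl, of B1 "fst s" "snd s"]
    by (metis (no_types, lifting) mult_zero_left sum.neutral)
  define N' where "N' = ?m N"
  define b where "b = ?m (coeff B1 j)"
  have nz: "N' \<noteq> 0" "b \<noteq> 0" using \<open>N \<noteq> 0\<close> j by (auto simp: N'_def b_def map_poly_eq_0_iff)
  have "poly (?m (pi_r r)) ?a = 0" using s(2) by simp
  hence "[:- ?a, 1:] dvd ?m (pi_r r)" using poly_eq_0_iff_dvd by blast
  hence "[:- ?a, 1:] ^ n dvd ?m (pi_r r ^ n * coeff C1 j)" by (simp add: dvd_power_same)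
  hence "[:- ?a, 1:] ^ n dvd N' * b" unfolding eq1[symmetric] by (simp add: N'_def b_def)
  hence "n \<le> order ?a (N' * b)" using nz by (simp add: order_divides)
  also have "\<dots> = order ?a N' + order ?a b" using nz by (intro order_mult) auto
  also have "order ?a b = 0" using j by (simp add: b_def order_root)
  also have "order ?a N' + 0 \<le> degree N'" using order_degree[OF nz(1)] by simp
  also have "\<dots> \<le> degree N" unfolding N'_def by (rule map_poly_degree_leq)
  finally show ?thesis .
qed

text \<open>Extract \<open>pi_r r\<close> as often as possible. Multiplying by \<open>A'\<close>
  turns \<open>A\<close> into a polynomial in \<open>x\<close>, for which
  \<open>local_order_bound\<close> limits the exponent; at the maximal exponent \<open>C\<close>
  cannot vanish at \<open>s\<close>, or \<open>local_uniformizer\<close> would extract one more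
  factor.\<close>

lemma local_factorization:
  assumes s: "s \<in> pts" "fst s ^ (q ^ r) = fst s" "r > 0" and "ev A \<noteq> 0"
  obtains n B C where "evs s B \<noteq> 0" "evs s C \<noteq> 0" "ev A * ev B = ev [:pi_r r:] ^ n * ev C"
proof -
  obtain A' N where N: "N \<noteq> 0" "ev A * ev A' = ev [:N:]" using rationalize[OF assms(4)] .
  define R where "R n \<longleftrightarrow> (\<exists>B C. evs s B \<noteq> 0 \<and> ev A * ev B = ev [:pi_r r:] ^ n * ev C)" for n
  have "R 0" unfolding R_def by (rule exI[of _ 1], rule exI[of _ A]) simp
  moreover have "n \<le> degree N" if Rn: "R n" for n
  proof -
    obtain B C where BC: "evs s B \<noteq> 0" "ev A * ev B = ev [:pi_r r:] ^ n * ev C" using Rn by (auto simp: R_def)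
    have "ev [:N:] * ev B = ev A' * (ev A * ev B)" by (simp add: mult_ac flip: N(2))
    also have "\<dots> = ev [:pi_r r:] ^ n * ev (C * A')" unfolding BC(2) by (simp add: mult_ac)
    finally show ?thesis using local_order_bound[OF s N(1) BC(1)] by blast
  qed
  ultimately have "\<exists>n. R n \<and> (\<forall>k. R k \<longrightarrow> k \<le> n)"
    using ex_has_greatest_nat[of R 0 id "Suc (degree N)"] by (simp add: less_Suc_eq_le)
  then obtain n where n: "R n" "\<And>k. R k \<Longrightarrow> k \<le> n" by blast
  then obtain B C where BC: "evs s B \<noteq> 0" "ev A * ev B = ev [:pi_r r:] ^ n * ev C" by (auto simp: R_def)
  have "evs s C \<noteq> 0"
  proof
    assume "evs s C = 0"
    then obtain B' C' where B': "evs s B' \<noteq> 0" "ev C * ev B' = ev [:pi_r r:] * ev C'"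
      by (rule local_uniformizer[OF s])
    have "ev A * ev (B * B') = (ev A * ev B) * ev B'" by (simp add: mult_ac)
    also have "\<dots> = ev [:pi_r r:] ^ n * (ev C * ev B')" unfolding BC(2) by (simp add: mult_ac)
    also have "\<dots> = ev [:pi_r r:] ^ Suc n * ev C'" unfolding B'(2) by (simp add: mult_ac)
    finally have "ev A * ev (B * B') = ev [:pi_r r:] ^ Suc n * ev C'" .
    moreover have "evs s (B * B') \<noteq> 0" using BC(1) B'(1) by simp
    ultimately have "R (Suc n)" unfolding R_def by blast
    thus False using n(2) by fastforce
  qed
  with BC show ?thesis by (intro that)
qed


abbreviation aff_ring :: "'k alg_closure \<times> 'k alg_closure \<Rightarrow> 'f set" where
  "aff_ring s \<equiv> point_data.loc \<iota> x y (\<lambda>_. UNIV) (\<lambda>_. evs s)"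

abbreviation aff_res :: "'k alg_closure \<times> 'k alg_closure \<Rightarrow> 'f \<Rightarrow> 'k alg_closure" where
  "aff_res s \<equiv> point_data.res \<iota> x y (\<lambda>_. UNIV) (\<lambda>_. evs s)"

lemma aff_point_data:
  assumes "s \<in> pts"
  shows "point_data q m f p d \<iota> x y (\<lambda>_. UNIV) (\<lambda>_. evs s)"
  by unfold_locales (auto simp: evs_dvd[OF assms])

lemma aff_ringI: "s \<in> pts \<Longrightarrow> evs s B \<noteq> 0 \<Longrightarrow> ev A / ev B \<in> aff_ring s"
  and aff_res_eq: "s \<in> pts \<Longrightarrow> evs s B \<noteq> 0 \<Longrightarrow> aff_res s (ev A / ev B) = evs s A / evs s B"
proof -
  assume s: "s \<in> pts" "evs s B \<noteq> 0"
  interpret point_data q m K f p d \<iota> x y "\<lambda>_. UNIV" "\<lambda>_. evs s" by (rule aff_point_data[OF s(1)])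
  have "is_frac (ev A / ev B) (evs s A / evs s B)" using s(2) by (intro is_fracI) auto
  thus "ev A / ev B \<in> aff_ring s" "aff_res s (ev A / ev B) = evs s A / evs s B"
    by (auto intro: locI res_eqI)
qed

lemma aff_ringE:
  assumes "s \<in> pts" "z \<in> aff_ring s"
  obtains A B where "evs s B \<noteq> 0" "z = ev A / ev B"
proof -
  interpret point_data q m K f p d \<iota> x y "\<lambda>_. UNIV" "\<lambda>_. evs s" by (rule aff_point_data[OF assms(1)])
  show ?thesis using assms(2) that by (auto simp: loc_def is_frac_def)
qed

lemma aff_ring_ev: "s \<in> pts \<Longrightarrow> ev A \<in> aff_ring s"
  and aff_res_ev: "s \<in> pts \<Longrightarrow> aff_res s (ev A) = evs s A"
  using aff_ringI[of s 1 A] aff_res_eq[of s 1 A] by auto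

lemma evs_nz_imp_ev_nz: "s \<in> pts \<Longrightarrow> evs s B \<noteq> 0 \<Longrightarrow> ev B \<noteq> 0"
  using evs_dvd kernel by blast

lemma aff_dvr:
  assumes s: "s \<in> pts" "fst s ^ (q ^ r) = fst s" "r > 0"
  shows "dvr q m f p d \<iota> x y (aff_ring s) (aff_res s) (ev [:pi_r r:])"
proof -
  interpret point_data q m K f p d \<iota> x y "\<lambda>_. UNIV" "\<lambda>_. evs s" by (rule aff_point_data[OF s(1)])
  show ?thesis
  proof (rule dvrI)
    show "is_frac (ev [:pi_r r:]) 0" using is_fracI[where A = "[:pi_r r:]" and B = 1] s(2) by simp
    show "ev [:pi_r r:] \<noteq> 0" using pi_r_nz[OF s(3)] by simp
    show "\<exists>n u a. is_frac u a \<and> a \<noteq> 0 \<and> z = ev [:pi_r r:] powi n * u" if z: "z \<in> F" "z \<noteq> 0" for z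
    proof -
      obtain A N where zA: "degree A < p" "N \<noteq> 0" "z = ev A / ev [:N:]" using F_rep[OF z(1)] .
      have "ev A \<noteq> 0" "ev [:N:] \<noteq> 0" using z(2) zA by auto
      obtain n B C where 1: "evs s B \<noteq> 0" "evs s C \<noteq> 0" "ev A * ev B = ev [:pi_r r:] ^ n * ev C"
        using local_factorization[OF s \<open>ev A \<noteq> 0\<close>] .
      obtain n' B' C' where 2: "evs s B' \<noteq> 0" "evs s C' \<noteq> 0" "ev [:N:] * ev B' = ev [:pi_r r:] ^ n' * ev C'"
        using local_factorization[OF s \<open>ev [:N:] \<noteq> 0\<close>] .
      have nz: "ev B \<noteq> 0" "ev C \<noteq> 0" "ev B' \<noteq> 0" "ev C' \<noteq> 0" "ev [:pi_r r:] \<noteq> 0"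
        using 1 2 evs_nz_imp_ev_nz[OF s(1)] pi_r_nz[OF s(3)] by auto
      have A: "ev A = ev [:pi_r r:] ^ n * ev C / ev B" and N: "ev [:N:] = ev [:pi_r r:] ^ n' * ev C' / ev B'"
        using 1(3) 2(3) nz by (simp_all add: eq_divide_eq)
      have "z = ev [:pi_r r:] powi (int n - int n') * (ev (C * B') / ev (B * C'))"
        unfolding zA(3) A N using nz by (simp add: power_int_diff field_simps)
      moreover have "is_frac (ev (C * B') / ev (B * C')) (evs s (C * B') / evs s (B * C'))"
        using 1 2 by (intro is_fracI) auto
      moreover have "evs s (C * B') / evs s (B * C') \<noteq> 0" using 1 2 by simp
      ultimately show ?thesis by blast
    qed
    show "finite (res ` loc)"
    proof -
      obtain r where r: "r > 0" "\<And>A. evs s A ^ (q ^ r) = evs s A"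
        by (rule evs_subfield[of s]) (rule that)
      have "res ` loc \<subseteq> {a. a ^ (q ^ r) = a}"
        using is_frac_res r(2) by (fastforce simp: is_frac_def power_divide)
      thus ?thesis using finite_subfield[OF r(1)] by (rule finite_subset)
    qed
  qed
qed

subsection \<open>The point at infinity\<close>

abbreviation inf_ring :: "'f set" where
  "inf_ring \<equiv> point_data.loc \<iota> x y (\<lambda>w. {A. wle w A}) (\<lambda>w A. to_ac (lam w A))"

abbreviation inf_res :: "'f \<Rightarrow> 'k alg_closure" where
  "inf_res \<equiv> point_data.res \<iota> x y (\<lambda>w. {A. wle w A}) (\<lambda>w A. to_ac (lam w A))"

lemma wle_monom_1: "wle (d * j) (monom 1 j)" "wle (p * i) [:monom 1 i:]"
  using wle_monom[of 1 j] wle_C[of "monom 1 i"] by (simp_all add: degree_monom_eq)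

lemma lam_monom_1: "lam (d * j) (monom 1 j) = 1" "lam (p * i) [:monom 1 i:] = 1"
proof -
  interpret P: ring_map "\<lambda>h :: 'k poly. h \<circ>\<^sub>p monom 1 p" by (rule ring_map_pcompose)
  show "lam (d * j) (monom 1 j) = 1"
    unfolding lam_def Psi_def by (simp add: monom_power)
  show "lam (p * i) [:monom 1 i:] = 1" using p_ge_2
    unfolding lam_def Psi_def by (simp add: coeff_pcompose_monom)
qed

lemma inf_point_data: "point_data q m f p d \<iota> x y (\<lambda>w. {A. wle w A}) (\<lambda>w A. to_ac (lam w A))"
proof unfold_locales
  show "[:[:c:]:] \<in> {A. wle 0 A}" for c using wle_C[of "[:c:]"] by simp
  show "to_ac (lam 0 [:[:c:]:]) = to_ac c" for c
    using lam_reduced[of "[:[:c:]:]" 0 0] p_ge_2 by simp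
qed (auto simp: wle_diff lam_diff wle_mult lam_mult lam_dvd)

lemma inf_dvr:
  obtains \<pi> where "dvr q m f p d \<iota> x y inf_ring inf_res \<pi>"
    "\<And>A w. wle w A \<Longrightarrow> lam w A \<noteq> 0 \<Longrightarrow> place_val inf_ring (ev A) = - int w"
    "inf_res ` inf_ring = range to_ac" "inverse x \<in> inf_ring"
proof -
  interpret point_data q m K f p d \<iota> x y "\<lambda>w. {A. wle w A}" "\<lambda>w A. to_ac (lam w A)" by (rule inf_point_data)
  \<comment> \<open>The orders of \<open>x\<close> and \<open>y\<close> at infinity are
    \<open>- p\<close> and \<open>- d\<close>, so \<open>y ^ b / x ^ a\<close> gets order
    \<open>p * a - d * b = 1\<close>.\<close>
  obtain a b where ab: "p * a = d * b + 1"
    using bezout_nat[of p d] coprime_p_d p_ge_2 by (auto simp: coprime_iff_gcd_eq_1)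
  define \<pi> where "\<pi> = ev (monom 1 b) / ev [:monom 1 a:]"
  have nz: "\<pi> \<noteq> 0" unfolding \<pi>_def
    using ev_nz[OF wle_monom_1(1)] ev_nz[OF wle_monom_1(2)] lam_monom_1 by simp
  have frac0: "is_frac \<pi> 0"
  proof -
    have "wle (p * a) (monom 1 b)" unfolding ab by (rule wle_mono[OF wle_monom_1(1)]) simp
    moreover have "lam (p * a) (monom 1 b) = 0" unfolding ab by (rule lam_eq_0[OF wle_monom_1(1)]) simp
    ultimately show ?thesis unfolding \<pi>_def
      using is_fracI[of "monom 1 b" "p * a" "[:monom 1 a:]"] wle_monom_1 lam_monom_1 by simp
  qed
  \<comment> \<open>Numerator \<open>A * y ^ (b * w)\<close> and denominator
    \<open>x ^ (a * w)\<close> are compared in the common weight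
    \<open>p * a * w = w + d * b * w\<close>.\<close>
  have frac: "is_frac (ev A * \<pi> ^ w) (to_ac (lam w A))" if A: "wle w A" for A w
  proof -
    have "p * (a * w) = w + d * (b * w)" using arg_cong[OF ab, of "\<lambda>t. t * w"] by (simp add: algebra_simps)
    moreover from this have "lam (w + d * (b * w)) [:monom 1 (a * w):] = 1"
      using lam_monom_1(2)[of "a * w"] by simp
    moreover have "ev [:monom 1 (a * w):] = ev [:monom 1 a:] ^ w" "ev (monom 1 (b * w)) = ev (monom 1 b) ^ w"
      by (simp_all add: ev_C eval2_monom ring_map_\<iota> power_mult)
    ultimately show ?thesis
      using is_fracI[of "A * monom 1 (b * w)" "p * (a * w)" "[:monom 1 (a * w):]"] A
        wle_mult[OF A wle_monom_1(1), of "b * w"] lam_mult[OF A wle_monom_1(1), of "b * w"]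
        wle_monom_1(2)[of "a * w"] lam_monom_1
      by (simp add: \<pi>_def power_divide)
  qed
  have dvr: "dvr q m f p d \<iota> x y inf_ring inf_res \<pi>"
  proof (rule dvrI[OF frac0 nz])
    show "\<exists>n u a. is_frac u a \<and> a \<noteq> 0 \<and> z = \<pi> powi n * u" if z: "z \<in> F" "z \<noteq> 0" for z
    proof -
      obtain A N where zA: "degree A < p" "N \<noteq> 0" "z = ev A / ev [:N:]" using F_rep[OF z(1)] .
      have nz': "ev A \<noteq> 0" "ev [:N:] \<noteq> 0" using z(2) zA by auto
      have "A \<noteq> 0" "[:N:] \<noteq> 0" "degree [:N:] < p" using nz' p_ge_2 by auto
      obtain v where v: "wle v A" "lam v A \<noteq> 0"
        by (rule exists_weight[OF \<open>A \<noteq> 0\<close> zA(1)])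
      obtain w where w: "wle w [:N:]" "lam w [:N:] \<noteq> 0"
        by (rule exists_weight[OF \<open>[:N:] \<noteq> 0\<close> \<open>degree [:N:] < p\<close>])
      have "is_frac (ev A * \<pi> ^ v * inverse (ev [:N:] * \<pi> ^ w)) (to_ac (lam v A) * inverse (to_ac (lam w [:N:])))"
        using v w by (intro is_frac_mult is_frac_inverse frac) auto
      moreover have "z = \<pi> powi (int w - int v) * (ev A * \<pi> ^ v * inverse (ev [:N:] * \<pi> ^ w))"
        unfolding zA(3) using nz nz' by (simp add: power_int_diff field_simps)
      moreover have "to_ac (lam v A) * inverse (to_ac (lam w [:N:])) \<noteq> 0" using v w by simp
      ultimately show ?thesis by blast
    qed
    have "res ` loc \<subseteq> range to_ac"
      using is_frac_res by (force simp: is_frac_def simp flip: to_ac_divide)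
    thus "finite (res ` loc)" by (rule finite_subset) simp
  qed
  interpret D: dvr q m K f p d \<iota> x y inf_ring inf_res \<pi> by (rule dvr)
  show ?thesis
  proof (rule that[OF dvr])
    show "place_val inf_ring (ev A) = - int w" if "wle w A" "lam w A \<noteq> 0" for A w
      using frac[OF that(1)] that(2) nz
      by (intro D.place_val_eqI[of "ev A * \<pi> ^ w"]) (auto intro: locI simp: res_eqI power_int_minus field_simps)
    have "res ` loc \<subseteq> range to_ac"
      using is_frac_res by (force simp: is_frac_def simp flip: to_ac_divide)
    moreover have "to_ac c \<in> res ` loc" for c
      using D.P_const[of c] by (intro image_eqI[of _ _ "\<iota> c"]) auto
    ultimately show "inf_res ` inf_ring = range to_ac" by blast
    have "wle (p * 1) 1" using wle_mono[OF wle_C[of 1], of p] by (simp add: one_pCons)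
    hence "is_frac (ev 1 / ev [:monom 1 1:]) (to_ac (lam (p * 1) 1) / to_ac (lam (p * 1) [:monom 1 1:]))"
      using wle_monom_1(2)[of 1] lam_monom_1(2)[of 1] by (intro is_fracI) auto
    from locI[OF this] show "inverse x \<in> inf_ring" by (simp only: ev_x ev.map_1 inverse_eq_divide)
  qed
qed

end

section \<open>Classification of the places\<close>

locale place_ring = as_function_field q m K f p d \<iota> x y
  for q m and K :: "'k::{field,finite} itself" and f p d and \<iota> :: "'k \<Rightarrow> 'f::field" and x y +
  fixes P :: "'f set"
  assumes place: "is_place \<iota> F P"
begin

abbreviation "M \<equiv> max_ideal P"

lemma P_const: "\<iota> c \<in> P" and P_F: "P \<subseteq> F" and P_ne_F: "P \<noteq> F"
  and P_diff: "a \<in> P \<Longrightarrow> b \<in> P \<Longrightarrow> a - b \<in> P" and P_mult: "a \<in> P \<Longrightarrow> b \<in> P \<Longrightarrow> a * b \<in> P"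
  and P_inverse: "z \<in> F \<Longrightarrow> z \<notin> P \<Longrightarrow> inverse z \<in> P"
  using place by (auto simp: is_place_def)

lemma P_0: "0 \<in> P" and P_1: "1 \<in> P"
  using P_const[of 0] P_const[of 1] by auto

lemma P_add: "a \<in> P \<Longrightarrow> b \<in> P \<Longrightarrow> a + b \<in> P"
  using P_diff[of a "0 - b"] P_diff[of 0 b] P_0 by simp

lemma P_power: "a \<in> P \<Longrightarrow> a ^ n \<in> P"
  by (induction n) (auto simp: P_1 P_mult)

lemma P_sum: "(\<And>i. i \<in> A \<Longrightarrow> g i \<in> P) \<Longrightarrow> (\<Sum>i\<in>A. g i) \<in> P"
  by (induction A rule: infinite_finite_induct) (auto simp: P_0 P_add)

lemma M_P: "a \<in> M \<Longrightarrow> a \<in> P" and M_0: "0 \<in> M" and one_notin_M: "1 \<notin> M"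
  using P_0 P_1 by (auto simp: max_ideal_def)

lemma unit_inverse: "a \<in> P \<Longrightarrow> a \<notin> M \<Longrightarrow> inverse a \<in> P"
  by (auto simp: max_ideal_def)

lemma notin_imp_inverse_M:
  assumes "z \<in> F" "z \<notin> P"
  shows "inverse z \<in> M"
  using P_inverse[OF assms] assms(2) by (simp add: max_ideal_def)

lemma M_mult:
  assumes "a \<in> M" "b \<in> P"
  shows "a * b \<in> M"
proof -
  have "inverse a \<in> P" if "a * b \<noteq> 0" "inverse (a * b) \<in> P"
  proof -
    have eq: "inverse a = b * inverse (a * b)" using that(1) by (simp add: field_simps)
    show ?thesis unfolding eq by (rule P_mult[OF assms(2) that(2)])
  qed
  thus ?thesis using assms P_mult by (auto simp: max_ideal_def)
qed

lemma M_mult': "a \<in> P \<Longrightarrow> b \<in> M \<Longrightarrow> a * b \<in> M"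
  using M_mult[of b a] by (simp add: mult.commute)

lemma M_power: "a \<in> M \<Longrightarrow> n > 0 \<Longrightarrow> a ^ n \<in> M"
  by (cases n) (auto intro: M_mult P_power M_P)

lemma M_add:
  assumes "a \<in> M" "b \<in> M"
  shows "a + b \<in> M"
proof -
  have *: "a + b \<in> M" if "a \<in> M" "b \<in> M" "b \<noteq> 0" "a / b \<in> P" for a b
  proof -
    have "a + b = b * (1 + a / b)" using that(3) by (simp add: field_simps)
    thus ?thesis using M_mult[OF that(2) P_add[OF P_1 that(4)]] by simp
  qed
  have F: "a \<in> F" "b \<in> F" using assms M_P P_F by auto
  show ?thesis
  proof (cases "a = 0 \<or> b = 0")
    case False
    have "a / b \<in> P \<or> b / a \<in> P"
      using P_inverse[of "a / b"] F F_mult F_inverse by (auto simp: divide_inverse mult.commute)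
    thus ?thesis using *[OF assms] *[OF assms(2,1)] False by (auto simp: add.commute)
  qed (use assms in auto)
qed

lemma M_diff: "a \<in> M \<Longrightarrow> b \<in> M \<Longrightarrow> a - b \<in> M"
  using M_add[of a "- b"] M_mult[of b "- 1"] P_const[of "- 1"] by simp

lemma M_sum: "(\<And>i. i \<in> A \<Longrightarrow> g i \<in> M) \<Longrightarrow> (\<Sum>i\<in>A. g i) \<in> M"
  by (induction A rule: infinite_finite_induct) (auto simp: M_0 M_add)

lemma M_prime:
  assumes "a \<in> P" "b \<in> P" "a * b \<in> M"
  shows "a \<in> M \<or> b \<in> M"
proof (rule ccontr)
  assume *: "\<not> (a \<in> M \<or> b \<in> M)"
  hence "inverse a \<in> P" "inverse b \<in> P" using unit_inverse assms by auto
  hence "a * b * (inverse a * inverse b) \<in> M" using M_mult assms(3) P_mult by blast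
  moreover have "a \<noteq> 0" "b \<noteq> 0" using * M_0 by auto
  hence "a * b * (inverse a * inverse b) = 1" by (simp add: field_simps)
  ultimately show False using one_notin_M by simp
qed

lemma M_prime_power: "a \<in> P \<Longrightarrow> a ^ n \<in> M \<Longrightarrow> a \<in> M"
  by (induction n) (use one_notin_M M_prime P_power in auto)

lemma M_prime_prod:
  assumes "finite A" "\<And>i. i \<in> A \<Longrightarrow> g i \<in> P" "\<And>i. i \<in> A \<Longrightarrow> g i \<notin> M"
  shows "(\<Prod>i\<in>A. g i) \<in> P \<and> (\<Prod>i\<in>A. g i) \<notin> M"
  using assms by (induction A rule: finite_induct) (auto simp: P_1 one_notin_M P_mult dest: M_prime)

lemma x_F: "x \<in> F" and y_F: "y \<in> F"
  using ev_in_F[of "[:monom 1 1:]"] ev_in_F[of "monom 1 1"] by (simp_all add: ev_x ev_y del: One_nat_def)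

lemma curve_eq: "y ^ p - y = poly (map_poly \<iota> f) x"
proof -
  have "ev G = 0" using kernel by simp
  thus ?thesis by (simp add: G_def eval2_monom ring_map_\<iota> ev_C)
qed

lemma poly_in_P: "x \<in> P \<Longrightarrow> poly (map_poly \<iota> h) x \<in> P"
  by (induction h) (auto simp: P_0 P_add P_mult P_const)

text \<open>\<open>y\<close> is integral over the polynomials in \<open>x\<close>: dividing the
  equation by \<open>y ^ (p - 1)\<close> writes \<open>y\<close> through powers of its
  inverse.\<close>

lemma y_in_P:
  assumes "x \<in> P"
  shows "y \<in> P"
proof (rule ccontr)
  assume y: "y \<notin> P"
  hence v: "inverse y \<in> P" using P_inverse y_F by blast
  have "y \<noteq> 0" using y P_0 by auto
  have p: "p - 1 = Suc (p - 2)" using p_ge_2 by auto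
  have yp: "y ^ p = y ^ (p - 1) * y" using p_ge_2 by (cases p) auto
  have "y = (inverse y * y) ^ (p - 1) * y" using \<open>y \<noteq> 0\<close> by simp
  also have "\<dots> = inverse y ^ (p - 1) * y ^ p" by (simp only: power_mult_distrib yp mult.assoc)
  also have "y ^ p = y + poly (map_poly \<iota> f) x" by (simp flip: curve_eq)
  also have "inverse y ^ (p - 1) * (y + poly (map_poly \<iota> f) x) =
      inverse y ^ (p - 2) + inverse y ^ (p - 1) * poly (map_poly \<iota> f) x"
    using \<open>y \<noteq> 0\<close> by (subst (1 2) p) (simp add: algebra_simps)
  also have "\<dots> \<in> P" by (intro P_add P_mult P_power v poly_in_P assms)
  finally show False using y by simp
qed

lemma ev_in_P: "x \<in> P \<Longrightarrow> ev A \<in> P"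
  unfolding eval2_altdef[OF ring_map_\<iota> order_refl]
  by (intro P_sum P_mult P_power y_in_P poly_in_P)

text \<open>Otherwise every denominator in \<open>F_rep\<close> would be a unit of \<open>P\<close>,
  and \<open>P\<close> would be all of \<open>F\<close>.\<close>

lemma exists_polynomial_in_M:
  assumes x: "x \<in> P"
  obtains N where "N \<noteq> 0" "ev [:N:] \<in> M"
proof -
  have "\<exists>N. N \<noteq> 0 \<and> ev [:N:] \<in> M"
  proof (rule ccontr)
    assume *: "\<not> ?thesis"
    have "F \<subseteq> P"
    proof
      fix z assume "z \<in> F"
      then obtain A N where "N \<noteq> 0" "z = ev A / ev [:N:]" by (rule F_rep)
      thus "z \<in> P" using * ev_in_P[OF x] unit_inverse[of "ev [:N:]"]
        by (auto simp: divide_inverse intro: P_mult)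
    qed
    thus False using P_F P_ne_F by blast
  qed
  thus ?thesis using that by blast
qed

text \<open>The polynomial \<open>N\<close> of least degree in the maximal ideal fixes the
  \<open>x\<close>-coordinate \<open>a\<close> up to conjugation: its factor \<open>h\<close>, the
  minimal polynomial of \<open>a\<close>, already lies in \<open>M\<close>. It remains to find a
  point above \<open>a\<close> and to show that its local ring is contained in
  \<open>P\<close>.\<close>

lemma aff_place:
  assumes x: "x \<in> P"
  obtains s where "s \<in> pts" "P = aff_ring s"
proof -
  define R where "R N \<longleftrightarrow> N \<noteq> 0 \<and> ev [:N:] \<in> M" for N
  obtain N0 where "R N0" using exists_polynomial_in_M[OF x] unfolding R_def by blast
  then obtain N where N: "R N" "\<And>N'. R N' \<Longrightarrow> degree N \<le> degree N'"
    using ex_has_least_nat[of R N0 degree] by blast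
  have degN: "degree N > 0"
  proof (rule ccontr)
    assume "\<not> degree N > 0"
    then obtain c where c: "N = [:c:]" using degree_eq_zeroE[of N] by auto
    hence "\<iota> c * \<iota> (inverse c) \<in> M" using N(1) by (intro M_mult P_const) (simp add: R_def)
    moreover have "\<iota> c * \<iota> (inverse c) = \<iota> (c * inverse c)" by simp
    moreover have "c * inverse c = 1" using c N(1) by (simp add: R_def)
    ultimately show False using one_notin_M by simp
  qed
  have "degree (map_poly (to_ac :: 'k \<Rightarrow> _) N) > 0" using degN by (subst degree_map_poly) auto
  then obtain a where a: "poly (map_poly (to_ac :: 'k \<Rightarrow> _) N) a = 0"
    using alg_closed_imp_poly_has_root by blast
  obtain h :: "'k poly" where h: "h \<noteq> 0" "poly (map_poly to_ac h) a = 0"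
    "\<And>c. poly (map_poly to_ac c) a = 0 \<Longrightarrow> h dvd c"
    using minimal_polynomial[of a] by blast
  have "ev [:h:] \<in> M"
  proof -
    obtain h' where h': "N = h * h'" using h(3)[OF a] by (elim dvdE)
    hence nz: "h' \<noteq> 0" using N(1) by (auto simp: R_def)
    have "degree h > 0"
    proof (rule ccontr)
      assume "\<not> degree h > 0"
      then obtain c where "h = [:c:]" using degree_eq_zeroE[of h] by auto
      thus False using h(1,2) by simp
    qed
    hence "degree h' < degree N" using h' h(1) nz by (simp add: degree_mult_eq)
    hence "ev [:h':] \<notin> M" using N(2)[of h'] nz by (auto simp: R_def)
    moreover have "[:N:] = [:h:] * [:h':]" using h' by simp
    hence "ev [:N:] = ev [:h:] * ev [:h':]" by (simp only: ev.map_mult)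
    ultimately show ?thesis using N(1) M_prime[of "ev [:h:]" "ev [:h':]"] ev_in_P[OF x] by (auto simp: R_def)
  qed
  \<comment> \<open>If each point over \<open>a\<close> had a polynomial vanishing there with value
    outside \<open>M\<close>, their product would vanish on the whole fibre, be divisible by
    \<open>h\<close> and so lie in \<open>M\<close>, against primality.\<close>
  have "\<exists>s. s \<in> pts \<and> (\<forall>A. evs s A = 0 \<longrightarrow> ev A \<in> M)"
  proof (rule ccontr)
    assume *: "\<not> ?thesis"
    define S where "S = {b. (a, b) \<in> pts}"
    define A where "A b = (SOME A. evs (a, b) A = 0 \<and> ev A \<notin> M)" for b
    have A: "evs (a, b) (A b) = 0" "ev (A b) \<notin> M" if "b \<in> S" for b
    proof -
      have "\<exists>A. evs (a, b) A = 0 \<and> ev A \<notin> M" using * that unfolding S_def by blast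
      from someI_ex[OF this] show "evs (a, b) (A b) = 0" "ev (A b) \<notin> M" unfolding A_def by auto
    qed
    have fin: "finite S" unfolding S_def by (rule finite_fibre)
    have "ev (\<Prod>b\<in>S. A b) \<notin> M" using M_prime_prod[OF fin, of "\<lambda>b. ev (A b)"] A(2) ev_in_P[OF x] by simp
    obtain C where C: "degree C < p" "ev C = ev (\<Prod>b\<in>S. A b)" by (rule ev_reduce)
    have "h dvd coeff C j" for j
    proof (intro h(3) vanish_fibre[OF C(1)])
      fix b assume b: "(a, b) \<in> pts"
      have "G dvd C - (\<Prod>b\<in>S. A b)" using C(2) by (simp only: ev_eq_iff)
      hence "evs (a, b) (C - (\<Prod>b\<in>S. A b)) = 0" using b evs_dvd by blast
      hence "evs (a, b) C - evs (a, b) (\<Prod>b\<in>S. A b) = 0" by (simp only: evs.map_diff)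
      moreover have "evs (a, b) (\<Prod>b\<in>S. A b) = (\<Prod>b'\<in>S. evs (a, b) (A b'))"
        by (rule evs.map_prod)
      moreover have "(\<Prod>b'\<in>S. evs (a, b) (A b')) = 0"
        using b A(1)[of b] by (intro prod_zero[OF fin]) (auto simp: S_def)
      ultimately show "evs (a, b) C = 0" by simp
    qed
    hence "[:h:] dvd C" by (simp add: const_poly_dvd_iff)
    then obtain C' where "C = [:h:] * C'" by (elim dvdE)
    hence "ev C = ev [:h:] * ev C'" by (simp only: ev.map_mult)
    hence "ev C \<in> M" using \<open>ev [:h:] \<in> M\<close> ev_in_P[OF x] M_mult by simp
    thus False using C(2) \<open>ev (\<Prod>b\<in>S. A b) \<notin> M\<close> by simp
  qed
  then obtain s where s: "s \<in> pts" "\<And>A. evs s A = 0 \<Longrightarrow> ev A \<in> M" by blast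
  \<comment> \<open>\<open>1 - B ^ k\<close> vanishes at \<open>s\<close>, so its value lies in
    \<open>M\<close>; with \<open>ev B\<close> in \<open>M\<close> this would put 1 there.\<close>
  have notin: "ev B \<notin> M" if B: "evs s B \<noteq> 0" for B
  proof
    assume "ev B \<in> M"
    obtain k where k: "evs s (B ^ k) = 1" "k > 0"
      by (rule evs_power_one[of s]) (use B in blast)
    have "ev (1 - B ^ k) \<in> M" using k(1) by (intro s(2)) simp
    moreover have "ev (B ^ k) \<in> M" using M_power[OF \<open>ev B \<in> M\<close> k(2)] by simp
    ultimately have "ev (1 - B ^ k) + ev (B ^ k) \<in> M" by (rule M_add)
    thus False using one_notin_M by simp
  qed
  have "aff_ring s \<subseteq> P"
  proof
    fix z assume "z \<in> aff_ring s"
    then obtain A B where "evs s B \<noteq> 0" "z = ev A / ev B" by (rule aff_ringE[OF s(1)])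
    thus "z \<in> P" using notin ev_in_P[OF x] unit_inverse by (auto simp: divide_inverse intro: P_mult)
  qed
  moreover obtain r where r: "r > 0" "fst s ^ (q ^ r) = fst s"
    by (rule in_finite_subfield)
  interpret D: dvr q m K f p d \<iota> x y "aff_ring s" "aff_res s" "ev [:pi_r r:]"
    by (rule aff_dvr[OF s(1) r(2,1)])
  have "P = aff_ring s" using D.maximal[OF place] calculation by blast
  with s(1) show ?thesis by (rule that)
qed

text \<open>Modulo \<open>M\<close> both \<open>f(x) / x ^ d\<close> and \<open>f(x) / y ^ p\<close>
  are 1, so \<open>y ^ p\<close> is a unit times \<open>x ^ d\<close>. This forces the orders of
  \<open>x\<close> and \<open>y\<close> to be in ratio \<open>p : d\<close> and thus recovers the
  weights inside \<open>P\<close>.\<close>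

lemma inf_place:
  assumes x: "x \<notin> P"
  shows "P = inf_ring"
proof -
  define v where "v = inverse x"
  have x0: "x \<noteq> 0" using x P_0 by auto
  have v: "v \<in> M" unfolding v_def using x x_F by (intro notin_imp_inverse_M)
  have vP: "v \<in> P" using v by (rule M_P)
  define fx where "fx = poly (map_poly \<iota> f) x"
  have e1: "fx * v ^ d - 1 \<in> M"
  proof -
    have "fx * v ^ d = (\<Sum>i\<le>d. \<iota> (coeff f i) * v ^ (d - i))"
      unfolding fx_def \<iota>.eval_altdef[OF eq_refl[OF degree_f]] sum_distrib_right
    proof (rule sum.cong)
      fix i assume "i \<in> {..d}"
      hence "v ^ d = v ^ i * v ^ (d - i)" by (simp flip: power_add)
      thus "\<iota> (coeff f i) * x ^ i * v ^ d = \<iota> (coeff f i) * v ^ (d - i)"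
        using x0 by (simp add: v_def power_inverse)
    qed simp
    also have "\<dots> = (\<Sum>i<d. \<iota> (coeff f i) * v ^ (d - i)) + 1"
      using monic_f degree_f by (simp add: lessThan_Suc_atMost[symmetric])
    finally have "fx * v ^ d - 1 = (\<Sum>i<d. \<iota> (coeff f i) * v ^ (d - i))" by simp
    also have "\<dots> \<in> M" by (intro M_sum M_mult' M_power v P_const) auto
    finally show ?thesis .
  qed
  have e1M: "fx * v ^ d \<notin> M" using M_diff[of "fx * v ^ d", OF _ e1] one_notin_M by auto
  have e1P: "fx * v ^ d \<in> P" using P_add[OF M_P[OF e1] P_1] by simp
  have y: "y \<notin> P"
  proof
    assume "y \<in> P"
    hence "y ^ p - y \<in> P" by (intro P_diff P_power)
    hence "fx * v ^ d \<in> M" unfolding curve_eq fx_def using M_power[OF v d_pos] by (rule M_mult')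
    thus False using e1M by simp
  qed
  have y0: "y \<noteq> 0" using y P_0 by auto
  define u where "u = inverse y"
  have u: "u \<in> M" unfolding u_def using y y_F by (intro notin_imp_inverse_M)
  have e2: "fx * u ^ p - 1 \<in> M"
  proof -
    have "u ^ p = u ^ (p - 1) * u" using p_ge_2 by (cases p) auto
    hence "y * u ^ p = u ^ (p - 1)" using y0 by (simp add: u_def)
    moreover have "y ^ p * u ^ p = 1" using y0 by (simp add: u_def power_inverse)
    ultimately have "fx * u ^ p - 1 = 0 - u ^ (p - 1)"
      unfolding fx_def curve_eq[symmetric] by (simp add: algebra_simps)
    also have "\<dots> \<in> M" using p_ge_2 by (intro M_diff M_0 M_power u) auto
    finally show ?thesis .
  qed
  have e2M: "fx * u ^ p \<notin> M" using M_diff[of "fx * u ^ p", OF _ e2] one_notin_M by auto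
  have e2P: "fx * u ^ p \<in> P" using P_add[OF M_P[OF e2] P_1] by simp
  define e where "e = (fx * v ^ d) * inverse (fx * u ^ p)"
  have e: "e \<in> P" "inverse e \<in> P"
  proof -
    show "e \<in> P" unfolding e_def by (intro P_mult unit_inverse e1P e2P e2M)
    have "inverse e = inverse (fx * v ^ d) * (fx * u ^ p)" by (simp add: e_def mult.commute)
    also have "\<dots> \<in> P" by (intro P_mult unit_inverse e1P e2P e1M)
    finally show "inverse e \<in> P" .
  qed
  have fx0: "fx \<noteq> 0" using e1M M_0 by auto
  have yp: "y ^ p = e * x ^ d"
    using fx0 x0 y0 by (simp add: e_def u_def v_def power_inverse field_simps)
  \<comment> \<open>Only \<open>p\<close>-th powers of monomials can be compared directly, as units
    times powers of \<open>x\<close>; primality of \<open>M\<close> then removes the exponent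
    \<open>p\<close>.\<close>
  have mono: "x ^ i * y ^ j * inverse (x ^ i' * y ^ j') \<in> M" if lt: "p * i + d * j < p * i' + d * j'" for i j i' j'
  proof -
    define t where "t = x ^ i * y ^ j * inverse (x ^ i' * y ^ j')"
    define k where "k = (p * i' + d * j') - (p * i + d * j)"
    have e0: "e \<noteq> 0" using yp y0 by auto
    have pw: "(x ^ i * y ^ j) ^ p = e ^ j * x ^ (p * i + d * j)" for i j
    proof -
      have "(x ^ i * y ^ j) ^ p = x ^ (p * i) * (y ^ p) ^ j"
        by (simp add: power_mult_distrib mult.commute flip: power_mult)
      thus ?thesis unfolding yp by (simp add: power_mult_distrib power_add mult_ac flip: power_mult)
    qed
    have "x ^ (p * i' + d * j') = x ^ (p * i + d * j) * x ^ k"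
      using lt by (simp add: k_def flip: power_add)
    moreover have "t ^ p = (x ^ i * y ^ j) ^ p / (x ^ i' * y ^ j') ^ p"
      unfolding t_def divide_inverse[symmetric] by (rule power_divide)
    ultimately have "t ^ p = e ^ j * inverse e ^ j' * v ^ k"
      unfolding pw using e0 x0 by (simp add: v_def power_inverse field_simps)
    moreover have "v ^ k \<in> M" using lt by (intro M_power v) (simp add: k_def)
    ultimately have tp: "t ^ p \<in> M" using e by (auto intro!: M_mult' P_mult P_power)
    have t0: "t \<noteq> 0" using x0 y0 by (simp add: t_def)
    have tF: "t \<in> F" unfolding t_def using x_F y_F F_powi[of _ "int _"]
      by (auto intro!: F_mult F_inverse)
    have "t \<in> P"
    proof (rule ccontr)
      assume "t \<notin> P"
      hence "inverse t ^ p \<in> P" using tF by (intro P_power P_inverse)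
      hence "inverse t ^ p * t ^ p \<in> M" using tp by (rule M_mult')
      thus False using t0 one_notin_M by (simp flip: power_mult_distrib)
    qed
    thus ?thesis using M_prime_power tp unfolding t_def by blast
  qed
  have low: "ev A * inverse (x ^ i' * y ^ j') \<in> M"
    if A: "\<And>i j. coeff (coeff A j) i \<noteq> 0 \<Longrightarrow> p * i + d * j < p * i' + d * j'" for A i' j'
  proof -
    have "ev A * inverse (x ^ i' * y ^ j') = (\<Sum>j\<le>degree A. \<Sum>i\<le>degree (coeff A j).
        \<iota> (coeff (coeff A j) i) * (x ^ i * y ^ j * inverse (x ^ i' * y ^ j')))"
      unfolding eval2_altdef[OF ring_map_\<iota> order_refl] \<iota>.eval_altdef[OF order_refl] sum_distrib_right
      by (simp add: mult.assoc)
    also have "\<dots> \<in> M"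
    proof (intro M_sum)
      fix i j
      show "\<iota> (coeff (coeff A j) i) * (x ^ i * y ^ j * inverse (x ^ i' * y ^ j')) \<in> M"
      proof (cases "coeff (coeff A j) i = 0")
        case False
        thus ?thesis by (intro M_mult' P_const mono A)
      qed (simp add: M_0)
    qed
    finally show ?thesis .
  qed
  \<comment> \<open>Subtracting the one monomial of weight \<open>w\<close> leaves only monomials of
    smaller weight, which \<open>low\<close> sends into \<open>M\<close>.\<close>
  have lead: "ev A * inverse (x ^ i' * y ^ j') - \<iota> (lam w A) \<in> M"
    if A: "degree A < p" "wle w A" and w: "w = p * i' + d * j'" "j' < p" for A w i' j'
  proof -
    define T where "T = monom (monom (lam w A) i') j'"
    have T: "degree T < p" "ev T = \<iota> (lam w A) * (x ^ i' * y ^ j')"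
      using degree_monom_le[of "monom (lam w A) i'" j'] w(2)
      by (auto simp: T_def eval2_monom ring_map_\<iota>)
    have AT: "degree (A - T) < p" using A(1) T(1) by (intro degree_diff_less)
    have lamT: "coeff (coeff T j') i' = lam w A" by (simp add: T_def)
    have "p * i + d * j < p * i' + d * j'" if nz: "coeff (coeff (A - T) j) i \<noteq> 0" for i j
    proof -
      have j: "j < p" using nz AT le_degree[of "A - T" j] by (cases "coeff (A - T) j = 0") auto
      have le: "p * i + d * j \<le> w"
      proof (cases "coeff (coeff A j) i = 0")
        case True
        hence "coeff (coeff T j) i \<noteq> 0" using nz by auto
        hence "i = i'" "j = j'" unfolding T_def by (auto split: if_splits)
        thus ?thesis using w by simp
      qed (use A(2) wleD in auto)
      moreover have "p * i + d * j \<noteq> w"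
      proof
        assume eq: "p * i + d * j = w"
        have "coeff (coeff A j) i = lam w A" "coeff (coeff A j') i' = lam w A"
          "coeff (coeff T j) i = lam w T" "coeff (coeff T j') i' = lam w T"
          using lam_reduced[OF A(1) j, of i] lam_reduced[OF A(1) w(2), of i']
            lam_reduced[OF T(1) j, of i] lam_reduced[OF T(1) w(2), of i'] eq w(1) by simp_all
        thus False using nz lamT by simp
      qed
      ultimately show ?thesis using w(1) by simp
    qed
    hence "ev (A - T) * inverse (x ^ i' * y ^ j') \<in> M" by (intro low)
    moreover have "ev (A - T) * inverse (x ^ i' * y ^ j') = ev A * inverse (x ^ i' * y ^ j') - \<iota> (lam w A)"
      using T(2) x0 y0 by (simp add: field_simps)
    ultimately show ?thesis by simp
  qed
  have "inf_ring \<subseteq> P"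
  proof
    interpret I: point_data q m K f p d \<iota> x y "\<lambda>w. {A. wle w A}" "\<lambda>w A. to_ac (lam w A)" by (rule inf_point_data)
    fix z assume "z \<in> inf_ring"
    then obtain A0 B0 w where z: "wle w A0" "wle w B0" "lam w B0 \<noteq> 0" "z = ev A0 / ev B0"
      by (auto simp: I.loc_def I.is_frac_def)
    obtain A where A: "degree A < p" "ev A = ev A0" "wle w A" using ev_reduce[of A0] z(1) by metis
    obtain B where B: "degree B < p" "ev B = ev B0" "wle w B" "lam w B \<noteq> 0" using ev_reduce[of B0] z(2,3) by metis
    \<comment> \<open>Not every number is the weight of a monomial with \<open>j < p\<close>;
      \<open>w\<close> is one because \<open>lam w B\<close> is nonzero.\<close>
    obtain i j where ij: "w = p * i + d * j" "j < p"
    proof -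
      have "(\<Sum>j\<le>p - 1. if d * j \<le> w \<and> p dvd (w - d * j) then coeff (coeff B j) ((w - d * j) div p) else 0) \<noteq> 0"
        using lam_altdef[of B "p - 1" w] B(1,4) by simp
      hence "\<exists>j\<le>p - 1. d * j \<le> w \<and> p dvd (w - d * j)"
        by (rule contrapos_np) (auto intro!: sum.neutral)
      then obtain j where "j \<le> p - 1" "d * j \<le> w" "p dvd (w - d * j)" by blast
      thus ?thesis using p_ge_2 by (intro that[of "(w - d * j) div p" j]) auto
    qed
    define \<mu> where "\<mu> = inverse (x ^ i * y ^ j)"
    have \<mu>: "\<mu> \<noteq> 0" using x0 y0 by (simp add: \<mu>_def)
    have a: "ev A * \<mu> - \<iota> (lam w A) \<in> M" and b: "ev B * \<mu> - \<iota> (lam w B) \<in> M"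
      unfolding \<mu>_def by (rule lead[OF A(1,3) ij], rule lead[OF B(1,3) ij])
    have aP: "ev A * \<mu> \<in> P" using P_add[OF M_P[OF a] P_const[of "lam w A"]] by simp
    have bP: "ev B * \<mu> \<in> P" using P_add[OF M_P[OF b] P_const[of "lam w B"]] by simp
    have "ev B * \<mu> \<notin> M"
    proof
      assume "ev B * \<mu> \<in> M"
      from M_diff[OF this b] have "\<iota> (lam w B) \<in> M" by simp
      hence "\<iota> (lam w B) * \<iota> (inverse (lam w B)) \<in> M" using P_const by (rule M_mult)
      moreover have "\<iota> (lam w B) * \<iota> (inverse (lam w B)) = \<iota> (lam w B * inverse (lam w B))" by simp
      ultimately show False using B(4) one_notin_M by simp
    qed
    from P_mult[OF aP unit_inverse[OF bP this]]
    have "(ev A * \<mu>) * inverse (ev B * \<mu>) \<in> P" .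
    moreover have "z = (ev A * \<mu>) * inverse (ev B * \<mu>)" using z(4) A(2) B(2) \<mu> by (simp add: divide_inverse)
    ultimately show "z \<in> P" by simp
  qed
  moreover obtain \<pi> where "dvr q m f p d \<iota> x y inf_ring inf_res \<pi>" by (rule inf_dvr)
  then interpret D: dvr q m K f p d \<iota> x y inf_ring inf_res \<pi> .
  show ?thesis using D.maximal[OF place] calculation by blast
qed

end

section \<open>Rational points\<close>

lemma (in dvr) rational_pointI:
  assumes "\<phi> ` P \<subseteq> L"
  shows "(P, restrict \<phi> P) \<in> rational_points \<iota> F to_ac L"
  unfolding rational_points_def mem_Collect_eq prod.case
proof (intro conjI ballI allI)
  show "restrict \<phi> P \<in> P \<rightarrow>\<^sub>E L" using assms by auto
  show "restrict \<phi> P a = 0" if "a \<in> max_ideal P" for a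
    using that by (simp add: max_ideal_eq)
qed (use place in \<open>simp_all add: P_add \<phi>_add P_mult \<phi>_mult P_const\<close>)

context as_function_field
begin

lemma x_in_aff: "s \<in> pts \<Longrightarrow> x \<in> aff_ring s" and aff_res_x: "s \<in> pts \<Longrightarrow> aff_res s x = fst s"
  and aff_res_y: "s \<in> pts \<Longrightarrow> aff_res s y = snd s"
  using aff_ring_ev[of s "[:monom 1 1:]"] aff_res_ev[of s "[:monom 1 1:]"] aff_res_ev[of s "monom 1 1"]
  by (simp_all only: ev_x ev_y evs_C evs_monom to_ac.eval_monom) simp_all

lemma x_notin_inf: "x \<notin> inf_ring"
proof
  assume x: "x \<in> inf_ring"
  obtain \<pi> where D: "dvr q m f p d \<iota> x y inf_ring inf_res \<pi>"
    and val: "\<And>A w. wle w A \<Longrightarrow> lam w A \<noteq> 0 \<Longrightarrow> place_val inf_ring (ev A) = - int w" by (rule inf_dvr) (rule that)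
  interpret D: dvr q m K f p d \<iota> x y inf_ring inf_res \<pi> by (rule D)
  have "place_val inf_ring (ev [:monom 1 1:]) = - int (p * 1)"
    by (rule val[OF wle_monom_1(2)]) (simp only: lam_monom_1(2) one_neq_zero not_False_eq_True)
  hence v: "place_val inf_ring x = - int p" by (simp only: ev_x mult_1_right)
  have "ev [:monom 1 1:] \<noteq> 0" unfolding ev_C_eq_0_iff by simp
  hence "x \<noteq> 0" by (simp only: ev_x not_False_eq_True)
  moreover have "x \<in> F" using ev_in_F[of "[:monom 1 1:]"] by (simp only: ev_x)
  ultimately show False using D.in_P_iff[of x] x v p_ge_2 by simp
qed

lemma is_place_iff: "is_place \<iota> F P \<longleftrightarrow> P = inf_ring \<or> (\<exists>s\<in>pts. P = aff_ring s)"
proof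
  assume P: "is_place \<iota> F P"
  interpret place_ring q m K f p d \<iota> x y P by unfold_locales (rule P)
  show "P = inf_ring \<or> (\<exists>s\<in>pts. P = aff_ring s)"
    using inf_place aff_place by (cases "x \<in> P") blast+
next
  assume "P = inf_ring \<or> (\<exists>s\<in>pts. P = aff_ring s)"
  thus "is_place \<iota> F P"
  proof
    assume "P = inf_ring"
    moreover obtain \<pi> where "dvr q m f p d \<iota> x y inf_ring inf_res \<pi>" by (rule inf_dvr)
    ultimately show ?thesis using dvr.place by blast
  next
    assume "\<exists>s\<in>pts. P = aff_ring s"
    then obtain s where s: "s \<in> pts" "P = aff_ring s" by blast
    obtain r where r: "r > 0" "fst s ^ (q ^ r) = fst s" by (rule in_finite_subfield)
    from dvr.place[OF aff_dvr[OF s(1) r(2,1)]] s(2) show ?thesis by simp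
  qed
qed

lemma place_dvr:
  assumes "is_place \<iota> F P"
  obtains \<phi> \<pi> where "dvr q m f p d \<iota> x y P \<phi> \<pi>"
proof -
  consider "P = inf_ring" | s where "s \<in> pts" "P = aff_ring s" using assms unfolding is_place_iff by blast
  thus ?thesis
  proof cases
    case 1
    moreover obtain \<pi> where "dvr q m f p d \<iota> x y inf_ring inf_res \<pi>" by (rule inf_dvr)
    ultimately show ?thesis using that by blast
  next
    case 2
    obtain r where r: "r > 0" "fst s ^ (q ^ r) = fst s" by (rule in_finite_subfield)
    from aff_dvr[OF 2(1) r(2,1)] 2(2) show ?thesis using that by blast
  qed
qed

text \<open>A homomorphism on an affine local ring is determined by the images of \<open>x\<close>
  and \<open>y\<close>, which form a point of the curve. Conjugate points share the ring but give
  different homomorphisms. At infinity all residues are constants, so there is only one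
  homomorphism.\<close>

lemma rational_points_eq:
  fixes r :: nat
  defines "L \<equiv> {a :: 'k alg_closure. a ^ (q ^ r) = a}"
  shows "rational_points \<iota> F to_ac L = insert (inf_ring, restrict inf_res inf_ring)
    ((\<lambda>s. (aff_ring s, restrict (aff_res s) (aff_ring s))) ` {s \<in> pts. fst s \<in> L \<and> snd s \<in> L})"
proof (intro equalityI subsetI)
  fix t assume t: "t \<in> insert (inf_ring, restrict inf_res inf_ring)
    ((\<lambda>s. (aff_ring s, restrict (aff_res s) (aff_ring s))) ` {s \<in> pts. fst s \<in> L \<and> snd s \<in> L})"
  then consider "t = (inf_ring, restrict inf_res inf_ring)"
    | s where "s \<in> pts" "fst s \<in> L" "snd s \<in> L" "t = (aff_ring s, restrict (aff_res s) (aff_ring s))"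
    by blast
  thus "t \<in> rational_points \<iota> F to_ac L"
  proof cases
    case 1
    obtain \<pi> where D: "dvr q m f p d \<iota> x y inf_ring inf_res \<pi>" "inf_res ` inf_ring = range to_ac"
      by (rule inf_dvr) (rule that)
    have "inf_res ` inf_ring \<subseteq> L" unfolding D(2) L_def by auto
    from dvr.rational_pointI[OF D(1) this] 1 show ?thesis by simp
  next
    case 2
    obtain r' where r: "r' > 0" "fst s ^ (q ^ r') = fst s" by (rule in_finite_subfield)
    have L: "evs s A \<in> L" for A
      using 2(2,3) unfolding L_def mem_Collect_eq frob_evs by simp
    have "aff_res s ` aff_ring s \<subseteq> L"
    proof safe
      fix z assume "z \<in> aff_ring s"
      then obtain A B where "evs s B \<noteq> 0" "z = ev A / ev B" by (rule aff_ringE[OF 2(1)])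
      thus "aff_res s z \<in> L" using aff_res_eq[OF 2(1)] L[of A] L[of B] by (simp add: L_def power_divide)
    qed
    from dvr.rational_pointI[OF aff_dvr[OF 2(1) r(2,1)] this] 2(4) show ?thesis by simp
  qed
next
  fix t assume "t \<in> rational_points \<iota> F to_ac L"
  then obtain P \<psi> where t: "t = (P, \<psi>)" and P: "is_place \<iota> F P" and ext: "\<psi> \<in> P \<rightarrow>\<^sub>E L"
    and hom: "\<And>a b. a \<in> P \<Longrightarrow> b \<in> P \<Longrightarrow> \<psi> (a + b) = \<psi> a + \<psi> b"
      "\<And>a b. a \<in> P \<Longrightarrow> b \<in> P \<Longrightarrow> \<psi> (a * b) = \<psi> a * \<psi> b"
    and const: "\<And>c. \<psi> (\<iota> c) = to_ac c" and M: "\<And>a. a \<in> max_ideal P \<Longrightarrow> \<psi> a = 0"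
    unfolding rational_points_def by auto
  have ext': "\<psi> \<in> P \<rightarrow>\<^sub>E UNIV" using ext by (auto simp: PiE_def)
  interpret P: place_ring q m K f p d \<iota> x y P by unfold_locales (rule P)
  show "t \<in> insert (inf_ring, restrict inf_res inf_ring)
    ((\<lambda>s. (aff_ring s, restrict (aff_res s) (aff_ring s))) ` {s \<in> pts. fst s \<in> L \<and> snd s \<in> L})"
  proof (cases "x \<in> P")
    case False
    hence Pinf: "P = inf_ring" by (rule P.inf_place)
    obtain \<pi> where D: "dvr q m f p d \<iota> x y inf_ring inf_res \<pi>" "inf_res ` inf_ring = range to_ac"
      by (rule inf_dvr) (rule that)
    interpret D: dvr q m K f p d \<iota> x y inf_ring inf_res \<pi> by (rule D)
    have "\<psi> = restrict inf_res inf_ring"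
    proof (rule PiE_ext[OF ext'])
      show "restrict inf_res inf_ring \<in> P \<rightarrow>\<^sub>E UNIV" unfolding Pinf by auto
      fix z assume z: "z \<in> P"
      then obtain c where c: "inf_res z = to_ac c" using D(2) unfolding Pinf by blast
      have "z - \<iota> c \<in> max_ideal P"
        using z c unfolding Pinf D.max_ideal_eq by (simp add: D.P_diff D.P_const D.\<phi>_diff)
      hence "\<psi> (z - \<iota> c + \<iota> c) = to_ac c"
        using M P.M_P P.P_const by (subst hom(1)) (auto simp: const)
      thus "\<psi> z = restrict inf_res inf_ring z" using c z Pinf by simp
    qed
    thus ?thesis using t Pinf by simp
  next
    case True
    define s where "s = (\<psi> x, \<psi> y)"
    have y: "y \<in> P" by (rule P.y_in_P[OF True])
    have 1: "\<psi> (poly (map_poly \<iota> h) x) = poly (map_poly to_ac h) (\<psi> x)" for h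
    proof (induction h)
      case 0
      show ?case using const[of 0] by simp
    next
      case (pCons a h)
      show ?case using True P.poly_in_P[OF True, of h]
        by (simp add: hom P.P_mult P.P_const const pCons.IH)
    qed
    interpret ex: ring_map "\<lambda>h. poly (map_poly \<iota> h) x" by (rule \<iota>.ring_map_eval)
    have \<psi>: "\<psi> (ev A) = evs s A" for A
    proof (induction A)
      case 0
      show ?case using const[of 0] by (simp add: s_def eval2_def)
    next
      case (pCons a A)
      have "ev (pCons a A) = poly (map_poly \<iota> a) x + y * ev A" by (simp add: eval2_def)
      moreover have "evs s (pCons a A) = poly (map_poly to_ac a) (\<psi> x) + \<psi> y * evs s A"
        by (simp add: eval2_def s_def)
      ultimately show ?case using y P.ev_in_P[OF True, of A] P.poly_in_P[OF True, of a]
        by (simp add: hom P.P_mult 1 pCons.IH)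
    qed
    have "ev G = 0" by (simp add: kernel)
    hence "evs s G = 0" using \<psi>[of G] const[of 0] by simp
    hence s: "s \<in> pts" by (simp add: pts_def G_def evs_monom)
    have sL: "fst s \<in> L" "snd s \<in> L" using ext True y by (auto simp: s_def)
    have notin: "ev B \<notin> max_ideal P" if "evs s B \<noteq> 0" for B using \<psi>[of B] that M by auto
    have sub: "aff_ring s \<subseteq> P"
    proof
      fix z assume "z \<in> aff_ring s"
      then obtain A B where "evs s B \<noteq> 0" "z = ev A / ev B" by (rule aff_ringE[OF s])
      thus "z \<in> P" using notin P.ev_in_P[OF True] P.unit_inverse by (auto simp: divide_inverse intro: P.P_mult)
    qed
    obtain r' where r: "r' > 0" "fst s ^ (q ^ r') = fst s" by (rule in_finite_subfield)
    have Ps: "P = aff_ring s" by (rule dvr.maximal[OF aff_dvr[OF s r(2,1)] P sub])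
    have "\<psi> = restrict (aff_res s) (aff_ring s)"
    proof (rule PiE_ext[OF ext'])
      show "restrict (aff_res s) (aff_ring s) \<in> P \<rightarrow>\<^sub>E UNIV" unfolding Ps by auto
      fix z assume z: "z \<in> P"
      then obtain A B where AB: "evs s B \<noteq> 0" "z = ev A / ev B" unfolding Ps by (rule aff_ringE[OF s])
      have "\<psi> (z * ev B) = \<psi> z * evs s B" using z P.ev_in_P[OF True] by (simp add: hom \<psi>)
      moreover have "z * ev B = ev A" using AB evs_nz_imp_ev_nz[OF s] by simp
      ultimately have "\<psi> z = evs s A / evs s B" using AB(1) \<psi>[of A] by (simp add: field_simps)
      thus "\<psi> z = restrict (aff_res s) (aff_ring s) z" using z AB aff_res_eq[OF s] Ps by simp
    qed
    thus ?thesis using t Ps s sL by blast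
  qed
qed

lemma card_rational_points:
  fixes r :: nat
  assumes "r > 0"
  defines "L \<equiv> {a :: 'k alg_closure. a ^ (q ^ r) = a}"
  shows "card (rational_points \<iota> F to_ac L) = card {s \<in> pts. fst s \<in> L \<and> snd s \<in> L} + 1"
proof -
  let ?g = "\<lambda>s. (aff_ring s, restrict (aff_res s) (aff_ring s))"
  let ?S = "{s \<in> pts. fst s \<in> L \<and> snd s \<in> L}"
  have fin: "finite ?S"
    using finite_pts_r[OF assms(1)] by (rule rev_finite_subset) (auto simp: pts_r_def L_def)
  have inj: "inj_on ?g ?S"
  proof (rule inj_onI)
    fix s s' assume s: "s \<in> ?S" "s' \<in> ?S" "?g s = ?g s'"
    hence eq: "aff_ring s = aff_ring s'" "restrict (aff_res s) (aff_ring s) = restrict (aff_res s') (aff_ring s')"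
      by auto
    have pts: "s \<in> pts" "s' \<in> pts" using s by auto
    have y: "y \<in> aff_ring s" using aff_ring_ev[OF pts(1), of "monom 1 1"] by (simp only: ev_y)
    have "aff_res s z = aff_res s' z" if "z \<in> aff_ring s" for z
      using fun_cong[OF eq(2), of z] that eq(1) by simp
    from this[OF x_in_aff[OF pts(1)]] this[OF y] show "s = s'"
      unfolding aff_res_x[OF pts(1)] aff_res_x[OF pts(2)] aff_res_y[OF pts(1)] aff_res_y[OF pts(2)]
      by (rule prod_eqI)
  qed
  have "(inf_ring, restrict inf_res inf_ring) \<notin> ?g ` ?S"
    using x_in_aff x_notin_inf by auto
  thus ?thesis unfolding L_def rational_points_eq using fin inj unfolding L_def
    by (simp add: card_image)
qed

section \<open>Regular functions\<close>

text \<open>Take a denominator \<open>N\<close> of least degree. If it has a root \<open>a\<close>,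
  regularity makes the numerator vanish on the fibre over \<open>a\<close>, so the minimal
  polynomial of \<open>a\<close> cancels from both.\<close>

lemma regular_imp_polynomial:
  assumes z: "z \<in> F" and reg: "\<And>s. s \<in> pts \<Longrightarrow> z \<in> aff_ring s"
  obtains A where "degree A < p" "z = ev A"
proof -
  define R where "R N \<longleftrightarrow> N \<noteq> 0 \<and> (\<exists>A. degree A < p \<and> z = ev A / ev [:N:])" for N
  obtain N0 where "R N0" using F_rep[OF z] unfolding R_def by metis
  then obtain N where N: "R N" "\<And>N'. R N' \<Longrightarrow> degree N \<le> degree N'"
    using ex_has_least_nat[of R N0 degree] by blast
  then obtain A where A: "N \<noteq> 0" "degree A < p" "z = ev A / ev [:N:]" by (auto simp: R_def)
  have "degree N = 0"
  proof (rule ccontr)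
    assume "degree N \<noteq> 0"
    hence "degree (map_poly (to_ac :: 'k \<Rightarrow> _) N) > 0" by (subst degree_map_poly) auto
    then obtain a where a: "poly (map_poly (to_ac :: 'k \<Rightarrow> _) N) a = 0"
      using alg_closed_imp_poly_has_root by blast
    obtain h :: "'k poly" where h: "h \<noteq> 0" "poly (map_poly to_ac h) a = 0"
      "\<And>c. poly (map_poly to_ac c) a = 0 \<Longrightarrow> h dvd c"
      using minimal_polynomial[of a] by blast
    have "evs (a, b) A = 0" if b: "(a, b) \<in> pts" for b
    proof -
      obtain A1 B1 where 1: "evs (a, b) B1 \<noteq> 0" "z = ev A1 / ev B1"
        by (rule aff_ringE[OF b reg[OF b]])
      have "ev B1 \<noteq> 0" "ev [:N:] \<noteq> 0" using evs_nz_imp_ev_nz[OF b 1(1)] A(1) by auto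
      hence "ev A * ev B1 = ev [:N:] * ev A1" using A(3) 1(2) by (simp add: field_simps)
      hence "ev (A * B1) = ev ([:N:] * A1)" by (simp only: ev.map_mult)
      hence "G dvd A * B1 - [:N:] * A1" by (simp only: ev_eq_iff)
      hence "evs (a, b) (A * B1 - [:N:] * A1) = 0" using b evs_dvd by blast
      hence "evs (a, b) A * evs (a, b) B1 - evs (a, b) [:N:] * evs (a, b) A1 = 0"
        by (simp only: evs.map_diff evs.map_mult)
      moreover have "evs (a, b) [:N:] = 0" unfolding evs_C using a by simp
      ultimately show ?thesis using 1(1) by simp
    qed
    hence "h dvd coeff A j" for j by (intro h(3) vanish_fibre[OF A(2)])
    hence "[:h:] dvd A" by (simp add: const_poly_dvd_iff)
    then obtain A' where A': "A = [:h:] * A'" by (elim dvdE)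
    obtain N' where N': "N = h * N'" using h(3)[OF a] by (elim dvdE)
    have "degree h > 0"
    proof (rule ccontr)
      assume "\<not> degree h > 0"
      then obtain c where "h = [:c:]" using degree_eq_zeroE[of h] by auto
      thus False using h(1,2) by simp
    qed
    hence deg: "N' \<noteq> 0" "degree N' < degree N" using N' A(1) by (auto simp: degree_mult_eq)
    have "[:N:] = [:h:] * [:N':]" using N' by simp
    hence "ev [:N:] = ev [:h:] * ev [:N':]" by (simp only: ev.map_mult)
    moreover have "ev A = ev [:h:] * ev A'" unfolding A' by (rule ev.map_mult)
    moreover have "ev [:h:] \<noteq> 0" using h(1) by simp
    ultimately have "z = ev A' / ev [:N':]" using A(3) by simp
    moreover have "degree A' < p"
      using A(2) A' h(1) by (cases "A' = 0") (auto simp: degree_mult_eq)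
    ultimately have "R N'" using deg(1) unfolding R_def by blast
    thus False using N(2) deg(2) by fastforce
  qed
  then obtain c where c: "N = [:c:]" by (rule degree_eq_zeroE)
  hence "c \<noteq> 0" using A(1) by auto
  have "\<iota> (inverse c) * \<iota> c = 1" using \<open>c \<noteq> 0\<close> by (simp flip: \<iota>.map_mult)
  moreover have "ev A = z * \<iota> c" using A(3) c \<open>c \<noteq> 0\<close> by simp
  ultimately have "z = \<iota> (inverse c) * ev A" by (simp add: mult.left_commute)
  hence "z = ev ([:[:inverse c:]:] * A)" unfolding ev.map_mult ev_const .
  moreover have "degree ([:[:inverse c:]:] * A) < p"
    using A(2) degree_mult_le[of "[:[:inverse c:]:]" A] by simp
  ultimately show ?thesis using that by blast
qed

end

section \<open>Riemann-Roch spaces and the genus\<close>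

text \<open>Membership in \<open>P\<close> is stable under sums and also covers
  \<open>z = 0\<close>, for which \<open>place_val\<close> has no meaning.\<close>

lemma (in dvr) val_condition:
  assumes "z \<in> F"
  shows "z = 0 \<or> place_val P z \<ge> - a \<longleftrightarrow> z * \<pi> powi a \<in> P"
  using val_ge_iff[OF assms] P_0 by (cases "z = 0") auto

context as_function_field
begin

abbreviation RR :: "('f set \<Rightarrow> int) \<Rightarrow> 'f set" where
  "RR A \<equiv> riemann_roch_space \<iota> F A"

lemma RR_iff: "z \<in> RR A \<longleftrightarrow> z \<in> F \<and> (\<forall>P. is_place \<iota> F P \<longrightarrow> z = 0 \<or> place_val P z \<ge> - A P)"
  by (auto simp: riemann_roch_space_def)

lemma RR_mono: "(\<And>P. A P \<le> B P) \<Longrightarrow> RR A \<subseteq> RR B"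
  unfolding RR_iff subset_iff by (meson neg_le_iff_le order_trans)

lemma vector_space_\<iota>: "vector_space (\<lambda>c z. \<iota> c * z)"
  by (intro vector_space_ring_map ring_map_\<iota>)

lemma RR_diff: "z \<in> RR A \<Longrightarrow> w \<in> RR A \<Longrightarrow> z - w \<in> RR A"
  and RR_scale: "z \<in> RR A \<Longrightarrow> \<iota> c * z \<in> RR A"
proof -
  have "z - w = 0 \<or> place_val P (z - w) \<ge> - A P"
    if "z \<in> RR A" "w \<in> RR A" and P: "is_place \<iota> F P" for z w P
  proof -
    obtain \<phi> \<pi> where "dvr q m f p d \<iota> x y P \<phi> \<pi>" using place_dvr[OF P] .
    then interpret dvr q m K f p d \<iota> x y P \<phi> \<pi> .
    have "z \<in> F" "w \<in> F" "z * \<pi> powi (A P) \<in> P" "w * \<pi> powi (A P) \<in> P"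
      using that by (auto simp: RR_iff val_condition[symmetric])
    hence "(z - w) * \<pi> powi (A P) \<in> P" unfolding left_diff_distrib by (intro P_diff)
    thus ?thesis using val_condition[OF F_diff] \<open>z \<in> F\<close> \<open>w \<in> F\<close> by blast
  qed
  thus "z \<in> RR A \<Longrightarrow> w \<in> RR A \<Longrightarrow> z - w \<in> RR A" by (auto simp: RR_iff F_diff)
  have "\<iota> c * z = 0 \<or> place_val P (\<iota> c * z) \<ge> - A P"
    if "z \<in> RR A" and P: "is_place \<iota> F P" for z P
  proof -
    obtain \<phi> \<pi> where "dvr q m f p d \<iota> x y P \<phi> \<pi>" using place_dvr[OF P] .
    then interpret dvr q m K f p d \<iota> x y P \<phi> \<pi> .
    have "z \<in> F" "z * \<pi> powi (A P) \<in> P"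
      using that by (auto simp: RR_iff val_condition[symmetric])
    thus ?thesis using P_mult[OF P_const[of c], of "z * \<pi> powi (A P)"]
      by (subst val_condition) (auto simp: F_mult F_const mult.assoc)
  qed
  thus "z \<in> RR A \<Longrightarrow> \<iota> c * z \<in> RR A" by (auto simp: RR_iff F_mult F_const)
qed

lemma RR_0: "0 \<in> RR A"
  by (simp add: RR_iff F_0)

lemma card_RR:
  assumes "finite (RR A)"
  shows "card (RR A) = q ^ ell \<iota> F A"
proof -
  interpret vector_space "\<lambda>c z. \<iota> c * z" by (rule vector_space_\<iota>)
  have "subspace (RR A)"
  proof (rule subspaceI)
    show "z + w \<in> RR A" if "z \<in> RR A" "w \<in> RR A" for z w
      using RR_diff[OF that(1) RR_scale[OF that(2), of "- 1"]] by simp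
  qed (auto simp: RR_0 RR_scale)
  from card_finite_subspace[OF vector_space_\<iota> this assms] show ?thesis
    by (simp add: ell_def q_def)
qed

text \<open>The residue of \<open>z * \<pi> powi (A P + 1)\<close> at \<open>P\<close> is additive
  in \<open>z\<close>, and functions with equal residue differ by an element of \<open>RR A\<close>.
  So the larger space is covered by as many translates of subsets of \<open>RR A\<close> as there
  are residues.\<close>

lemma RR_step:
  assumes P: "is_place \<iota> F P" and fin: "finite (RR (A(P := A P + 1)))"
  shows "card (RR (A(P := A P + 1))) \<le> card (RR A) * q ^ place_degree \<iota> P"
proof -
  let ?X = "RR (A(P := A P + 1))"
  obtain \<phi> \<pi> where "dvr q m f p d \<iota> x y P \<phi> \<pi>" using place_dvr[OF P] .
  then interpret dvr q m K f p d \<iota> x y P \<phi> \<pi> .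
  define \<psi> where "\<psi> z = \<phi> (z * \<pi> powi (A P + 1))" for z
  have XF: "z \<in> F" "z * \<pi> powi (A P + 1) \<in> P" if "z \<in> ?X" for z
    using that P by (auto simp: RR_iff val_condition[symmetric])
  have RRA: "finite (RR A)" using RR_mono[of A "A(P := A P + 1)"] fin finite_subset by fastforce
  have ker: "z - w \<in> RR A" if z: "z \<in> ?X" "w \<in> ?X" "\<psi> z = \<psi> w" for z w
  proof -
    have zw: "z - w \<in> ?X" by (rule RR_diff[OF z(1,2)])
    have "(z - w) * \<pi> powi (A P + 1) \<in> max_ideal P"
      using XF(2)[OF z(1)] XF(2)[OF z(2)] XF(2)[OF zw] z(3)
      by (simp add: max_ideal_eq \<psi>_def left_diff_distrib \<phi>_diff)
    then obtain a where a: "a \<in> P" "(z - w) * \<pi> powi (A P + 1) = \<pi> * a"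
      unfolding max_ideal_generator by blast
    hence "(z - w) * \<pi> powi (A P) = a" using \<pi>_nz by (simp add: power_int_add_1)
    hence "z - w = 0 \<or> place_val P (z - w) \<ge> - A P" using val_condition[OF XF(1)[OF zw]] a(1) by simp
    moreover have "z - w = 0 \<or> place_val Q (z - w) \<ge> - A Q" if "is_place \<iota> F Q" "Q \<noteq> P" for Q
    proof -
      have "z - w = 0 \<or> place_val Q (z - w) \<ge> - (A(P := A P + 1)) Q"
        using zw that(1) unfolding RR_iff by blast
      thus ?thesis using that(2) by (simp only: fun_upd_other not_False_eq_True)
    qed
    ultimately show ?thesis using zw unfolding RR_iff by blast
  qed
  have "?X = (\<Union>v\<in>\<phi> ` P. {z \<in> ?X. \<psi> z = v})" using XF by (auto simp: \<psi>_def)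
  hence "card ?X = card (\<Union>v\<in>\<phi> ` P. {z \<in> ?X. \<psi> z = v})" by (rule arg_cong)
  also have "\<dots> \<le> (\<Sum>v\<in>\<phi> ` P. card {z \<in> ?X. \<psi> z = v})"
    by (rule card_UN_le[OF finite_residue])
  also have "\<dots> \<le> (\<Sum>v\<in>\<phi> ` P. card (RR A))"
  proof (rule sum_mono)
    fix v
    show "card {z \<in> ?X. \<psi> z = v} \<le> card (RR A)"
    proof (cases "{z \<in> ?X. \<psi> z = v} = {}")
      case True
      thus ?thesis unfolding True by simp
    next
      case False
      then obtain w where w: "w \<in> ?X" "\<psi> w = v" by blast
      show ?thesis
        by (rule card_inj_on_le[of "\<lambda>z. z - w"]) (use ker w RRA in \<open>auto simp: inj_on_def\<close>)
    qed
  qed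
  also have "\<dots> = card (RR A) * q ^ place_degree \<iota> P"
    by (simp add: card_residue_field mult.commute)
  finally show ?thesis .
qed

text \<open>Induction along a chain of divisors that gains one place at a time. In logarithms to
  base \<open>q\<close> it says that degree minus \<open>ell\<close> does not decrease from
  \<open>A\<close> to \<open>B\<close>.\<close>

lemma RR_compare:
  assumes "finite S" "\<And>P. P \<in> S \<Longrightarrow> is_place \<iota> F P" "\<And>P. P \<notin> S \<Longrightarrow> A P = B P"
    and "\<And>P. A P \<le> B P" and "finite (RR B)"
  shows "card (RR B) \<le> card (RR A) * q ^ (\<Sum>P\<in>S. nat (B P - A P) * place_degree \<iota> P)"
  using assms(3,4)
proof (induction "\<Sum>P\<in>S. nat (B P - A P)" arbitrary: A rule: less_induct)
  case less
  show ?case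
  proof (cases "\<exists>P\<in>S. A P < B P")
    case False
    hence "A = B" using less.prems by (metis ext antisym_conv2)
    thus ?thesis by simp
  next
    case True
    then obtain P where P: "P \<in> S" "A P < B P" by blast
    define A' where "A' = A(P := A P + 1)"
    define T where "T = S - {P}"
    have T: "finite T" "P \<notin> T" "S = insert P T" using P(1) assms(1) by (auto simp: T_def)
    have eqT: "(\<Sum>Q\<in>T. nat (B Q - A' Q) * g Q) = (\<Sum>Q\<in>T. nat (B Q - A Q) * g Q)" for g
      using T(2) by (intro sum.cong) (auto simp: A'_def)
    have P': "nat (B P - A P) = Suc (nat (B P - A' P))" using P(2) by (simp add: A'_def)
    have le: "A' Q \<le> B Q" for Q using less.prems(2)[of Q] P(2) by (auto simp: A'_def)
    have "card (RR B) \<le> card (RR A') * q ^ (\<Sum>P\<in>S. nat (B P - A' P) * place_degree \<iota> P)"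
    proof (rule less.hyps)
      show "(\<Sum>P\<in>S. nat (B P - A' P)) < (\<Sum>P\<in>S. nat (B P - A P))"
        using eqT[of "\<lambda>_. 1"] T P' by simp
    qed (use less.prems P le in \<open>auto simp: A'_def\<close>)
    also have "card (RR A') \<le> card (RR A) * q ^ place_degree \<iota> P"
    proof -
      have "RR A' \<subseteq> RR B" by (rule RR_mono[OF le])
      hence "finite (RR A')" using assms(5) finite_subset by blast
      thus ?thesis unfolding A'_def using assms(2)[OF P(1)] by (intro RR_step)
    qed
    also have "card (RR A) * q ^ place_degree \<iota> P * q ^ (\<Sum>P\<in>S. nat (B P - A' P) * place_degree \<iota> P) =
      card (RR A) * q ^ (\<Sum>P\<in>S. nat (B P - A P) * place_degree \<iota> P)"
      unfolding T(3) using T(1,2) P' eqT by (simp add: power_add mult_ac)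
    finally show ?thesis by simp
  qed
qed

lemma divisor_degree_eq:
  assumes "finite S" "\<And>P. P \<notin> S \<Longrightarrow> A P = 0"
  shows "divisor_degree \<iota> A = (\<Sum>P\<in>S. A P * int (place_degree \<iota> P))"
  unfolding divisor_degree_def by (rule sum.mono_neutral_left) (use assms in auto)

subsection \<open>The degrees of the places\<close>

lemma degree_inf: "place_degree \<iota> inf_ring = 1"
proof -
  obtain \<pi> where D: "dvr q m f p d \<iota> x y inf_ring inf_res \<pi>" "inf_res ` inf_ring = range to_ac"
    by (rule inf_dvr) (rule that)
  have "card (range (to_ac :: 'k \<Rightarrow> _)) = q" unfolding q_def by (intro card_image inj_to_ac)
  hence "q ^ place_degree \<iota> inf_ring = q ^ 1" using dvr.card_residue_field[OF D(1)] D(2) by simp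
  thus ?thesis using q_ge_2 by (subst (asm) power_inject_exp) auto
qed

text \<open>The Frobenius conjugates of \<open>s\<close> share its local ring. If two of the first
  \<open>n\<close> agreed, all residues would be fixed by a Frobenius power below the
  \<open>n\<close>-th, leaving fewer than \<open>q ^ n\<close> of them.\<close>

lemma degree_aff_le:
  assumes s: "s \<in> pts_r r" and r: "r > 0"
  shows "place_degree \<iota> (aff_ring s) \<le> card {s' \<in> pts_r r. aff_ring s' = aff_ring s}"
proof -
  have pts: "s \<in> pts" "fst s ^ (q ^ r) = fst s" using s by (auto simp: pts_r_def)
  define n where "n = place_degree \<iota> (aff_ring s)"
  define c where "c i = (fst s ^ (q ^ i), snd s ^ (q ^ i))" for i
  have c_pts: "c i \<in> pts" for i unfolding c_def by (rule frob_pts[OF pts(1)])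
  have evs_c: "evs (c i) A = evs s A ^ (q ^ i)" for i A unfolding frob_evs c_def ..
  have "aff_ring (c i) = aff_ring s" for i
  proof -
    have "evs (c i) B \<noteq> 0 \<longleftrightarrow> evs s B \<noteq> 0" for B
      unfolding evs_c using q_ge_2 by simp
    thus ?thesis using aff_ringI[OF pts(1)] aff_ringI[OF c_pts] aff_ringE[OF pts(1)] aff_ringE[OF c_pts]
      by (metis subsetI subset_antisym)
  qed
  moreover have "c i \<in> pts_r r" for i
  proof -
    have "(fst s ^ (q ^ i)) ^ (q ^ r) = (fst s ^ (q ^ r)) ^ (q ^ i)"
      by (simp only: power_mult[symmetric] mult.commute)
    thus ?thesis using c_pts[of i] pts(2) by (simp add: pts_r_def c_def)
  qed
  ultimately have sub: "c ` {..<n} \<subseteq> {s' \<in> pts_r r. aff_ring s' = aff_ring s}" by blast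
  have "c i \<noteq> c j" if ij: "i < j" "j < n" for i j
  proof
    assume eq: "c i = c j"
    have fix_k: "evs s A ^ (q ^ (j - i)) = evs s A" for A
    proof -
      have "(evs s A ^ (q ^ (j - i))) ^ (q ^ i) = evs s A ^ (q ^ j)"
        using ij(1) by (simp flip: power_mult power_add)
      also have "\<dots> = evs s A ^ (q ^ i)" by (simp only: eq flip: evs_c)
      finally show ?thesis by (rule frob_inj)
    qed
    have "aff_res s ` aff_ring s \<subseteq> {a. a ^ (q ^ (j - i)) = a}"
    proof safe
      fix z assume "z \<in> aff_ring s"
      then obtain A B where "evs s B \<noteq> 0" "z = ev A / ev B" by (rule aff_ringE[OF pts(1)])
      thus "aff_res s z ^ (q ^ (j - i)) = aff_res s z"
        using fix_k by (simp add: aff_res_eq[OF pts(1)] power_divide)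
    qed
    moreover have pos: "j - i > 0" using ij(1) by simp
    ultimately have "card (aff_res s ` aff_ring s) \<le> card {a :: 'k alg_closure. a ^ (q ^ (j - i)) = a}"
      by (intro card_mono finite_subfield[OF pos])
    also have "\<dots> = q ^ (j - i)" by (rule card_subfield[OF pos])
    finally have "card (aff_res s ` aff_ring s) \<le> q ^ (j - i)" .
    moreover have "card (aff_res s ` aff_ring s) = q ^ n"
      unfolding n_def by (rule dvr.card_residue_field[OF aff_dvr[OF pts r]])
    ultimately have "q ^ n \<le> q ^ (j - i)" by simp
    hence "n \<le> j - i" using q_ge_2 by (subst (asm) power_increasing_iff) auto
    thus False using ij by simp
  qed
  hence "inj_on c {..<n}" by (intro inj_onI) (metis lessThan_iff linorder_neqE_nat)
  hence "n \<le> card (c ` {..<n})" by (simp add: card_image)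
  also have "\<dots> \<le> card {s' \<in> pts_r r. aff_ring s' = aff_ring s}"
    using finite_pts_r[OF r] by (intro card_mono sub) auto
  finally show ?thesis by (simp add: n_def)
qed

lemma sum_degree_aff_le:
  assumes "r > 0"
  shows "(\<Sum>P\<in>aff_ring ` pts_r r. place_degree \<iota> P) \<le> p * q ^ r"
proof -
  have "(\<Sum>P\<in>aff_ring ` pts_r r. place_degree \<iota> P) \<le> (\<Sum>P\<in>aff_ring ` pts_r r. card {s \<in> pts_r r. aff_ring s = P})"
    using degree_aff_le[OF _ assms] by (intro sum_mono) auto
  also have "\<dots> = (\<Sum>P\<in>aff_ring ` pts_r r. \<Sum>s\<in>{s \<in> pts_r r. aff_ring s = P}. 1)" by simp
  also have "\<dots> = (\<Sum>s\<in>pts_r r. 1)" by (rule sum.image_gen[OF finite_pts_r[OF assms], symmetric])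
  also have "\<dots> = p * q ^ r" using card_pts_r[OF assms] by simp
  finally show ?thesis .
qed

subsection \<open>Polynomials of bounded weight\<close>

definition polys :: "nat \<Rightarrow> 'k poly poly set" where
  "polys w = {C. degree C < p \<and> wle w C}"

definition exps :: "nat \<Rightarrow> (nat \<times> nat) set" where
  "exps w = (SIGMA j:{..<p}. {i. p * i + d * j \<le> w})"

lemma exps_fibre: "d * j \<le> w \<Longrightarrow> {i. p * i + d * j \<le> w} = {..(w - d * j) div p}"
  using p_ge_2 by (auto simp: less_eq_div_iff_mult_less_eq mult.commute)

lemma finite_exps: "finite (exps w)"
proof -
  have "finite {i. p * i + d * j \<le> w}" for j
  proof (rule finite_subset)
    show "{i. p * i + d * j \<le> w} \<subseteq> {..w}"
    proof safe
      fix i assume "p * i + d * j \<le> w"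
      moreover have "1 * i \<le> p * i" using p_ge_2 by (intro mult_le_mono1) simp
      ultimately show "i \<le> w" by linarith
    qed
  qed simp
  thus ?thesis unfolding exps_def by (intro finite_SigmaI) auto
qed

text \<open>The bound on \<open>w\<close> makes every \<open>j < p\<close> contribute. By
  coprimality the remainders of \<open>w - d * j\<close> modulo \<open>p\<close> run through all
  residues, which evaluates the sum of the quotients; the factor 2 avoids halving
  \<open>p * (p - 1)\<close>.\<close>

lemma card_exps:
  assumes w: "d * (p - 1) \<le> w"
  shows "2 * int (card (exps w)) = 2 * int w + 2 - (int p - 1) * (int d - 1)"
proof -
  have le: "d * j \<le> w" if "j < p" for j
  proof -
    have "d * j \<le> d * (p - 1)" using that by (intro mult_le_mono2) simp
    thus ?thesis using w by (rule order_trans)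
  qed
  have int_w: "int (w - d * j) = int w - int d * int j" if "j < p" for j
    using of_nat_diff[OF le[OF that], where ?'a = int] by simp
  define S where "S = (\<Sum>j<p. (w - d * j) div p)"
  have card: "card (exps w) = S + p"
  proof -
    have "card (exps w) = (\<Sum>j<p. card {i. p * i + d * j \<le> w})"
      unfolding exps_def using exps_fibre le by (intro card_SigmaI) auto
    also have "\<dots> = (\<Sum>j<p. (w - d * j) div p + 1)"
      using exps_fibre le by (intro sum.cong) auto
    also have "\<dots> = S + p" by (simp only: S_def sum.distrib) simp
    finally show ?thesis .
  qed
  have inj: "inj_on (\<lambda>j. (w - d * j) mod p) {..<p}"
  proof (rule inj_onI)
    fix i j assume ij: "i \<in> {..<p}" "j \<in> {..<p}" "(w - d * i) mod p = (w - d * j) mod p"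
    have "int (w - d * i) mod int p = int (w - d * j) mod int p" using ij(3) by (metis of_nat_mod)
    hence "int p dvd int (w - d * i) - int (w - d * j)" by (simp add: mod_eq_dvd_iff)
    moreover have "int (w - d * i) - int (w - d * j) = int d * (int j - int i)"
      using int_w[of i] int_w[of j] ij(1,2) by (simp add: right_diff_distrib)
    ultimately have "int p dvd int d * (int j - int i)" by simp
    hence "int p dvd int j - int i" using coprime_p_d
      by (metis coprime_dvd_mult_right_iff coprime_int_iff)
    moreover have "\<bar>int j - int i\<bar> < int p" using ij(1,2) by auto
    ultimately show "i = j"
      by (metis dvd_imp_le_int eq_iff_diff_eq_0 int_int_eq linorder_not_le abs_of_nat)
  qed
  have "(\<lambda>j. (w - d * j) mod p) ` {..<p} = {..<p}"
    by (rule endo_inj_surj[OF _ _ inj]) (use p_ge_2 in auto)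
  hence "(\<Sum>j<p. (w - d * j) mod p) = (\<Sum>j<p. j)"
    using sum.reindex[OF inj, of id] by simp
  hence "(\<Sum>j<p. w - d * j) = p * S + (\<Sum>j<p. j)"
    unfolding S_def sum_distrib_left by (metis (no_types, lifting) sum.cong sum.distrib mult_div_mod_eq)
  hence 1: "int (\<Sum>j<p. w - d * j) = int p * int S + (\<Sum>j<p. int j)" by simp
  have "int (\<Sum>j<p. w - d * j) = (\<Sum>j<p. int w - int d * int j)"
    unfolding of_nat_sum using int_w by (intro sum.cong) auto
  hence 2: "int (\<Sum>j<p. w - d * j) = int p * int w - int d * (\<Sum>j<p. int j)"
    by (simp add: sum_subtractf sum_distrib_left)
  have 3: "2 * (\<Sum>j<n. int j) = int n * (int n - 1)" for n
    by (induction n) (auto simp: algebra_simps)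
  have "int p * (2 * int S) = 2 * int p * int w - (int d + 1) * (2 * (\<Sum>j<p. int j))"
    using 1 2 by (simp add: ring_distribs)
  also have "\<dots> = int p * (2 * int w - (int d + 1) * (int p - 1))"
    unfolding 3 by (simp add: algebra_simps)
  finally have "int p * (2 * int S) = int p * (2 * int w - (int d + 1) * (int p - 1))" .
  hence "2 * int S = 2 * int w - (int d + 1) * (int p - 1)" using p_ge_2 by simp
  thus ?thesis unfolding card by (simp add: algebra_simps)
qed

lemma finite_polys: "finite (polys w)" and card_polys: "card (polys w) = q ^ card (exps w)"
proof -
  let ?c = "\<lambda>C. restrict (\<lambda>(j, i). coeff (coeff C j) i) (exps w)"
  have "bij_betw ?c (polys w) (exps w \<rightarrow>\<^sub>E (UNIV :: 'k set))"
    unfolding bij_betw_def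
  proof
    show "inj_on ?c (polys w)"
    proof (rule inj_onI)
      fix C C' assume C: "C \<in> polys w" "C' \<in> polys w" "?c C = ?c C'"
      have "coeff (coeff C j) i = coeff (coeff C' j) i" for i j
      proof (cases "(j, i) \<in> exps w")
        case True
        thus ?thesis using fun_cong[OF C(3), of "(j, i)"] by simp
      next
        case False
        have "coeff (coeff D j) i = 0" if D: "D \<in> polys w" for D
        proof (rule ccontr)
          assume nz: "coeff (coeff D j) i \<noteq> 0"
          hence "coeff D j \<noteq> 0" by auto
          hence "j \<le> degree D" by (rule le_degree)
          thus False using nz False D wleD by (auto simp: polys_def exps_def)
        qed
        thus ?thesis using C by simp
      qed
      thus "C = C'" by (intro poly_eqI)
    qed
    show "?c ` polys w = exps w \<rightarrow>\<^sub>E UNIV"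
    proof (intro equalityI subsetI)
      fix c assume c: "c \<in> exps w \<rightarrow>\<^sub>E (UNIV :: 'k set)"
      define C where "C = (\<Sum>(j, i)\<in>exps w. monom (monom (c (j, i)) i) j)"
      have coeff: "coeff (coeff C j) i = (if (j, i) \<in> exps w then c (j, i) else 0)" for i j
      proof -
        have "coeff (coeff C j) i = (\<Sum>t\<in>exps w. if t = (j, i) then c t else 0)"
          unfolding C_def by (auto simp: coeff_sum intro!: sum.cong split: if_splits)
        thus ?thesis using finite_exps by (simp add: sum.delta)
      qed
      have "degree C \<le> p - 1"
      proof (rule degree_le, intro allI impI poly_eqI)
        fix j i assume "p - 1 < j"
        hence "\<not> j < p" by simp
        thus "coeff (coeff C j) i = coeff 0 i" by (simp add: coeff exps_def)
      qed
      hence "C \<in> polys w" using p_ge_2 by (auto simp: polys_def wle_def coeff exps_def split: if_splits)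
      moreover have "?c C = c" using c by (auto simp: coeff fun_eq_iff PiE_def extensional_def)
      ultimately show "c \<in> ?c ` polys w" by blast
    qed auto
  qed
  note bij = this
  have fin: "finite (exps w \<rightarrow>\<^sub>E (UNIV :: 'k set))" using finite_exps by (intro finite_PiE) auto
  show "finite (polys w)" using bij fin by (simp add: bij_betw_finite)
  show "card (polys w) = q ^ card (exps w)"
    using bij_betw_same_card[OF bij] finite_exps by (simp add: card_PiE q_def)
qed

end

subsection \<open>The genus\<close>

context as_function_field
begin

text \<open>The divisor of poles of \<open>pi_r r ^ e\<close>, up to the multiplicity at infinity.\<close>

definition D :: "nat \<Rightarrow> nat \<Rightarrow> nat \<Rightarrow> 'f set \<Rightarrow> int" where
  "D r e w P = (if P = inf_ring then int w else if P \<in> aff_ring ` pts_r r then int e else 0)"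

lemma aff_ne_inf: "s \<in> pts \<Longrightarrow> aff_ring s \<noteq> inf_ring"
  using x_in_aff x_notin_inf by auto

lemma D_inf: "D r e w inf_ring = int w"
  by (simp add: D_def)

lemma D_aff: "s \<in> pts \<Longrightarrow> D r e w (aff_ring s) = (if aff_ring s \<in> aff_ring ` pts_r r then int e else 0)"
  by (simp add: D_def aff_ne_inf)

text \<open>Multiplication by the \<open>e\<close>-th power of \<open>pi_r r\<close> removes the
  poles allowed at its zeros, and a function regular at all affine points is a polynomial. At
  infinity it adds \<open>e * p * q ^ r\<close> to the pole order, and there the pole order of a
  polynomial is its weight.\<close>

lemma RR_D:
  assumes r: "r > 0"
  shows "RR (D r e w) = (\<lambda>C. ev C / ev [:pi_r r:] ^ e) ` polys (w + e * p * q ^ r)"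
proof (intro equalityI subsetI)
  let ?\<pi> = "ev [:pi_r r:]" and ?v = "w + e * p * q ^ r"
  have \<pi>: "?\<pi> \<noteq> 0" "?\<pi> \<in> F" using pi_r_nz[OF r] ev_in_F by auto
  obtain \<pi>' where I: "dvr q m f p d \<iota> x y inf_ring inf_res \<pi>'"
    and val: "\<And>A w. wle w A \<Longrightarrow> lam w A \<noteq> 0 \<Longrightarrow> place_val inf_ring (ev A) = - int w"
    by (rule inf_dvr) (rule that)
  interpret I: dvr q m K f p d \<iota> x y inf_ring inf_res \<pi>' by (rule I)
  have "place_val inf_ring ?\<pi> = - int (p * q ^ r)"
  proof (rule val)
    show "wle (p * q ^ r) [:pi_r r:]" using wle_C[of "pi_r r"] degree_pi_r[OF r] by simp
    have "lam (p * q ^ r + d * 0) [:pi_r r:] = coeff (pi_r r) (q ^ r)"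
      using p_ge_2 by (subst lam_reduced) auto
    also have "\<dots> = 1" using one_less_qr[OF r] by (simp add: pi_r_def)
    finally show "lam (p * q ^ r) [:pi_r r:] \<noteq> 0" by simp
  qed
  hence val_pow: "place_val inf_ring (?\<pi> ^ e) = - int (e * p * q ^ r)"
  proof (induction e)
    case (Suc e)
    have "?\<pi> ^ e \<in> F" using F_powi[OF \<pi>(2), of "int e"] by simp
    thus ?case using Suc \<pi> I.val_mult[of ?\<pi> "?\<pi> ^ e"] by (simp add: algebra_simps)
  qed (use I.val_unit[OF I.P_1] in simp)
  have powF: "?\<pi> ^ e \<in> F" "inverse (?\<pi> ^ e) \<in> F" using F_powi[OF \<pi>(2), of "int e"] F_inverse by auto
  fix z
  {
    assume "z \<in> RR (D r e w)"
    hence zF: "z \<in> F" and zval: "\<And>P. is_place \<iota> F P \<Longrightarrow> z = 0 \<or> place_val P z \<ge> - D r e w P"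
      by (auto simp: RR_iff)
    define u where "u = z * ?\<pi> ^ e"
    have uF: "u \<in> F" unfolding u_def using zF powF by (intro F_mult)
    have "u \<in> aff_ring s" if s: "s \<in> pts" for s
    proof (cases "aff_ring s \<in> aff_ring ` pts_r r")
      case True
      then obtain s' where s': "s' \<in> pts_r r" "aff_ring s = aff_ring s'" by blast
      interpret A: dvr q m K f p d \<iota> x y "aff_ring s'" "aff_res s'" "ev [:pi_r r:]"
        using s' r by (intro aff_dvr) (auto simp: pts_r_def)
      have "z = 0 \<or> place_val (aff_ring s') z \<ge> - int e"
        using zval[OF A.place] D_aff[OF s] s' True by simp
      thus ?thesis using A.val_condition[OF zF] s'(2) by (simp add: u_def)
    next
      case False
      obtain r' where r': "r' > 0" "fst s ^ (q ^ r') = fst s" by (rule in_finite_subfield)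
      interpret A: dvr q m K f p d \<iota> x y "aff_ring s" "aff_res s" "ev [:pi_r r':]"
        by (rule aff_dvr[OF s r'(2,1)])
      have "z = 0 \<or> place_val (aff_ring s) z \<ge> - 0"
        using zval[OF A.place] D_aff[OF s] False by simp
      hence "z \<in> aff_ring s" using A.val_condition[OF zF, of 0] by simp
      thus ?thesis unfolding u_def by (intro A.P_mult A.P_power aff_ring_ev s)
    qed
    then obtain C where C: "degree C < p" "u = ev C" by (rule regular_imp_polynomial[OF uF])
    have "wle ?v C"
    proof (cases "C = 0")
      case False
      then obtain w' where w': "wle w' C" "lam w' C \<noteq> 0" using exists_weight C(1) by blast
      have "ev C \<noteq> 0" using False C(1) ev_eq_0_iff by blast
      hence "z \<noteq> 0" using C(2) by (auto simp: u_def)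
      hence "place_val inf_ring z \<ge> - int w" using zval[OF I.place] D_inf by simp
      moreover have "place_val inf_ring u = place_val inf_ring z - int (e * p * q ^ r)"
        unfolding u_def using \<pi> by (subst I.val_mult[OF zF \<open>z \<noteq> 0\<close> powF(1)]) (auto simp: val_pow)
      ultimately have "- int w' \<ge> - int ?v" using val[OF w'] C(2) by simp
      hence "w' \<le> ?v" by linarith
      with w'(1) show ?thesis by (rule wle_mono)
    qed simp
    hence "C \<in> polys ?v" using C(1) by (simp add: polys_def)
    moreover have "z = ev C / ?\<pi> ^ e" using C(2) \<pi> by (simp add: u_def field_simps)
    ultimately show "z \<in> (\<lambda>C. ev C / ?\<pi> ^ e) ` polys ?v" by blast
  next
    assume "z \<in> (\<lambda>C. ev C / ?\<pi> ^ e) ` polys ?v"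
    then obtain C where C: "degree C < p" "wle ?v C" "z = ev C / ?\<pi> ^ e" by (auto simp: polys_def)
    have zF: "z \<in> F" unfolding C(3) divide_inverse by (intro F_mult ev_in_F powF)
    have evC: "ev C = z * ?\<pi> ^ e" using C(3) \<pi> by (simp add: field_simps)
    have "z = 0 \<or> place_val P z \<ge> - D r e w P" if P: "is_place \<iota> F P" for P
    proof -
      consider "P = inf_ring" | s where "s \<in> pts" "P = aff_ring s" using P unfolding is_place_iff by blast
      thus ?thesis
      proof cases
        case 1
        show ?thesis
        proof (cases "z = 0")
          case False
          hence "ev C \<noteq> 0" using evC \<pi> by simp
          hence "C \<noteq> 0" by auto
          then obtain w' where w': "wle w' C" "lam w' C \<noteq> 0" using exists_weight C(1) by blast
          have "w' \<le> ?v" using lam_eq_0[OF C(2)] w'(2) by (meson not_le)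
          moreover have "- int w' = place_val inf_ring z - int (e * p * q ^ r)"
            unfolding val[OF w', symmetric] evC
            using \<pi> by (subst I.val_mult[OF zF False powF(1)]) (auto simp: val_pow)
          ultimately show ?thesis unfolding 1 D_inf by linarith
        qed simp
      next
        case 2
        show ?thesis
        proof (cases "aff_ring s \<in> aff_ring ` pts_r r")
          case True
          then obtain s' where s': "s' \<in> pts_r r" "aff_ring s = aff_ring s'" by blast
          hence pts': "s' \<in> pts" by (auto simp: pts_r_def)
          interpret A: dvr q m K f p d \<iota> x y "aff_ring s'" "aff_res s'" "ev [:pi_r r:]"
            using s' r by (intro aff_dvr) (auto simp: pts_r_def)
          have "z * ?\<pi> powi int e \<in> aff_ring s'" using aff_ring_ev[OF pts', of C] evC by simp
          thus ?thesis using A.val_condition[OF zF] D_aff[OF 2(1)] True s'(2) 2(2) by simp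
        next
          case False
          obtain r' where r': "r' > 0" "fst s ^ (q ^ r') = fst s" by (rule in_finite_subfield)
          interpret A: dvr q m K f p d \<iota> x y "aff_ring s" "aff_res s" "ev [:pi_r r':]"
            by (rule aff_dvr[OF 2(1) r'(2,1)])
          have "s \<notin> pts_r r" using False by blast
          hence "evs s ([:pi_r r:] ^ e) \<noteq> 0" using 2(1) by (simp add: pts_r_def)
          from aff_ringI[OF 2(1) this, of C] have "z \<in> aff_ring s" using C(3) by simp
          hence "z = 0 \<or> place_val (aff_ring s) z \<ge> - 0" using A.val_condition[OF zF, of 0] by simp
          thus ?thesis using D_aff[OF 2(1)] False 2(2) by simp
        qed
      qed
    qed
    thus "z \<in> RR (D r e w)" using zF by (simp add: RR_iff)
  }
qed

lemma finite_RR_D: "r > 0 \<Longrightarrow> finite (RR (D r e w))"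
  by (simp add: RR_D finite_polys)

lemma card_RR_D:
  assumes r: "r > 0"
  shows "card (RR (D r e w)) = q ^ card (exps (w + e * p * q ^ r))"
proof -
  have "inj_on (\<lambda>C. ev C / ev [:pi_r r:] ^ e) (polys (w + e * p * q ^ r))"
  proof (rule inj_onI)
    fix C C' assume C: "C \<in> polys (w + e * p * q ^ r)" "C' \<in> polys (w + e * p * q ^ r)"
      "ev C / ev [:pi_r r:] ^ e = ev C' / ev [:pi_r r:] ^ e"
    hence "ev (C - C') = 0" using pi_r_nz[OF r] by simp
    moreover have "degree (C - C') < p" using C by (intro degree_diff_less) (auto simp: polys_def)
    ultimately show "C = C'" using ev_eq_0_iff by force
  qed
  thus ?thesis unfolding RR_D[OF r] by (simp add: card_image card_polys)
qed

lemma ell_D: "r > 0 \<Longrightarrow> ell \<iota> F (D r e w) = card (exps (w + e * p * q ^ r))"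
proof -
  assume r: "r > 0"
  have "q ^ ell \<iota> F (D r e w) = q ^ card (exps (w + e * p * q ^ r))"
    using card_RR[OF finite_RR_D[OF r]] card_RR_D[OF r] by simp
  thus ?thesis using q_ge_2 by (subst (asm) power_inject_exp) auto
qed

lemma D_support: "P \<notin> insert inf_ring (aff_ring ` pts_r r) \<Longrightarrow> D r e w P = 0"
  by (simp add: D_def)

lemma D_divisor: "r > 0 \<Longrightarrow> D r e w \<in> divisors \<iota> F"
proof -
  assume r: "r > 0"
  have "{P. D r e w P \<noteq> 0} \<subseteq> insert inf_ring (aff_ring ` pts_r r)" using D_support by blast
  moreover have "finite (insert inf_ring (aff_ring ` pts_r r))" using finite_pts_r[OF r] by simp
  moreover have "is_place \<iota> F P" if "P \<in> insert inf_ring (aff_ring ` pts_r r)" for P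
    using that unfolding is_place_iff by (auto simp: pts_r_def)
  ultimately show ?thesis unfolding divisors_def by (auto dest: finite_subset)
qed

lemma degree_D:
  assumes r: "r > 0"
  shows "divisor_degree \<iota> (D r e w) = int w + int e * (\<Sum>P\<in>aff_ring ` pts_r r. int (place_degree \<iota> P))"
proof -
  have notin: "inf_ring \<notin> aff_ring ` pts_r r" using aff_ne_inf by (auto simp: pts_r_def)
  have "divisor_degree \<iota> (D r e w) = (\<Sum>P\<in>insert inf_ring (aff_ring ` pts_r r). D r e w P * int (place_degree \<iota> P))"
    using finite_pts_r[OF r] D_support by (intro divisor_degree_eq) auto
  also have "\<dots> = int w + (\<Sum>P\<in>aff_ring ` pts_r r. D r e w P * int (place_degree \<iota> P))"
    using finite_pts_r[OF r] notin by (simp add: D_inf degree_inf)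
  also have "(\<Sum>P\<in>aff_ring ` pts_r r. D r e w P * int (place_degree \<iota> P)) =
      (\<Sum>P\<in>aff_ring ` pts_r r. int e * int (place_degree \<iota> P))"
  proof (rule sum.cong)
    fix P assume "P \<in> aff_ring ` pts_r r"
    hence "D r e w P = int e" using notin by (auto simp: D_def)
    thus "D r e w P * int (place_degree \<iota> P) = int e * int (place_degree \<iota> P)" by simp
  qed simp
  finally show ?thesis by (simp add: sum_distrib_left)
qed

lemma common_subfield:
  assumes "finite T" "T \<subseteq> aff_ring ` pts"
  shows "\<exists>r>0. T \<subseteq> aff_ring ` pts_r r"
  using assms
proof (induction T rule: finite_induct)
  case (insert P T)
  then obtain r where r: "r > 0" "T \<subseteq> aff_ring ` pts_r r" by auto
  obtain s where s: "s \<in> pts" "P = aff_ring s" using insert.prems by auto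
  obtain r' where r': "r' > 0" "fst s ^ (q ^ r') = fst s" by (rule in_finite_subfield)
  have "pts_r r \<subseteq> pts_r (r * r')" using power_q_power_mult by (auto simp: pts_r_def)
  moreover have "s \<in> pts_r (r * r')"
    using power_q_power_mult[OF r'(2), of r] s(1) by (simp add: pts_r_def mult.commute)
  ultimately have "insert P T \<subseteq> aff_ring ` pts_r (r * r')" using r(2) s(2) by blast
  thus ?case using r(1) r'(1) by (intro exI[of _ "r * r'"]) auto
qed (auto intro: exI[of _ 1])

text \<open>If \<open>p\<close> is even, coprimality makes \<open>d\<close> odd, so the halving in
  the genus is exact.\<close>

lemma two_genus: "2 * int ((p - 1) * (d - 1) div 2) = (int p - 1) * (int d - 1)"
proof -
  have "even ((p - 1) * (d - 1))"
  proof (cases "even p")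
    case True
    hence "odd d" using coprime_p_d by (metis coprime_common_divisor_nat numeral_eq_one_iff semiring_norm(85))
    thus ?thesis by simp
  next
    case False
    thus ?thesis by simp
  qed
  hence "2 * int ((p - 1) * (d - 1) div 2) = int ((p - 1) * (d - 1))" by (metis dvd_mult_div_cancel of_nat_mult of_nat_numeral)
  also have "\<dots> = (int p - 1) * (int d - 1)" using p_ge_2 d_pos by (simp add: of_nat_diff)
  finally show ?thesis .
qed

lemma card_exps_genus:
  "d * (p - 1) \<le> w \<Longrightarrow> int (card (exps w)) = int w + 1 - int ((p - 1) * (d - 1) div 2)"
  using card_exps[of w] two_genus by linarith

text \<open>Enlarging a divisor cannot decrease degree minus \<open>ell\<close>, so it suffices to
  treat a divisor \<open>B\<close> above \<open>A\<close> whose \<open>ell\<close> is known exactly.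
  The bound on the degree of \<open>B\<close> comes from \<open>sum_degree_aff_le\<close>.\<close>

lemma riemann_inequality:
  assumes A: "A \<in> divisors \<iota> F"
  shows "divisor_degree \<iota> A - int (ell \<iota> F A) + 1 \<le> int ((p - 1) * (d - 1) div 2)"
proof -
  define T where "T = {P. A P \<noteq> 0} - {inf_ring}"
  have fin: "finite {P. A P \<noteq> 0}" and pl: "\<And>P. A P \<noteq> 0 \<Longrightarrow> is_place \<iota> F P"
    using A by (auto simp: divisors_def)
  have T: "finite T" "T \<subseteq> aff_ring ` pts"
    using fin pl unfolding T_def is_place_iff by auto
  obtain r where r: "r > 0" "T \<subseteq> aff_ring ` pts_r r" using common_subfield[OF T] by blast
  define e where "e = (\<Sum>P\<in>T. nat (A P))"
  \<comment> \<open>The summand \<open>d * (p - 1)\<close> places \<open>v\<close> in the range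
    where \<open>card_exps_genus\<close> applies.\<close>
  define w where "w = nat (A inf_ring) + d * (p - 1)"
  define B where "B = D r e w"
  define v where "v = w + e * p * q ^ r"
  define S where "S = insert inf_ring (aff_ring ` pts_r r)"
  have S: "finite S" using finite_pts_r[OF r(1)] by (simp add: S_def)
  have outside: "A P = 0" "B P = 0" if "P \<notin> S" for P
    using that r(2) D_support by (auto simp: T_def S_def B_def)
  have le: "A P \<le> B P" for P
  proof (cases "P = inf_ring")
    case True
    show ?thesis unfolding True B_def D_inf w_def of_nat_add
      using of_nat_0_le_iff[of "d * (p - 1)", where ?'a = int] by linarith
  next
    case ne: False
    show ?thesis
    proof (cases "P \<in> T")
      case True
      hence "nat (A P) \<le> e" unfolding e_def using T(1) by (intro member_le_sum) auto
      moreover have "B P = int e" using True r(2) ne by (auto simp: B_def D_def)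
      ultimately show ?thesis by linarith
    next
      case False
      hence "A P = 0" using ne by (auto simp: T_def)
      thus ?thesis by (simp add: B_def D_def)
    qed
  qed
  have finB: "finite (RR B)" unfolding B_def by (rule finite_RR_D[OF r(1)])
  have finA: "finite (RR A)" using RR_mono[of A B, OF le] finB by (rule finite_subset)
  have "card (RR B) \<le> card (RR A) * q ^ (\<Sum>P\<in>S. nat (B P - A P) * place_degree \<iota> P)"
  proof (rule RR_compare[OF S _ _ le finB])
    show "is_place \<iota> F P" if "P \<in> S" for P
      using that unfolding is_place_iff by (auto simp: S_def pts_r_def)
  qed (simp add: outside)
  hence "q ^ card (exps v) \<le> q ^ (ell \<iota> F A + (\<Sum>P\<in>S. nat (B P - A P) * place_degree \<iota> P))"
    unfolding card_RR[OF finA] unfolding B_def card_RR_D[OF r(1)] by (simp add: v_def power_add)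
  hence "card (exps v) \<le> ell \<iota> F A + (\<Sum>P\<in>S. nat (B P - A P) * place_degree \<iota> P)"
    using q_ge_2 by (subst (asm) power_increasing_iff) auto
  hence "int (card (exps v)) \<le> int (ell \<iota> F A) + (\<Sum>P\<in>S. int (nat (B P - A P)) * int (place_degree \<iota> P))"
    by (metis (mono_tags, lifting) of_nat_add of_nat_le_iff of_nat_mult of_nat_sum sum.cong)
  also have "(\<Sum>P\<in>S. int (nat (B P - A P)) * int (place_degree \<iota> P)) =
      divisor_degree \<iota> B - divisor_degree \<iota> A"
  proof -
    have "(\<Sum>P\<in>S. int (nat (B P - A P)) * int (place_degree \<iota> P)) =
        (\<Sum>P\<in>S. B P * int (place_degree \<iota> P) - A P * int (place_degree \<iota> P))"
      using le by (intro sum.cong) (auto simp: left_diff_distrib)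
    also have "\<dots> = divisor_degree \<iota> B - divisor_degree \<iota> A"
      using divisor_degree_eq[OF S outside(1)] divisor_degree_eq[OF S outside(2)]
      by (simp add: sum_subtractf)
    finally show ?thesis .
  qed
  finally have "int (card (exps v)) \<le> int (ell \<iota> F A) + (divisor_degree \<iota> B - divisor_degree \<iota> A)" .
  moreover have "divisor_degree \<iota> B \<le> int v"
  proof -
    have "(\<Sum>P\<in>aff_ring ` pts_r r. int (place_degree \<iota> P)) \<le> int (p * q ^ r)"
      unfolding of_nat_sum[symmetric] of_nat_le_iff by (rule sum_degree_aff_le[OF r(1)])
    hence "int e * (\<Sum>P\<in>aff_ring ` pts_r r. int (place_degree \<iota> P)) \<le> int e * int (p * q ^ r)"
      by (intro mult_left_mono) auto
    thus ?thesis unfolding B_def degree_D[OF r(1)] v_def by (simp add: mult.assoc)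
  qed
  moreover have "int (card (exps v)) = int v + 1 - int ((p - 1) * (d - 1) div 2)"
    by (rule card_exps_genus) (simp add: v_def w_def)
  ultimately show ?thesis by linarith
qed

lemma genus_eq: "genus \<iota> F = int ((p - 1) * (d - 1) div 2)"
  unfolding genus_def
proof (rule Greatest_equality)
  \<comment> \<open>A multiple of the place at infinity attains the bound as soon as its coefficient
    reaches the range of \<open>card_exps_genus\<close>; with \<open>e = 0\<close> the affine part
    of \<open>D\<close> is empty.\<close>
  define w where "w = d * (p - 1)"
  have r: "(1::nat) > 0" by simp
  have "divisor_degree \<iota> (D 1 0 w) = int w" using degree_D[OF r, of 0 w] by simp
  moreover have "int (ell \<iota> F (D 1 0 w)) = int w + 1 - int ((p - 1) * (d - 1) div 2)"
    using ell_D[OF r, of 0 w] card_exps_genus[of w] by (simp add: w_def)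
  ultimately show "\<exists>A\<in>divisors \<iota> F. int ((p - 1) * (d - 1) div 2) = divisor_degree \<iota> A - int (ell \<iota> F A) + 1"
    using D_divisor[OF r, of 0 w] by (intro bexI[of _ "D 1 0 w"]) auto
qed (use riemann_inequality in auto)

text \<open>An element algebraic over the constants is integral, so it lies in every valuation ring,
  that is, in the Riemann-Roch space of the zero divisor. The only polynomials of weight 0 are
  constants.\<close>

lemma geometrically_connected: "geometrically_connected \<iota> F"
  unfolding geometrically_connected_def
proof (intro ballI impI)
  fix z assume z: "z \<in> F" and "\<exists>h. h \<noteq> 0 \<and> poly (map_poly \<iota> h) z = 0"
  then obtain h where h: "h \<noteq> 0" "poly (map_poly \<iota> h) z = 0" by blast
  have zP: "z \<in> P" if P: "is_place \<iota> F P" for P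
  proof (rule ccontr)
    assume zP: "z \<notin> P"
    interpret P: place_ring q m K f p d \<iota> x y P by unfold_locales (rule P)
    define v where "v = inverse z"
    have v: "v \<in> max_ideal P" unfolding v_def using z zP by (rule P.notin_imp_inverse_M)
    have z0: "z \<noteq> 0" using zP P.P_0 by auto
    define n where "n = degree h"
    have "(\<Sum>i\<le>n. \<iota> (coeff h i) * z ^ i) * v ^ n = 0"
      using h(2) \<iota>.eval_altdef[of h n z] by (simp add: n_def)
    moreover have "(\<Sum>i\<le>n. \<iota> (coeff h i) * z ^ i) * v ^ n = (\<Sum>i\<le>n. \<iota> (coeff h i) * v ^ (n - i))"
      unfolding sum_distrib_right
    proof (rule sum.cong)
      fix i assume "i \<in> {..n}"
      hence "v ^ n = v ^ i * v ^ (n - i)" by (simp flip: power_add)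
      thus "\<iota> (coeff h i) * z ^ i * v ^ n = \<iota> (coeff h i) * v ^ (n - i)"
        using z0 by (simp add: v_def power_inverse)
    qed simp
    moreover have "\<dots> = (\<Sum>i<n. \<iota> (coeff h i) * v ^ (n - i)) + \<iota> (lead_coeff h)"
      by (simp add: n_def lessThan_Suc_atMost[symmetric])
    ultimately have "(\<Sum>i<n. \<iota> (coeff h i) * v ^ (n - i)) + \<iota> (lead_coeff h) = 0" by simp
    hence "0 - \<iota> (lead_coeff h) = (\<Sum>i<n. \<iota> (coeff h i) * v ^ (n - i))" by (metis add_diff_cancel_right')
    also have "\<dots> \<in> max_ideal P" by (intro P.M_sum P.M_mult' P.M_power v P.P_const) auto
    finally have "\<iota> (inverse (lead_coeff h)) * (0 - \<iota> (lead_coeff h)) \<in> max_ideal P"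
      by (intro P.M_mult' P.P_const)
    moreover have "\<iota> (inverse (lead_coeff h)) * \<iota> (lead_coeff h) = 1"
      unfolding \<iota>.map_mult[symmetric] using h(1) by simp
    ultimately have "0 - 1 \<in> max_ideal P" by (simp add: right_diff_distrib)
    from P.M_diff[OF P.M_0 this] show False using P.one_notin_M by simp
  qed
  have "z = 0 \<or> place_val P z \<ge> - D 1 0 0 P" if P: "is_place \<iota> F P" for P
  proof -
    obtain \<phi> \<pi> where "dvr q m f p d \<iota> x y P \<phi> \<pi>" using place_dvr[OF P] .
    then interpret dvr q m K f p d \<iota> x y P \<phi> \<pi> .
    have "D 1 0 0 P = 0" by (simp add: D_def)
    thus ?thesis using val_condition[OF z, of 0] zP[OF P] by simp
  qed
  hence "z \<in> RR (D 1 0 0)" using z by (simp add: RR_iff)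
  then obtain C where C: "degree C < p" "wle 0 C" "z = ev C"
    unfolding RR_D[OF zero_less_one] by (auto simp: polys_def)
  have "coeff (coeff C j) i = 0" if "\<not> (i = 0 \<and> j = 0)" for i j
    using wleD[OF C(2), of j i] that p_ge_2 d_pos by (cases i; cases j) auto
  hence "C = [:[:coeff (coeff C 0) 0:]:]"
    by (intro poly_eqI) (auto simp: coeff_pCons split: nat.splits)
  hence "z = \<iota> (coeff (coeff C 0) 0)" using C(3) ev_const by metis
  thus "z \<in> range \<iota>" by blast
qed

theorem is_maximal_iff:
  "is_maximal \<iota> F \<longleftrightarrow>
    int (card {s \<in> pts. fst s ^ (q ^ 2) = fst s \<and> snd s ^ (q ^ 2) = snd s}) =
      int q ^ 2 + (int p - 1) * (int d - 1) * int q"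
proof -
  have Q: "quadratic_ext = {z :: 'k alg_closure. z ^ (q ^ 2) = z}"
    by (simp add: quadratic_ext_def q_def)
  have "card (rational_points \<iota> F to_ac (quadratic_ext :: 'k alg_closure set)) =
      card {s \<in> pts. fst s ^ (q ^ 2) = fst s \<and> snd s ^ (q ^ 2) = snd s} + 1"
    unfolding Q using card_rational_points[of 2] by simp
  thus ?thesis
    unfolding is_maximal_def genus_eq two_genus using geometrically_connected
    by (simp add: q_def)
qed

end

section \<open>Existence of the function field\<close>

context as_curve
begin

text \<open>\<open>x\<close> is the variable and \<open>y\<close> any root of the equation over it.
  A relation not divisible by \<open>G\<close> would, by
  \<open>ideal_contains_polynomial_in_x\<close>, give a nonzero polynomial in \<open>x\<close> that
  vanishes.\<close>

lemma exists_generic_point: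
  obtains x y :: "'k poly fract alg_closure" where "as_function_field q m f p d const x y"
proof -
  interpret c: ring_map "const :: 'k \<Rightarrow> _" by (rule ring_map_const)
  define x :: "'k poly fract alg_closure" where "x = to_ac (to_fract [:0, 1:])"
  have ev_x: "poly (map_poly const h) x = to_ac (to_fract h)" for h :: "'k poly"
  proof (induction h)
    case (pCons a h)
    have "pCons a h = [:a:] + [:0, 1:] * h" by simp
    hence "to_fract (pCons a h) = to_fract [:a:] + to_fract [:0, 1:] * to_fract h"
      by (simp only: to_fract_add to_fract_mult)
    thus ?case unfolding c.eval_pCons pCons.IH by (simp add: const_def x_def)
  qed simp
  define Y where "Y = monom 1 p - monom 1 1 - [:poly (map_poly const f) x:]"
  have "degree Y = p" unfolding Y_def using p_ge_2
    by (intro antisym degree_diff_le le_degree) (auto simp: degree_monom_eq coeff_pCons split: nat.splits)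
  hence "degree Y > 0" using p_ge_2 by simp
  then obtain y where "poly Y y = 0" using alg_closed_imp_poly_has_root by blast
  hence y: "y ^ p - y - poly (map_poly const f) x = 0" by (simp add: Y_def poly_monom)
  interpret ev: ring_map "\<lambda>A. eval2 const A x y" by (rule ring_map_eval2[OF ring_map_const])
  have G: "eval2 const G x y = 0"
    using y by (simp add: G_def eval2_monom eval2_C ring_map_const)
  have red: "C = 0" if C: "degree C < p" "eval2 const C x y = 0" for C
  proof (rule ccontr)
    assume "C \<noteq> 0"
    define I where "I = {A. eval2 const A x y = 0}"
    obtain N where "N \<noteq> 0" "[:N:] \<in> I"
      by (rule ideal_contains_polynomial_in_x[of I C]) (use C \<open>C \<noteq> 0\<close> G in \<open>auto simp: I_def\<close>)
    thus False by (simp add: I_def eval2_C ring_map_const ev_x)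
  qed
  have "eval2 const H x y = 0 \<longleftrightarrow> G dvd H" for H
  proof
    assume H: "eval2 const H x y = 0"
    obtain C where C: "degree C < p" "G dvd H - C" using reduce[of H] by blast
    then obtain Q where "H - C = G * Q" by (elim dvdE)
    hence "eval2 const H x y - eval2 const C x y = 0" using G by (simp flip: ev.map_diff)
    hence "C = 0" using H by (intro red C(1)) simp
    thus "G dvd H" using C(2) by simp
  qed (use G in \<open>auto elim!: dvdE\<close>)
  hence "as_function_field q m f p d const x y" by unfold_locales
  thus ?thesis by (rule that)
qed

lemma exists_function_field: "\<exists>F. is_function_field_of const G F"
proof -
  obtain x y :: "'k poly fract alg_closure" where "as_function_field q m f p d const x y"
    by (rule exists_generic_point)
  then interpret A: as_function_field q m K f p d const x y .
  show ?thesis unfolding is_function_field_of_def using A.kernel by blast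
qed

lemma is_maximalI:
  assumes F: "is_function_field_of const G F"
    and card: "int (card {s \<in> pts. fst s ^ (q ^ 2) = fst s \<and> snd s ^ (q ^ 2) = snd s}) =
      int q ^ 2 + (int p - 1) * (int d - 1) * int q"
  shows "is_maximal const F"
proof -
  obtain x y where xy: "\<And>H. eval2 const H x y = 0 \<longleftrightarrow> G dvd H"
    "F = {eval2 const A x y / eval2 const B x y | A B. True}"
    using F unfolding is_function_field_of_def by blast
  interpret A: as_function_field q m K f p d const x y
    by unfold_locales (use xy(1) ring_map_const in \<open>auto simp: ring_map_def\<close>)
  have "F = A.F" unfolding xy(2) A.F_def ..
  thus ?thesis using A.is_maximal_iff card by simp
qed

end

section \<open>Zeros of the quadratic form in characteristic 2\<close>

lemma sum_lessThan_add:
  fixes g :: "nat \<Rightarrow> 'a::comm_monoid_add"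
  shows "(\<Sum>i<a + b. g i) = (\<Sum>i<a. g i) + (\<Sum>i<b. g (a + i))"
  by (induction b) (auto simp: add.assoc)

lemma sum_lessThan_double:
  fixes g :: "nat \<Rightarrow> 'a::comm_monoid_add"
  shows "(\<Sum>i<2 * h. g i) = (\<Sum>a<h. g (2 * a) + g (2 * a + 1))"
  by (induction h) (auto simp: add_ac)

lemma card_eq_fibres:
  assumes "finite B" "\<And>x. x \<in> A \<Longrightarrow> g x \<in> B" "\<And>b. b \<in> B \<Longrightarrow> card {x \<in> A. g x = b} = c" "finite A"
  shows "card A = card B * c"
proof -
  have "card A = (\<Sum>b\<in>g ` A. card {x \<in> A. g x = b})"
    using sum.image_gen[OF assms(4), of "\<lambda>_. 1::nat" g] by simp
  also have "\<dots> = (\<Sum>b\<in>B. card {x \<in> A. g x = b})"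
  proof (rule sum.mono_neutral_left)
    show "\<forall>b\<in>B - g ` A. card {x \<in> A. g x = b} = 0"
      by (auto simp: card_eq_0_iff)
  qed (use assms in auto)
  also have "\<dots> = card B * c" using assms(3) by simp
  finally show ?thesis .
qed

locale char2_form =
  fixes e h :: nat and t :: "'l::alg_closed_field"
  assumes CHAR_2: "CHAR('l) = 2" and e_pos: "e > 0" and h_pos: "h > 0"
begin

definition p :: nat where "p = 2 ^ e"
definition n :: nat where "n = 2 * h"
text \<open>In the application \<open>q = p ^ N\<close>, so \<open>s N\<close> is the
  \<open>q\<close>-power map and \<open>V\<close> is the field with \<open>q ^ 2\<close>
  elements.\<close>

definition N :: nat where "N = 4 * n"

definition s :: "nat \<Rightarrow> 'l \<Rightarrow> 'l" where "s i x = x ^ (p ^ i)"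

lemma two_eq_0 [simp]: "(2 :: 'l) = 0"
  using CHAR_2 by (metis of_nat_CHAR of_nat_numeral)

lemma add_self [simp]: "a + a = (0 :: 'l)"
  using two_eq_0 by (metis mult_2 mult_zero_left)

lemma add_self_left [simp]: "a + (a + b) = (b :: 'l)"
  by (simp flip: add.assoc)

lemma uminus_eq [simp]: "- a = (a :: 'l)"
  using add_self[of a] by (metis add_eq_0_iff)

lemma diff_eq_add [simp]: "a - b = (a + b :: 'l)"
  using uminus_eq by (metis diff_conv_add_uminus)

lemma add_eq_0_iff_eq: "a + b = (0 :: 'l) \<longleftrightarrow> b = a"
  by (metis add_self add_self_left add_0_right)

lemma p_power: "p ^ i = CHAR('l) ^ (e * i)"
  by (simp add: p_def CHAR_2 power_mult)

lemma prime_CHAR_2: "prime CHAR('l)"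
  by (simp add: CHAR_2)

lemma s_add [simp]: "s i (a + b) = s i a + s i b"
  unfolding s_def by (rule freshmans_dream'[OF prime_CHAR_2 p_power])

lemma s_mult [simp]: "s i (a * b) = s i a * s i b"
  by (simp add: s_def power_mult_distrib)

lemma s_1 [simp]: "s i 1 = 1"
  by (simp add: s_def)

lemma s_power: "s i (a ^ k) = s i a ^ k"
  by (simp add: s_def mult.commute flip: power_mult)

lemma s_s: "s i (s j a) = s (i + j) a"
  by (simp add: s_def add.commute flip: power_mult power_add)

lemma s_0 [simp]: "s 0 a = a"
  by (simp add: s_def)

lemma p_ge_2: "p \<ge> 2"
  using power_increasing[of 1 e "2::nat"] e_pos by (simp add: p_def)

lemma s_zero [simp]: "s i 0 = 0"
  using s_add[of i 0 0] by simp

lemma s_sum [simp]: "s i (\<Sum>j\<in>A. g j) = (\<Sum>j\<in>A. s i (g j))"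
  by (induction A rule: infinite_finite_induct) auto

lemma s_inj: "s i a = s i b \<Longrightarrow> a = b"
  unfolding s_def p_power by (rule power_eq_imp_eq_prime_char[OF prime_CHAR_2])

lemma s_fixed_mult: "s i a = a \<Longrightarrow> s (i * k) a = a"
proof (induction k)
  case (Suc k)
  have "s (i * Suc k) a = s i (s (i * k) a)" by (simp add: s_s)
  thus ?case using Suc by simp
qed simp

lemma s_fixed_1: "s 1 a = a \<Longrightarrow> s i a = a"
  using s_fixed_mult[of 1 a i] by simp

text \<open>\<open>tr m\<close> is the operator \<open>1 + \<sigma> + \<dots> + \<sigma>\<^sup>m\<^sup>-\<^sup>1\<close> for the Frobenius map \<open>\<sigma> = s 1\<close>.\<close>

definition tr :: "nat \<Rightarrow> 'l \<Rightarrow> 'l" where "tr m a = (\<Sum>i<m. s i a)"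

lemma tr_add [simp]: "tr m (a + b) = tr m a + tr m b"
  by (simp add: tr_def sum.distrib)

lemma tr_zero [simp]: "tr m 0 = 0"
  by (simp add: tr_def)

lemma tr_sum: "tr m (\<Sum>j\<in>A. g j) = (\<Sum>j\<in>A. tr m (g j))"
  by (induction A rule: infinite_finite_induct) auto

lemma s_tr: "s i (tr m a) = tr m (s i a)"
  by (simp add: tr_def s_s add.commute)

lemma tr_tr: "tr m (tr m' a) = tr m' (tr m a)"
proof -
  have "tr m (tr m' a) = (\<Sum>j<m'. s j (tr m a))"
    unfolding tr_def[of m' a] tr_sum by (simp add: s_tr)
  thus ?thesis by (simp add: tr_def[of m' "tr m a"])
qed

text \<open>The operator identity
  \<open>(1 + \<sigma>)(1 + ... + \<sigma>^(m-1)) = 1 + \<sigma>^m\<close> of characteristic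
  2.\<close>

lemma telescope: "tr m a + s 1 (tr m a) = a + s m a"
proof (induction m)
  case (Suc m)
  have "tr (Suc m) a = tr m a + s m a" by (simp add: tr_def)
  hence "tr (Suc m) a + s 1 (tr (Suc m) a) = (tr m a + s 1 (tr m a)) + (s m a + s (Suc m) a)"
    by (simp add: s_s add_ac)
  thus ?case unfolding Suc by (simp add: add.assoc)
qed (simp add: tr_def)

lemma s_telescope: "s m a = a + tr m (a + s 1 a)"
  using telescope[of m a] by (simp add: s_tr)

lemma tr_split: "tr (a + b) w = tr a w + s a (tr b w)"
  unfolding tr_def sum_lessThan_add by (simp add: s_s)

lemma tr_mult_fixed: "s 1 c = c \<Longrightarrow> tr m (c * a) = c * tr m a"
  by (simp add: tr_def sum_distrib_left s_fixed_1)

text \<open>\<open>N\<close> is an even multiple of \<open>n\<close>, so the sum consists of two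
  equal halves.\<close>

lemma tr_periodic: "s n w = w \<Longrightarrow> tr N w = 0"
proof -
  assume "s n w = w"
  hence "s (2 * n) w = w" using s_fixed_mult[of n w 2] by (simp add: mult.commute)
  moreover have "N = 2 * n + 2 * n" by (simp add: N_def)
  ultimately show ?thesis by (simp only: tr_split s_tr add_self)
qed

lemma tr_square: "tr m (a ^ 2) = tr m a ^ 2"
  unfolding tr_def by (simp add: s_power freshmans_dream_sum[OF prime_CHAR_2] CHAR_2)

definition V :: "'l set" where "V = {a. s (2 * N) a = a}"

definition A :: "'l \<Rightarrow> 'l" where "A a = tr n (tr N a)"

definition \<beta> :: "'l \<Rightarrow> 'l" where "\<beta> a = A a + s 1 (A a)"

text \<open>When \<open>s N\<close> fixes \<open>t\<close>, \<open>s (N - i) t\<close> is the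
  \<open>p ^ i\<close>-th root of \<open>t\<close>; this is the sum squared in the linear
  coefficient of the polynomial of the theorem.\<close>

definition coef :: 'l where "coef = (\<Sum>i<n. s (N - i) t)"

definition Q0 :: "'l \<Rightarrow> 'l" where "Q0 a = (\<Sum>k<h. tr (2 * N) (a * s (2 * k + 1) a))"

definition Q :: "'l \<Rightarrow> 'l" where "Q a = Q0 a + tr (2 * N) (coef ^ 2 * a ^ 2)"

lemma \<beta>_eq: "\<beta> a = tr n (a + s N a)"
  using telescope[of N a] unfolding \<beta>_def A_def s_tr[of 1 n] by (metis tr_add)

lemma V_add: "a \<in> V \<Longrightarrow> b \<in> V \<Longrightarrow> a + b \<in> V" and V_mult: "a \<in> V \<Longrightarrow> b \<in> V \<Longrightarrow> a * b \<in> V"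
  and V_s: "a \<in> V \<Longrightarrow> s i a \<in> V"
  by (simp_all add: V_def s_s add.commute) (metis s_s)

lemma A_add [simp]: "A (a + b) = A a + A b"
  by (simp add: A_def)

lemma tr_2N: "tr (2 * N) w = tr N (w + s N w)"
  using tr_split[of N N w] by (simp add: s_tr mult_2)

lemma N_n: "n > 0" "N > 0" "n < N"
  using h_pos by (auto simp: n_def N_def)

text \<open>For fixed \<open>k\<close> the left side runs over the pairs of indices below
  \<open>n\<close> with difference \<open>n - (2 * k + 1)\<close>. As \<open>n\<close> is even,
  these are all odd differences, so each pair of an even and an odd index occurs exactly
  once.\<close>

lemma pairs_opposite_parity:
  fixes g :: "nat \<Rightarrow> 'l"
  shows "(\<Sum>k<h. \<Sum>j<2 * k + 1. g j * g (n - (2 * k + 1) + j)) = (\<Sum>a<h. g (2 * a)) * (\<Sum>b<h. g (2 * b + 1))"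
proof -
  have "(\<Sum>k<h. \<Sum>j<2 * k + 1. g j * g (n - (2 * k + 1) + j)) =
      (\<Sum>(k, j)\<in>(SIGMA k:{..<h}. {..<2 * k + 1}). g j * g (n - (2 * k + 1) + j))"
    by (rule sum.Sigma) auto
  also have "\<dots> = (\<Sum>(a, b)\<in>{..<h} \<times> {..<h}. g (2 * a) * g (2 * b + 1))"
  \<comment> \<open>The smaller index is \<open>j\<close>: it is \<open>2 * a\<close> if
    \<open>a \<le> b\<close> and \<open>2 * b + 1\<close> otherwise. The difference of the two
    indices then determines \<open>k\<close>.\<close>
  proof (rule sum.reindex_bij_witness[of _
      "\<lambda>(a, b). if a \<le> b then (h - 1 - (b - a), 2 * a) else (h - (a - b), 2 * b + 1)"
      "\<lambda>(k, j). if even j then (j div 2, h - 1 - k + j div 2) else (h - k + j div 2, j div 2)"], goal_cases)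
    case (1 x)
    thus ?case by (cases x) (auto elim!: evenE oddE)
  next
    case (2 x)
    thus ?case by (cases x) (auto elim!: evenE oddE)
  next
    case (3 x)
    thus ?case by (cases x) (auto)
  next
    case (4 x)
    thus ?case by (cases x) (auto)
  next
    case (5 x)
    obtain k j where x: "x = (k, j)" by (cases x)
    have kj: "k < h" "j < 2 * k + 1" using 5 by (auto simp: x)
    show ?case
    proof (cases "even j")
      case True
      then obtain a where a: "j = 2 * a" by (elim evenE)
      have "n - (2 * k + 1) + j = 2 * (h - 1 - k + a) + 1" using kj a by (simp add: n_def)
      thus ?thesis using a by (simp add: x)
    next
      case False
      then obtain a where a: "j = 2 * a + 1" by (elim oddE)
      have "n - (2 * k + 1) + j = 2 * (h - k + a)" using kj a by (simp add: n_def)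
      moreover have "j div 2 = a" using a by simp
      ultimately have "g j * g (n - (2 * k + 1) + j) = g (2 * (h - k + j div 2)) * g (2 * (j div 2) + 1)"
        using a by (simp only: mult.commute)
      thus ?thesis using False unfolding x by (simp only: prod.case if_False)
    qed
  qed
  also have "\<dots> = (\<Sum>a<h. g (2 * a)) * (\<Sum>b<h. g (2 * b + 1))"
    by (simp add: sum_product sum.cartesian_product)
  finally show ?thesis .
qed

section \<open>The form where \<open>\<beta> x\<close> is fixed by \<open>\<sigma>\<close>\<close>

context
  fixes x assumes x: "x \<in> V" and \<beta>x: "s 1 (\<beta> x) = \<beta> x"
begin

private definition "z = x + s N x"

private lemma s_N_z: "s N z = z"
proof -
  have "s N (s N x) = x" using x by (simp add: V_def s_s mult_2)
  thus ?thesis by (simp add: z_def add.commute)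
qed

private lemma s_n_z: "s n z = z"
proof -
  have "z + s n z = \<beta> x + s 1 (\<beta> x)" unfolding \<beta>_eq z_def[symmetric] by (rule telescope[symmetric])
  hence "z + s n z = 0" using \<beta>x by simp
  thus ?thesis by (simp add: add_eq_0_iff_eq)
qed

text \<open>Here \<open>z\<close> is fixed by \<open>\<sigma>^n\<close>, so the part quadratic in
  \<open>z\<close> has trace 0. In the mixed part \<open>\<sigma>^i\<close> must be moved across
  \<open>tr N\<close>; since \<open>x\<close> lies only in \<open>V\<close>, this is not free, and
  \<open>s_telescope\<close> turns the cost into the sum over \<open>j\<close>.\<close>

private lemma odd_term:
  assumes i: "0 < i" "i < n"
  shows "tr (2 * N) (x * s i x) = tr N (x * (s i z + s (n - i) z)) + (\<Sum>j<i. s j z * s (n - i + j) z)"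
proof -
  have sNx: "s N x = x + z" by (simp add: z_def)
  have "x * s i x + s N (x * s i x) = x * s i z + z * s i x + z * s i z"
    unfolding s_mult s_s[of N i] add.commute[of N i] s_s[of i N, symmetric] sNx
    by (simp add: algebra_simps)
  hence 1: "tr (2 * N) (x * s i x) = tr N (x * s i z) + tr N (z * s i x) + tr N (z * s i z)"
    unfolding tr_2N by simp
  have "s n (z * s i z) = z * s i z" using s_n_z by (simp add: s_s add.commute[of n i]) (metis s_s)
  hence 2: "tr N (z * s i z) = 0" by (rule tr_periodic)
  define w where "w = x * s (n - i) z"
  have "s i (s (n - i) z) = z" using i s_n_z by (simp add: s_s)
  hence "z * s i x = s i w" by (simp add: w_def mult.commute)
  hence "tr N (z * s i x) = s i (tr N w)" by (simp add: s_tr)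
  also have "\<dots> = tr N w + tr i (tr N w + s 1 (tr N w))" by (rule s_telescope)
  also have "tr N w + s 1 (tr N w) = w + s N w" by (rule telescope)
  also have "s N w = (x + z) * s (n - i) z"
    unfolding w_def s_mult sNx using s_N_z by (simp add: s_s add.commute[of N]) (metis s_s)
  also have "w + (x + z) * s (n - i) z = z * s (n - i) z" by (simp add: w_def algebra_simps)
  finally have 3: "tr N (z * s i x) = tr N w + (\<Sum>j<i. s j z * s (n - i + j) z)"
    by (simp add: tr_def[of i] s_s add.commute)
  show ?thesis unfolding 1 2 3 by (simp add: w_def distrib_left add_ac)
qed

text \<open>The map \<open>i\<close> to \<open>n - i\<close> permutes the odd numbers below
  \<open>n\<close>, so the terms linear in \<open>x\<close> cancel. The rest is a product of the
  sums over even and odd Frobenius powers of \<open>z = (1 + \<sigma>) T x\<close>, which are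
  \<open>A x\<close> and its image under \<open>\<sigma>\<close>.\<close>

lemma Q0_eq: "Q0 x = A x * s 1 (A x)"
proof -
  have 1: "Q0 x = (\<Sum>k<h. tr N (x * (s (2 * k + 1) z + s (n - (2 * k + 1)) z))) +
      (\<Sum>k<h. \<Sum>j<2 * k + 1. s j z * s (n - (2 * k + 1) + j) z)"
    unfolding Q0_def sum.distrib[symmetric] by (intro sum.cong odd_term) (auto simp: n_def)
  have "(\<Sum>k<h. s (n - (2 * k + 1)) z) = (\<Sum>k<h. s (2 * k + 1) z)"
    by (rule sum.reindex_bij_witness[of _ "\<lambda>k. h - 1 - k" "\<lambda>k. h - 1 - k"])
       (auto simp: n_def intro!: arg_cong[where f = "\<lambda>i. s i z"])
  hence 2: "(\<Sum>k<h. tr N (x * (s (2 * k + 1) z + s (n - (2 * k + 1)) z))) = 0"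
    unfolding tr_sum[symmetric] sum_distrib_left[symmetric] sum.distrib by simp
  have 3: "(\<Sum>a<h. s (2 * a) z) = A x"
  proof -
    have "z = tr N x + s 1 (tr N x)" unfolding z_def by (rule telescope[symmetric])
    hence "(\<Sum>a<h. s (2 * a) z) = (\<Sum>a<h. s (2 * a) (tr N x) + s (2 * a + 1) (tr N x))"
      by (simp add: s_s)
    also have "\<dots> = A x" unfolding A_def n_def tr_def[of "2 * h"] sum_lessThan_double ..
    finally show ?thesis .
  qed
  have "(\<Sum>b<h. s (2 * b + 1) z) = s 1 (\<Sum>a<h. s (2 * a) z)" by (simp add: s_s)
  hence 4: "(\<Sum>b<h. s (2 * b + 1) z) = s 1 (A x)" unfolding 3 .
  show ?thesis
    unfolding 1 2 pairs_opposite_parity[of "\<lambda>i. s i z"] 3 4 by simp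
qed

text \<open>This explains the inverse Frobenius powers in \<open>coef\<close>: under
  \<open>tr N\<close>, moving them from \<open>t\<close> onto \<open>z\<close> produces
  \<open>t\<close> times \<open>tr n z = \<beta> x\<close>, and \<open>\<beta> x\<close> can be
  pulled out of the trace.\<close>

lemma linear_term:
  assumes t: "s N t = t"
  shows "tr (2 * N) (coef ^ 2 * x ^ 2) = (\<beta> x * tr N t) ^ 2"
proof -
  have per: "s i (tr N w) = tr N w" if "s N w = w" for w i
  proof -
    have "tr N w + s 1 (tr N w) = 0" unfolding telescope that by simp
    hence "s 1 (tr N w) = tr N w" by (simp only: add_eq_0_iff_eq)
    thus ?thesis by (rule s_fixed_1)
  qed
  have fix_t: "s N (s i t) = s i t" for i
  proof -
    have "s N (s i t) = s i (s N t)" by (simp only: s_s add.commute)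
    thus ?thesis using t by simp
  qed
  have coef: "s N coef = coef" by (simp add: coef_def fix_t)
  have "tr (2 * N) (coef * x) = tr N (coef * z)"
    unfolding tr_2N s_mult coef by (simp add: z_def distrib_left)
  also have "\<dots> = (\<Sum>i<n. tr N (s (N - i) t * z))"
    by (simp add: coef_def sum_distrib_right tr_sum)
  also have "\<dots> = (\<Sum>i<n. tr N (t * s i z))"
  proof (rule sum.cong)
    fix i assume "i \<in> {..<n}"
    hence "i \<le> N" using N_n by simp
    hence "s i (s (N - i) t * z) = t * s i z" using t by (simp add: s_s)
    moreover have "s i (tr N (s (N - i) t * z)) = tr N (s (N - i) t * z)"
      using s_N_z fix_t by (intro per) simp
    ultimately show "tr N (s (N - i) t * z) = tr N (t * s i z)" by (simp only: s_tr)
  qed simp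
  also have "\<dots> = tr N (t * \<beta> x)"
    unfolding \<beta>_eq z_def[symmetric] tr_def[of n] by (simp add: sum_distrib_left tr_sum)
  also have "\<dots> = \<beta> x * tr N t" using tr_mult_fixed[OF \<beta>x, of N t] by (simp add: mult.commute)
  finally show ?thesis unfolding power_mult_distrib[symmetric] tr_square by simp
qed

end

end

section \<open>Fibres of additive polynomials\<close>

lemma pderiv_sum: "pderiv (\<Sum>i\<in>I. g i) = (\<Sum>i\<in>I. pderiv (g i))"
  by (induction I rule: infinite_finite_induct) (auto simp: pderiv_add)

context char2_form
begin

lemma of_nat_p_power: "of_nat (p ^ i) = (if i = 0 then 1 else 0 :: 'l)"
  using e_pos by (auto simp: p_def two_eq_0)

lemma card_fixed: "i > 0 \<Longrightarrow> card {a. s i a = a} = p ^ i" and finite_fixed: "i > 0 \<Longrightarrow> finite {a. s i a = a}"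
proof -
  assume i: "i > 0"
  define P :: "'l poly" where "P = monom 1 (p ^ i) - monom 1 1"
  have pi: "p ^ i > 1" using i p_ge_2 by (intro one_less_power) auto
  have "pderiv P = [:- 1:]" unfolding P_def
    using of_nat_p_power[of i] i by (simp add: pderiv_diff pderiv_monom monom_0 del: of_nat_power)
  hence "card {z. poly P z = 0} = degree P" by (rule card_roots_separable) simp
  also have "degree P = p ^ i" unfolding P_def using pi
    by (intro antisym degree_diff_le le_degree) (auto simp: degree_monom_eq)
  also have "{z. poly P z = 0} = {a. s i a = a}"
    by (auto simp: P_def poly_monom s_def add_eq_0_iff_eq)
  finally show "card {a. s i a = a} = p ^ i" .
  thus "finite {a. s i a = a}" using pi by (metis card.infinite not_less_zero)
qed

lemma finite_V: "finite V" and card_V: "card V = p ^ (2 * N)"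
  unfolding V_def using N_n by (auto intro: finite_fixed card_fixed)

lemma card_artin_schreier: "card {b. s 1 b + b = c} = p"
proof -
  define P :: "'l poly" where "P = monom 1 p + monom 1 1 + [:c:]"
  have "of_nat p = (0 :: 'l)" using of_nat_p_power[of 1] by simp
  hence "pderiv P = [:1:]" unfolding P_def
    by (simp add: pderiv_add pderiv_monom monom_0 pderiv_pCons)
  hence "card {z. poly P z = 0} = degree P" by (rule card_roots_separable) simp
  also have "degree P = p" unfolding P_def using p_ge_2
    by (intro antisym degree_add_le le_degree) (auto simp: degree_monom_eq coeff_pCons split: nat.splits)
  also have "{z. poly P z = 0} = {b. s 1 b + b = c}"
    by (auto simp: P_def poly_monom s_def add_eq_0_iff_eq)
  finally show ?thesis .
qed

lemma A_altdef: "A a = (\<Sum>(j, i)\<in>{..<n} \<times> {..<N}. s (j + i) a)"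
  by (simp add: A_def tr_def s_s sum.cartesian_product)

text \<open>As a polynomial, \<open>A\<close> has derivative 1, since only the index pair
  \<open>(0, 0)\<close> gives a linear term. Its top exponent is
  \<open>(n - 1) + (N - 1) = 5 * n - 2\<close>.\<close>

lemma card_A_fibre: "card {a. A a = v} = p ^ (5 * n - 2)" and finite_A_fibre: "finite {a. A a = v}"
proof -
  let ?I = "{..<n} \<times> {..<N}"
  define S :: "'l poly" where "S = (\<Sum>(j, i)\<in>?I. monom 1 (p ^ (j + i)))"
  define P :: "'l poly" where "P = S - [:v:]"
  have mem: "(0, 0) \<in> ?I" "(n - 1, N - 1) \<in> ?I" using N_n by auto
  have "pderiv S = (\<Sum>x\<in>?I. if x = (0, 0) then 1 else 0)"
    unfolding S_def pderiv_sum
    by (rule sum.cong) (auto simp: pderiv_monom of_nat_p_power monom_0 one_pCons split: if_splits simp del: of_nat_power)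
  also have "\<dots> = 1" using mem(1) by (subst sum.delta) auto
  finally have "pderiv P = [:1:]" by (simp add: P_def pderiv_diff pderiv_pCons one_pCons)
  hence card: "card {z. poly P z = 0} = degree P" by (rule card_roots_separable) simp
  have N2: "5 * n - 2 = (n - 1) + (N - 1)" using N_n by (simp add: N_def)
  have pos: "p ^ (5 * n - 2) > 0" using p_ge_2 by simp
  have "degree P = p ^ (5 * n - 2)"
  proof (rule antisym)
    show "degree P \<le> p ^ (5 * n - 2)" unfolding P_def S_def
    proof (intro degree_diff_le degree_sum_le, goal_cases)
      case (2 x)
      thus ?case unfolding N2 using p_ge_2 by (auto simp: degree_monom_eq intro!: power_increasing)
    qed (use N_n in auto)
    have "coeff S (p ^ (5 * n - 2)) = (\<Sum>x\<in>?I. if x = (n - 1, N - 1) then 1 else 0)"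
      unfolding S_def coeff_sum
    proof (rule sum.cong)
      fix x assume x: "x \<in> ?I"
      obtain j i where ji: "x = (j, i)" by (cases x)
      have "p ^ (j + i) = p ^ (5 * n - 2) \<longleftrightarrow> j + i = (n - 1) + (N - 1)"
        unfolding N2 using p_ge_2 by (intro power_inject_exp) auto
      moreover have "j + i = (n - 1) + (N - 1) \<longleftrightarrow> j = n - 1 \<and> i = N - 1" using x ji by auto
      ultimately show "coeff (case x of (j, i) \<Rightarrow> monom 1 (p ^ (j + i))) (p ^ (5 * n - 2)) =
          (if x = (n - 1, N - 1) then 1 else 0)" by (simp add: ji)
    qed simp
    also have "\<dots> = 1" using mem(2) by (subst sum.delta) auto
    finally have "coeff P (p ^ (5 * n - 2)) = 1"
      using p_ge_2 by (simp add: P_def coeff_pCons split: nat.splits)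
    thus "p ^ (5 * n - 2) \<le> degree P" by (intro le_degree) simp
  qed
  moreover have "poly P z = A z + v" for z
    unfolding P_def S_def A_altdef by (simp add: poly_sum case_prod_beta poly_monom s_def)
  ultimately show "card {a. A a = v} = p ^ (5 * n - 2)"
    using card by (auto simp: add_eq_0_iff_eq eq_commute[of v])
  thus "finite {a. A a = v}" using pos by (metis card.infinite less_irrefl)
qed

text \<open>As operators, \<open>(1 + \<sigma>^2) A = (1 + \<sigma>^n)(1 + \<sigma>^N)\<close>. So
  \<open>b\<close> is fixed by \<open>\<sigma>^n\<close>, hence by \<open>\<sigma>^N\<close>, and
  then \<open>a\<close> by \<open>\<sigma>^(2N)\<close>. Fibres of \<open>A\<close> over the field
  with \<open>p^2\<close> elements thus need no intersection with \<open>V\<close>.\<close>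

lemma A_fixed_imp_V:
  assumes "s 2 (A a) = A a"
  shows "a \<in> V"
proof -
  define b where "b = a + s N a"
  have "\<beta> a + s 1 (\<beta> a) = A a + s 2 (A a)"
    unfolding \<beta>_def by (simp add: s_s numeral_2_eq_2)
  hence "tr n b + s 1 (tr n b) = 0" using assms by (simp add: \<beta>_eq b_def)
  hence "b + s n b = 0" by (simp only: telescope)
  hence "s n b = b" by (simp only: add_eq_0_iff_eq)
  hence "s N b = b" using s_fixed_mult[of n b 4] by (simp add: N_def mult.commute)
  hence "s N a + s (N + N) a = a + s N a" by (simp add: b_def s_s)
  hence "s (N + N) a = a" by (metis add.commute add_self_left)
  thus ?thesis by (simp add: V_def mult_2)
qed

lemma \<beta>_fixed_iff: "s 1 (\<beta> a) = \<beta> a \<longleftrightarrow> s 2 (A a) = A a"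
proof -
  have "\<beta> a + s 1 (\<beta> a) = A a + s 2 (A a)"
    unfolding \<beta>_def by (simp add: s_s numeral_2_eq_2)
  thus ?thesis by (metis add_eq_0_iff_eq)
qed

section \<open>The polar form of \<open>Q\<close>\<close>

definition B :: "'l \<Rightarrow> 'l \<Rightarrow> 'l" where "B a b = tr (2 * N) (tr n a * tr n b)"

text \<open>Entries depend only on the difference of the indices, and in a square of side
  \<open>2 * k\<close> a difference \<open>c\<close> occurs \<open>2 * k - c\<close> times on each
  side of the diagonal. In characteristic 2 only odd differences survive.\<close>

lemma sum_square_antidiagonal:
  fixes g :: "nat \<Rightarrow> nat \<Rightarrow> 'l"
  assumes shift: "\<And>a b. g (Suc a) (Suc b) = g a b"
  shows "(\<Sum>a<2 * k. \<Sum>b<2 * k. g a b) = (\<Sum>i<k. g 0 (2 * i + 1) + g (2 * i + 1) 0)"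
proof -
  define S where "S m = (\<Sum>a<m. \<Sum>b<m. g a b)" for m
  define D where "D m = (\<Sum>i<m. g (Suc i) 0 + g 0 (Suc i))" for m
  have row: "(\<Sum>b<m. g m b) = (\<Sum>i<m. g (Suc i) 0)" for m
  proof (induction m)
    case (Suc m)
    have "(\<Sum>b<Suc m. g (Suc m) b) = g (Suc m) 0 + (\<Sum>b<m. g (Suc m) (Suc b))"
      by (rule sum.lessThan_Suc_shift)
    thus ?case by (simp add: shift Suc.IH add.commute)
  qed simp
  have col: "(\<Sum>a<m. g a m) = (\<Sum>i<m. g 0 (Suc i))" for m
  proof (induction m)
    case (Suc m)
    have "(\<Sum>a<Suc m. g a (Suc m)) = g 0 (Suc m) + (\<Sum>a<m. g (Suc a) (Suc m))"
      by (rule sum.lessThan_Suc_shift)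
    thus ?case by (simp add: shift Suc.IH add.commute)
  qed simp
  have diag: "g m m = g 0 0" for m by (induction m) (auto simp: shift)
  have step: "S (Suc m) = S m + (D m + g 0 0)" for m
  proof -
    have "S (Suc m) = (\<Sum>a<m. \<Sum>b<m. g a b) + (\<Sum>a<m. g a m) + ((\<Sum>b<m. g m b) + g m m)"
      by (simp add: S_def sum.distrib)
    thus ?thesis by (simp add: S_def D_def row col diag[of m] sum.distrib add_ac)
  qed
  have "S (2 * k) = (\<Sum>i<k. g 0 (2 * i + 1) + g (2 * i + 1) 0)"
  proof (induction k)
    case (Suc k)
    have "S (2 * Suc k) = S (2 * k) + ((D (2 * k) + g 0 0) + (D (Suc (2 * k)) + g 0 0))"
      by (simp add: step add.assoc)
    also have "D (Suc (2 * k)) = D (2 * k) + (g (Suc (2 * k)) 0 + g 0 (Suc (2 * k)))" by (simp add: D_def)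
    also have "(D (2 * k) + g 0 0) + (D (2 * k) + (g (Suc (2 * k)) 0 + g 0 (Suc (2 * k))) + g 0 0) =
        g 0 (Suc (2 * k)) + g (Suc (2 * k)) 0"
      by (simp add: add_ac)
    finally show ?case using Suc by simp
  qed (simp add: S_def)
  thus ?thesis by (simp add: S_def)
qed

lemma tr_2N_fixed:
  assumes "w \<in> V"
  shows "s i (tr (2 * N) w) = tr (2 * N) w"
proof (rule s_fixed_1)
  have "tr (2 * N) w + s 1 (tr (2 * N) w) = 0" unfolding telescope using assms by (simp add: V_def)
  thus "s 1 (tr (2 * N) w) = tr (2 * N) w" by (simp only: add_eq_0_iff_eq)
qed

text \<open>The trace of \<open>s i a * s j b\<close> is invariant under shifting both indices, so
  expanding the product leaves only odd differences: the exponents that occur in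
  \<open>Q0\<close>.\<close>

lemma B_eq:
  assumes "a \<in> V" "b \<in> V"
  shows "B a b = (\<Sum>k<h. tr (2 * N) (a * s (2 * k + 1) b + b * s (2 * k + 1) a))"
proof -
  define g where "g i j = tr (2 * N) (s i a * s j b)" for i j
  have "B a b = (\<Sum>i<2 * h. \<Sum>j<2 * h. g i j)"
    unfolding B_def tr_def[of n] sum_product tr_sum g_def by (simp add: n_def)
  also have "\<dots> = (\<Sum>k<h. g 0 (2 * k + 1) + g (2 * k + 1) 0)"
  proof (rule sum_square_antidiagonal)
    fix i j
    have "s i a * s j b \<in> V" using assms by (intro V_mult V_s)
    moreover have "s 1 (s i a * s j b) = s (Suc i) a * s (Suc j) b" by (simp add: s_s)
    ultimately show "g (Suc i) (Suc j) = g i j"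
      unfolding g_def by (metis s_tr tr_2N_fixed)
  qed
  also have "\<dots> = (\<Sum>k<h. tr (2 * N) (a * s (2 * k + 1) b + b * s (2 * k + 1) a))"
    by (simp add: g_def mult.commute)
  finally show ?thesis .
qed

lemma square_add: "(a + b) ^ 2 = a ^ 2 + (b :: 'l) ^ 2"
  by (simp add: power2_eq_square algebra_simps)

lemma Q_add:
  assumes "a \<in> V" "b \<in> V"
  shows "Q (a + b) = Q a + Q b + B a b"
proof -
  have "Q0 (a + b) = (\<Sum>k<h. (tr (2 * N) (a * s (2 * k + 1) a) + tr (2 * N) (b * s (2 * k + 1) b))
      + tr (2 * N) (a * s (2 * k + 1) b + b * s (2 * k + 1) a))"
    unfolding Q0_def by (intro sum.cong) (auto simp: algebra_simps)
  also have "\<dots> = Q0 a + Q0 b + B a b"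
    unfolding B_eq[OF assms] Q0_def sum.distrib by simp
  finally show ?thesis unfolding Q_def square_add by (simp add: distrib_left add_ac)
qed

lemma B_add: "B a (b + c) = B a b + B a c"
  by (simp add: B_def distrib_left)

lemma B_scale:
  assumes "s 1 c = c"
  shows "B a (c * b) = c * B a b"
  unfolding B_def tr_mult_fixed[OF assms]
  using tr_mult_fixed[OF assms, of "2 * N" "tr n a * tr n b"] by (simp add: mult.left_commute)

lemma V_tr: "a \<in> V \<Longrightarrow> tr m a \<in> V"
proof -
  assume a: "a \<in> V"
  have "s (2 * N) (tr m a) = tr m (s (2 * N) a)" by (rule s_tr)
  thus ?thesis using a by (simp add: V_def)
qed

lemma B_fixed: "a \<in> V \<Longrightarrow> b \<in> V \<Longrightarrow> s i (B a b) = B a b"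
  unfolding B_def by (intro tr_2N_fixed V_mult V_tr)

lemma A_scale: "s 1 c = c \<Longrightarrow> A (c * b) = c * A b"
  by (simp add: A_def tr_mult_fixed)

text \<open>The trace is a nonzero polynomial of degree at most \<open>p ^ (N - 1)\<close>, too
  small to vanish on \<open>p ^ N\<close> elements.\<close>

lemma exists_trace_nz: "\<exists>w. s N w = w \<and> tr N w \<noteq> 0"
proof (rule ccontr)
  assume *: "\<not> ?thesis"
  define P :: "'l poly" where "P = (\<Sum>i<N. monom 1 (p ^ i))"
  have "coeff P 1 = (\<Sum>i<N. if i = 0 then 1 else 0)" unfolding P_def coeff_sum
    using p_ge_2 by (intro sum.cong) auto
  hence "P \<noteq> 0" using N_n by auto
  have "{a. s N a = a} \<subseteq> {a. poly P a = 0}"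
    using * by (auto simp: P_def poly_sum poly_monom tr_def s_def)
  hence "p ^ N \<le> card {a. poly P a = 0}"
    using card_mono[OF poly_roots_finite[OF \<open>P \<noteq> 0\<close>]] card_fixed[OF N_n(2)] by metis
  also have "\<dots> \<le> degree P" using \<open>P \<noteq> 0\<close> by (rule card_poly_roots_bound)
  also have "\<dots> \<le> p ^ (N - 1)"
    unfolding P_def using p_ge_2 by (intro degree_sum_le) (auto simp: degree_monom_eq intro!: power_increasing)
  also have "\<dots> < p ^ N" using p_ge_2 N_n by (intro power_strict_increasing) auto
  finally show False by simp
qed

text \<open>If \<open>tr n m = (1 + \<sigma>) v\<close> with \<open>v\<close> fixed by
  \<open>\<sigma>^N\<close>, then \<open>A m = 0\<close>, and \<open>B x m\<close> becomes the
  \<open>tr N\<close> of \<open>\<sigma> v * \<gamma>\<close> with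
  \<open>\<gamma> = (1 + \<sigma>) \<beta> x\<close>. This \<open>\<gamma>\<close> is nonzero, so
  \<open>v\<close> can be chosen to give any prescribed element \<open>w\<close> inside the
  trace.\<close>

lemma B_nondegenerate:
  assumes x: "x \<in> V" and \<beta>x: "s 1 (\<beta> x) \<noteq> \<beta> x"
  shows "\<exists>m. A m = 0 \<and> B x m \<noteq> 0"
proof -
  define \<gamma> where "\<gamma> = \<beta> x + s 1 (\<beta> x)"
  have \<gamma>: "\<gamma> \<noteq> 0" using \<beta>x by (simp add: \<gamma>_def add_eq_0_iff_eq)
  have N\<beta>: "s N (\<beta> x) = \<beta> x"
  proof -
    have "s N (s N x) = x" using x by (simp add: V_def s_s mult_2)
    thus ?thesis unfolding \<beta>_eq s_tr by (simp add: add.commute)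
  qed
  have swap: "s N (s i a) = s i a" if "s N a = a" for a i
  proof -
    have "s N (s i a) = s i (s N a)" by (simp only: s_s add.commute)
    thus ?thesis using that by simp
  qed
  have N\<gamma>: "s N \<gamma> = \<gamma>" by (simp add: \<gamma>_def N\<beta> swap)
  obtain w where w: "s N w = w" "tr N w \<noteq> 0" using exists_trace_nz by blast
  define v where "v = s (N - 1) (w / \<gamma>)"
  have wg: "s N (w / \<gamma>) = w / \<gamma>" using w(1) N\<gamma> by (simp add: s_def power_divide)
  have sv: "s 1 v = w / \<gamma>" "s N v = v"
    using wg N_n swap[OF wg, of "N - 1"] unfolding v_def by (simp_all only: s_s) auto
  \<comment> \<open>A multiplier with \<open>(1 + \<sigma>^N)(\<omega> v) = v\<close> for every
    \<open>v\<close> fixed by \<open>\<sigma>^N\<close>.\<close>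
  obtain \<omega> where \<omega>: "\<omega> + s N \<omega> = 1"
  proof -
    define P :: "'l poly" where "P = monom 1 (p ^ N) + monom 1 1 - 1"
    have pN: "p ^ N > 1" using N_n p_ge_2 by (intro one_less_power) auto
    have "coeff P (p ^ N) = 1" using pN p_ge_2 by (simp add: P_def)
    hence "degree P \<ge> p ^ N" by (intro le_degree) simp
    hence "degree P > 0" using pN by linarith
    then obtain a where "poly P a = 0" using alg_closed_imp_poly_has_root by blast
    thus ?thesis by (intro that[of a]) (simp add: P_def poly_monom s_def add_eq_0_iff_eq add.commute)
  qed
  \<comment> \<open>The four summands, with \<open>N = 4 * n\<close>, telescope under
    \<open>1 + \<sigma>^n\<close> to \<open>(1 + \<sigma>^N)(\<omega> v) = v\<close>. Applying
    \<open>(1 + \<sigma>)^2\<close> to \<open>u\<close> then yields the required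
    \<open>tr n m\<close>.\<close>
  define u where "u = (\<Sum>k<4. s (n * k) (\<omega> * v))"
  define m where "m = (u + s 1 u) + s 1 (u + s 1 u)"
  have tele: "(\<Sum>k<j. s (n * k) a) + s n (\<Sum>k<j. s (n * k) a) = a + s (n * j) a" for j a
  proof (induction j)
    case (Suc j)
    have "(\<Sum>k<Suc j. s (n * k) a) + s n (\<Sum>k<Suc j. s (n * k) a) =
        ((\<Sum>k<j. s (n * k) a) + s n (\<Sum>k<j. s (n * k) a)) + (s (n * j) a + s (n * Suc j) a)"
      by (simp add: s_s add_ac)
    thus ?case unfolding Suc.IH by (simp add: add.assoc)
  qed simp
  have "u + s n u = \<omega> * v + s N (\<omega> * v)"
    unfolding u_def N_def mult.commute[of 4] by (rule tele)
  also have "\<dots> = v * (\<omega> + s N \<omega>)" using sv(2) by (simp add: distrib_left mult.commute)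
  finally have u: "u + s n u = v" using \<omega> by simp
  have "tr n (u + s 1 u) = v" using telescope[of n u] u by (simp add: s_tr)
  hence Lm: "tr n m = v + s 1 v" unfolding m_def tr_add[of n "u + s 1 u"] s_tr[symmetric] by simp
  have "A m = tr N (tr n m)" unfolding A_def by (rule tr_tr)
  also have "\<dots> = tr N v + s 1 (tr N v)" unfolding Lm by (simp add: s_tr)
  also have "\<dots> = 0" unfolding telescope using sv(2) by simp
  finally have Am: "A m = 0" .
  have "B x m = tr N (tr n x * tr n m + s N (tr n x * tr n m))" unfolding B_def by (rule tr_2N)
  also have "tr n x * tr n m + s N (tr n x * tr n m) = tr n m * (tr n x + s N (tr n x))"
    unfolding s_mult Lm using sv(2) swap[OF sv(2), of 1] by (simp add: distrib_left mult.commute)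
  also have "tr n x + s N (tr n x) = \<beta> x" unfolding \<beta>_eq by (simp add: s_tr)
  also have "tr N (tr n m * \<beta> x) = tr N (v * \<beta> x) + tr N (s 1 v * \<beta> x)"
    unfolding Lm by (simp add: distrib_right)
  also have "tr N (v * \<beta> x) = tr N (s 1 v * s 1 (\<beta> x))"
  proof -
    have "tr N (v * \<beta> x) + s 1 (tr N (v * \<beta> x)) = 0" unfolding telescope using sv(2) N\<beta> by simp
    hence "s 1 (tr N (v * \<beta> x)) = tr N (v * \<beta> x)" by (simp only: add_eq_0_iff_eq)
    thus ?thesis by (simp add: s_tr)
  qed
  also have "tr N (s 1 v * s 1 (\<beta> x)) + tr N (s 1 v * \<beta> x) = tr N (s 1 v * \<gamma>)"
    unfolding \<gamma>_def by (simp add: distrib_left add.commute)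
  also have "s 1 v * \<gamma> = w" using sv(1) \<gamma> by simp
  finally show ?thesis using Am w(2) by auto
qed

end

section \<open>The trace condition and the root \<open>\<epsilon>\<close>\<close>

context char2_form
begin

text \<open>Transitivity of the trace: \<open>\<sigma>\<close> is the \<open>2 ^ e\<close>-power
  map, and exponents below \<open>e * N\<close> are written as \<open>e * k + j\<close>.\<close>

lemma sum_powers_tr: "(\<Sum>j<e. tr N t ^ (2 ^ j)) = (\<Sum>i<e * N. t ^ (2 ^ i))"
proof -
  have "(\<Sum>j<e. tr k t ^ (2 ^ j)) = (\<Sum>i<e * k. t ^ (2 ^ i))" for k
  proof (induction k)
    case (Suc k)
    have "(\<Sum>j<e. tr (Suc k) t ^ (2 ^ j)) = (\<Sum>j<e. tr k t ^ (2 ^ j) + s k t ^ (2 ^ j))"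
      unfolding tr_def by (simp add: freshmans_dream'[OF prime_CHAR_2] CHAR_2)
    also have "\<dots> = (\<Sum>i<e * k. t ^ (2 ^ i)) + (\<Sum>j<e. s k t ^ (2 ^ j))"
      by (simp add: sum.distrib Suc)
    also have "(\<Sum>j<e. s k t ^ (2 ^ j)) = (\<Sum>j<e. t ^ (2 ^ (e * k + j)))"
      by (simp add: s_def p_def power_add flip: power_mult)
    also have "(\<Sum>i<e * k. t ^ (2 ^ i)) + (\<Sum>j<e. t ^ (2 ^ (e * k + j))) = (\<Sum>i<e * k + e. t ^ (2 ^ i))"
      by (rule sum_lessThan_add[symmetric])
    finally show ?case by (simp add: add.commute)
  qed (simp add: tr_def power_0_left)
  thus ?thesis .
qed

text \<open>Repeated squaring of the equation adds the square of a partial trace of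
  \<open>tr N t\<close> to \<open>\<epsilon>\<close>; after \<open>e\<close> steps this is the full
  absolute trace, which is 1.\<close>

lemma exists_eps:
  assumes "(\<Sum>j<e. tr N t ^ (2 ^ j)) = 1"
  obtains \<epsilon> where "\<epsilon> ^ 2 + \<epsilon> = tr N t ^ 2" "s 1 \<epsilon> = \<epsilon> + 1"
proof -
  define \<tau> where "\<tau> = tr N t"
  obtain \<epsilon> where "poly [:\<tau> ^ 2, 1, 1:] \<epsilon> = 0"
    using alg_closed_imp_poly_has_root[of "[:\<tau> ^ 2, 1, 1:]"] by auto
  hence "\<tau> ^ 2 + (\<epsilon> ^ 2 + \<epsilon>) = 0" by (simp add: power2_eq_square algebra_simps)
  hence eps: "\<epsilon> ^ 2 + \<epsilon> = \<tau> ^ 2" by (simp only: add_eq_0_iff_eq)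
  have "\<epsilon> ^ (2 ^ j) = \<epsilon> + (\<Sum>i<j. \<tau> ^ (2 ^ i)) ^ 2" for j
  proof (induction j)
    case (Suc j)
    have "\<epsilon> ^ (2 ^ Suc j) = (\<epsilon> ^ (2 ^ j)) ^ 2" by (simp add: mult.commute flip: power_mult)
    also have "\<dots> = \<epsilon> ^ 2 + ((\<Sum>i<j. \<tau> ^ (2 ^ i)) ^ 2) ^ 2" unfolding Suc by (rule square_add)
    also have "(\<Sum>i<j. \<tau> ^ (2 ^ i)) ^ 2 = (\<Sum>i<j. \<tau> ^ (2 ^ Suc i))"
      by (simp add: freshmans_dream_sum[OF prime_CHAR_2] CHAR_2 mult.commute flip: power_mult)
    also have "\<epsilon> ^ 2 = \<epsilon> + \<tau> ^ 2" using eps by (metis add.commute add_self_left)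
    also have "\<epsilon> + \<tau> ^ 2 + (\<Sum>i<j. \<tau> ^ (2 ^ Suc i)) ^ 2 = \<epsilon> + (\<tau> + (\<Sum>i<j. \<tau> ^ (2 ^ Suc i))) ^ 2"
      by (simp add: square_add add.assoc)
    also have "\<tau> + (\<Sum>i<j. \<tau> ^ (2 ^ Suc i)) = (\<Sum>i<Suc j. \<tau> ^ (2 ^ i))"
      unfolding sum.lessThan_Suc_shift by simp
    finally show ?case .
  qed simp
  from this[of e] have "s 1 \<epsilon> = \<epsilon> + 1" using assms by (simp add: s_def p_def \<tau>_def)
  with eps show ?thesis by (intro that) (simp_all add: \<tau>_def)
qed

end

section \<open>Zeros of \<open>Q\<close> inside and outside \<open>H\<close>\<close>

locale char2_count = char2_form +
  fixes \<epsilon> :: 'a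
  assumes t_fixed: "s N t = t" and eps_sq: "\<epsilon> ^ 2 + \<epsilon> = tr N t ^ 2" and s_eps: "s 1 \<epsilon> = \<epsilon> + 1"
begin

definition "Fp = {a. s 1 a = a}"
text \<open>Equivalent to \<open>\<beta> a\<close> lying in \<open>Fp\<close> by
  \<open>\<beta>_fixed_iff\<close>. Stated through \<open>A\<close>, it exhibits \<open>H\<close> as
  a union of fibres of \<open>A\<close>, so that it can be counted.\<close>

definition "H = {a. s 2 (A a) = A a}"
definition "Ker = {a. A a = 0}"

lemma card_Fp: "card Fp = p" and finite_Fp: "finite Fp"
  using card_fixed[of 1] finite_fixed[of 1] by (auto simp: Fp_def)

lemma H_V: "H \<subseteq> V" and Ker_H: "Ker \<subseteq> H"
  using A_fixed_imp_V by (auto simp: H_def Ker_def)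

text \<open>On \<open>H\<close> the form splits into two linear factors with values in the field with \<open>p\<close> elements;
  this is where the trace condition on \<open>t\<close> enters.\<close>

lemma Q_on_H:
  assumes "a \<in> H"
  shows "Q a = (A a + \<epsilon> * \<beta> a) * (A a + \<epsilon> * \<beta> a + \<beta> a)"
proof -
  have a: "a \<in> V" "s 1 (\<beta> a) = \<beta> a" using assms H_V unfolding \<beta>_fixed_iff by (auto simp: H_def)
  have sA: "s 1 (A a) = A a + \<beta> a" by (simp add: \<beta>_def)
  have "Q a = A a * (A a + \<beta> a) + \<beta> a ^ 2 * (\<epsilon> ^ 2 + \<epsilon>)"
    unfolding Q_def Q0_eq[OF a] linear_term[OF a t_fixed] sA power_mult_distrib eps_sq ..
  also have "\<dots> = (A a + \<epsilon> * \<beta> a) * (A a + \<epsilon> * \<beta> a + \<beta> a)"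
    by (simp add: power2_eq_square algebra_simps)
  finally show ?thesis .
qed

lemma Q_fixed:
  assumes "a \<in> V"
  shows "s 1 (Q a) = Q a"
proof -
  have "s N (s i t) = s i t" for i
  proof -
    have "s N (s i t) = s i (s N t)" by (simp only: s_s add.commute)
    thus ?thesis using t_fixed by simp
  qed
  hence "s N coef = coef" by (simp add: coef_def)
  hence coef: "coef \<in> V" using s_fixed_mult[of N coef 2] by (simp add: V_def mult.commute)
  have "s 1 (tr (2 * N) (a * s i a)) = tr (2 * N) (a * s i a)" for i
    using assms by (intro tr_2N_fixed V_mult V_s)
  moreover have "s 1 (tr (2 * N) (coef ^ 2 * a ^ 2)) = tr (2 * N) (coef ^ 2 * a ^ 2)"
    using assms coef unfolding power2_eq_square by (intro tr_2N_fixed V_mult)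
  ultimately show ?thesis unfolding Q_def Q0_def s_add s_sum by simp
qed

lemma card_A_preimage: "finite W \<Longrightarrow> card {a. A a \<in> W} = card W * p ^ (5 * n - 2)"
proof -
  assume W: "finite W"
  have "{a. A a \<in> W} = (\<Union>v\<in>W. {a. A a = v})" by blast
  hence fin: "finite {a. A a \<in> W}" using W finite_A_fibre by simp
  show "card {a. A a \<in> W} = card W * p ^ (5 * n - 2)"
  proof (rule card_eq_fibres[OF W, of _ A])
    fix v assume "v \<in> W"
    hence "{x \<in> {a. A a \<in> W}. A x = v} = {x. A x = v}" by blast
    thus "card {x \<in> {a. A a \<in> W}. A x = v} = p ^ (5 * n - 2)" by (simp add: card_A_fibre)
  qed (use fin in auto)
qed

lemma card_H: "card H = p ^ 2 * p ^ (5 * n - 2)"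
proof -
  have "card {a. A a \<in> {v. s 2 v = v}} = card {v. s 2 v = v} * p ^ (5 * n - 2)"
    by (intro card_A_preimage finite_fixed) simp
  thus ?thesis by (simp add: H_def card_fixed)
qed

text \<open>A zero has \<open>A a = \<epsilon> * c\<close> or
  \<open>A a = (\<epsilon> + 1) * c\<close> with \<open>c = \<beta> a\<close>. Conversely
  \<open>c\<close> is recovered from either value \<open>v\<close> as \<open>v + \<sigma> v\<close>.
  The two lines over \<open>Fp\<close> meet only in 0, which gives \<open>2 * p - 1\<close>
  values.\<close>

lemma card_zeros_H: "card {a \<in> H. Q a = 0} = (2 * p - 1) * p ^ (5 * n - 2)"
proof -
  define W where "W = (\<lambda>c. \<epsilon> * c) ` Fp \<union> (\<lambda>c. (\<epsilon> + 1) * c) ` Fp"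
  have s1: "\<epsilon> * c + s 1 (\<epsilon> * c) = c" "(\<epsilon> + 1) * c + s 1 ((\<epsilon> + 1) * c) = c" if "c \<in> Fp" for c
    using that s_eps by (simp_all add: Fp_def algebra_simps)
  have eps0: "\<epsilon> \<noteq> 0" "\<epsilon> + 1 \<noteq> 0"
  proof -
    show "\<epsilon> \<noteq> 0" using s_eps by auto
    show "\<epsilon> + 1 \<noteq> 0" using s_eps s_inj[of 1 \<epsilon> 0] \<open>\<epsilon> \<noteq> 0\<close> by auto
  qed
  have s2: "s 2 v = v" if "v \<in> W" for v
  proof -
    have "v + s 1 v \<in> Fp" using that s1 by (auto simp: W_def)
    hence "s 1 v + s 2 v = v + s 1 v" by (simp add: Fp_def s_s numeral_2_eq_2)
    thus ?thesis by (metis add.commute add_self_left)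
  qed
  have "{a \<in> H. Q a = 0} = {a. A a \<in> W}"
  proof (intro equalityI subsetI CollectI)
    fix a assume a: "a \<in> {a \<in> H. Q a = 0}"
    hence aH: "a \<in> H" by simp
    have \<beta>: "\<beta> a \<in> Fp" using aH \<beta>_fixed_iff by (simp add: H_def Fp_def)
    have "(A a + \<epsilon> * \<beta> a) * (A a + \<epsilon> * \<beta> a + \<beta> a) = 0"
      using a unfolding Q_on_H[OF aH, symmetric] by simp
    moreover have "A a + \<epsilon> * \<beta> a + \<beta> a = A a + (\<epsilon> + 1) * \<beta> a"
      by (simp add: distrib_right add.assoc)
    ultimately have "A a + \<epsilon> * \<beta> a = 0 \<or> A a + (\<epsilon> + 1) * \<beta> a = 0"
      by (simp only: mult_eq_0_iff)
    hence "\<epsilon> * \<beta> a = A a \<or> (\<epsilon> + 1) * \<beta> a = A a" by (simp only: add_eq_0_iff_eq)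
    thus "A a \<in> W" using \<beta> unfolding W_def by (metis UnI1 UnI2 imageI)
  next
    fix a assume "a \<in> {a. A a \<in> W}"
    hence AW: "A a \<in> W" by simp
    hence aH: "a \<in> H" using s2 by (simp add: H_def)
    obtain c where c: "c \<in> Fp" "A a = \<epsilon> * c \<or> A a = (\<epsilon> + 1) * c"
      using AW unfolding W_def by blast
    have "\<beta> a = c" unfolding \<beta>_def using c(2) s1[OF c(1)] by (elim disjE) (simp_all only:)
    hence "A a = \<epsilon> * \<beta> a \<or> A a = (\<epsilon> + 1) * \<beta> a" using c(2) by simp
    hence "Q a = 0" unfolding Q_on_H[OF aH]
    proof
      assume "A a = \<epsilon> * \<beta> a"
      hence "A a + \<epsilon> * \<beta> a = 0" by simp
      thus "(A a + \<epsilon> * \<beta> a) * (A a + \<epsilon> * \<beta> a + \<beta> a) = 0" by simp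
    next
      assume "A a = (\<epsilon> + 1) * \<beta> a"
      hence "A a + \<epsilon> * \<beta> a + \<beta> a = 0" by (simp add: distrib_right add.assoc)
      thus "(A a + \<epsilon> * \<beta> a) * (A a + \<epsilon> * \<beta> a + \<beta> a) = 0" by simp
    qed
    with aH show "a \<in> H \<and> Q a = 0" by simp
  qed
  moreover have "finite W" using finite_Fp by (simp add: W_def)
  moreover have "card W = 2 * p - 1"
  proof -
    have "(\<lambda>c. \<epsilon> * c) ` Fp \<inter> (\<lambda>c. (\<epsilon> + 1) * c) ` Fp = {0}"
    proof (intro equalityI subsetI)
      fix v assume "v \<in> (\<lambda>c. \<epsilon> * c) ` Fp \<inter> (\<lambda>c. (\<epsilon> + 1) * c) ` Fp"
      then obtain c c' where c: "c \<in> Fp" "c' \<in> Fp" "v = \<epsilon> * c" "v = (\<epsilon> + 1) * c'" by blast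
      hence "c = c'" using s1[OF c(1)] s1[OF c(2)] by metis
      hence "c = 0" using c(3,4) by (simp add: distrib_right)
      thus "v \<in> {0}" using c by simp
    next
      fix v :: 'a assume "v \<in> {0}"
      moreover have "0 \<in> Fp" by (simp add: Fp_def)
      ultimately show "v \<in> (\<lambda>c. \<epsilon> * c) ` Fp \<inter> (\<lambda>c. (\<epsilon> + 1) * c) ` Fp"
        by (auto intro!: image_eqI[of _ _ 0])
    qed
    moreover have "card ((\<lambda>c. \<epsilon> * c) ` Fp) = p" "card ((\<lambda>c. (\<epsilon> + 1) * c) ` Fp) = p"
      using eps0 by (auto simp: card_image inj_on_def card_Fp)
    moreover have "card W + card ((\<lambda>c. \<epsilon> * c) ` Fp \<inter> (\<lambda>c. (\<epsilon> + 1) * c) ` Fp) =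
        card ((\<lambda>c. \<epsilon> * c) ` Fp) + card ((\<lambda>c. (\<epsilon> + 1) * c) ` Fp)"
      unfolding W_def using finite_Fp by (intro card_Un_Int[symmetric]) auto
    ultimately show ?thesis by simp
  qed
  ultimately show ?thesis by (simp add: card_A_preimage)
qed

text \<open>On a coset of \<open>Ker\<close> outside \<open>H\<close> the form is an additive function plus a constant, and the additive
  function is not zero, since the polar form does not vanish.\<close>

lemma card_coset_zeros:
  assumes x: "x \<in> V - H"
  shows "p * card {m \<in> Ker. Q (x + m) = 0} = card Ker"
proof -
  have xV: "x \<in> V" using x by simp
  have "s 1 (\<beta> x) \<noteq> \<beta> x" using x unfolding \<beta>_fixed_iff by (simp add: H_def)
  then obtain m1 where m1: "A m1 = 0" "B x m1 \<noteq> 0" using B_nondegenerate[OF xV] by blast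
  have KV: "m \<in> V" if "m \<in> Ker" for m using that H_V Ker_H by blast
  have Qm: "Q m = 0" if "m \<in> Ker" for m
    using Q_on_H[of m] that Ker_H by (auto simp: Ker_def \<beta>_def)
  have fin: "finite Ker" unfolding Ker_def by (rule finite_A_fibre)
  have BF: "B x m \<in> Fp" if "m \<in> Ker" for m
    using B_fixed[OF xV KV[OF that]] by (simp add: Fp_def)
  \<comment> \<open>\<open>B x\<close> is linear over \<open>Fp\<close> and nonzero at
    \<open>m1\<close>, so a multiple of \<open>m1\<close> translates the zero fibre onto any
    other.\<close>
  have fibre: "card {m \<in> Ker. B x m = r} = card {m \<in> Ker. B x m = 0}" if r: "r \<in> Fp" for r
  proof -
    define c where "c = r / B x m1"
    have "s 1 (B x m1) = B x m1" using BF[of m1] m1 by (simp add: Ker_def Fp_def)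
    hence c: "s 1 c = c" using r by (simp add: c_def Fp_def s_def power_divide)
    have Bc: "B x (c * m1) = r" unfolding B_scale[OF c] using m1 by (simp add: c_def)
    have Ac: "A (c * m1) = 0" unfolding A_scale[OF c] using m1 by simp
    have "bij_betw (\<lambda>m. m + c * m1) {m \<in> Ker. B x m = 0} {m \<in> Ker. B x m = r}"
      by (rule bij_betwI[where g = "\<lambda>m. m + c * m1"]) (auto simp: Ker_def B_add Bc Ac add.assoc)
    from bij_betw_same_card[OF this] show ?thesis by simp
  qed
  have "card Ker = card Fp * card {m \<in> Ker. B x m = 0}"
    by (rule card_eq_fibres[OF finite_Fp, of _ "B x"]) (use BF fibre fin in auto)
  moreover have "{m \<in> Ker. Q (x + m) = 0} = {m \<in> Ker. B x m = Q x}"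
  proof -
    have "Q (x + m) = 0 \<longleftrightarrow> B x m = Q x" if "m \<in> Ker" for m
      using Q_add[OF xV KV[OF that]] Qm[OF that] by (simp add: add_eq_0_iff_eq)
    thus ?thesis by blast
  qed
  moreover have "Q x \<in> Fp" using Q_fixed[OF xV] by (simp add: Fp_def)
  ultimately show ?thesis using fibre[of "Q x"] by (simp add: card_Fp)
qed

text \<open>Summing the coset count over all \<open>x\<close> counts each zero once for every
  element of \<open>Ker\<close>; this avoids choosing coset representatives.\<close>

lemma card_zeros_outside: "p * card {a \<in> V - H. Q a = 0} = card (V - H)"
proof -
  let ?Z = "{a \<in> V - H. Q a = 0}"
  have fin: "finite Ker" "finite (V - H)" using finite_A_fibre finite_V by (auto simp: Ker_def)
  have shift: "a + m \<in> V - H \<longleftrightarrow> a \<in> V - H" if "m \<in> Ker" for a m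
  proof -
    have m: "m \<in> V" "A m = 0" using that H_V Ker_H by (auto simp: Ker_def)
    hence "a + m \<in> V \<longleftrightarrow> a \<in> V" using V_add[of a m] V_add[of "a + m" m] by (auto simp: add.assoc)
    thus ?thesis using m by (simp add: H_def)
  qed
  have "card (V - H) * card Ker = (\<Sum>x\<in>V - H. p * card {m \<in> Ker. Q (x + m) = 0})"
    by (simp add: card_coset_zeros)
  also have "\<dots> = p * card (SIGMA x:V - H. {m \<in> Ker. Q (x + m) = 0})"
    using fin by (simp add: card_SigmaI sum_distrib_left)
  also have "card (SIGMA x:V - H. {m \<in> Ker. Q (x + m) = 0}) = card (?Z \<times> Ker)"
  proof (rule bij_betw_same_card)
    show "bij_betw (\<lambda>(x, m). (x + m, m)) (SIGMA x:V - H. {m \<in> Ker. Q (x + m) = 0}) (?Z \<times> Ker)"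
      by (rule bij_betwI[where g = "\<lambda>(x, m). (x + m, m)"])
         (use shift in \<open>auto simp: add.assoc simp del: Diff_iff\<close>)
  qed
  also have "\<dots> = card ?Z * card Ker" by (rule card_cartesian_product)
  finally have "card (V - H) * card Ker = p * (card ?Z * card Ker)" .
  hence "p * card ?Z * card Ker = card (V - H) * card Ker" unfolding mult.assoc by (rule sym)
  moreover have "card Ker \<noteq> 0" using p_ge_2 by (simp add: Ker_def card_A_fibre)
  ultimately show ?thesis by simp
qed

text \<open>Perfect equidistribution would give \<open>p ^ (2 * N)\<close>. The set \<open>H\<close>
  contributes \<open>p * (2 * p - 1)\<close> fibres of \<open>A\<close> where \<open>p ^ 2\<close>
  would be balanced, and the surplus is \<open>(p - 1) * p\<close> fibres.\<close>

lemma card_zeros: "int p * int (card {a \<in> V. Q a = 0}) = int p ^ (2 * N) + (int p - 1) * int p ^ (5 * n - 1)"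
proof -
  define \<kappa> where "\<kappa> = int p ^ (5 * n - 2)"
  have H: "finite H" using H_V finite_V by (rule finite_subset)
  have "{a \<in> V. Q a = 0} = {a \<in> H. Q a = 0} \<union> {a \<in> V - H. Q a = 0}" using H_V by auto
  hence "card {a \<in> V. Q a = 0} = card {a \<in> H. Q a = 0} + card {a \<in> V - H. Q a = 0}"
    using H finite_V by (simp add: card_Un_disjoint disjoint_iff)
  hence "int p * int (card {a \<in> V. Q a = 0}) =
      int p * int (card {a \<in> H. Q a = 0}) + int (p * card {a \<in> V - H. Q a = 0})"
    by (simp add: distrib_left)
  also have "int (card {a \<in> H. Q a = 0}) = (2 * int p - 1) * \<kappa>"
    using p_ge_2 by (simp add: card_zeros_H \<kappa>_def of_nat_diff)
  also have "int (p * card {a \<in> V - H. Q a = 0}) = int p ^ (2 * N) - int p ^ 2 * \<kappa>"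
  proof -
    have "card H \<le> card V" using finite_V H_V by (rule card_mono)
    thus ?thesis unfolding card_zeros_outside using H H_V
      by (simp add: card_Diff_subset card_V card_H \<kappa>_def of_nat_diff)
  qed
  also have "int p * ((2 * int p - 1) * \<kappa>) + (int p ^ (2 * N) - int p ^ 2 * \<kappa>) =
      int p ^ (2 * N) + (int p - 1) * (int p * \<kappa>)"
    by (simp add: algebra_simps power2_eq_square)
  also have "int p * \<kappa> = int p ^ (5 * n - 1)"
  proof -
    have "5 * n - 1 = Suc (5 * n - 2)" using N_n by simp
    thus ?thesis by (simp add: \<kappa>_def)
  qed
  finally show ?thesis .
qed

definition "val a = (\<Sum>k<h. a * s (2 * k + 1) a) + coef ^ 2 * a ^ 2"

text \<open>For any root \<open>b\<close> of the Artin-Schreier equation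
  \<open>\<sigma>^(2N) b = b + Q a\<close>. So either all \<open>p\<close> roots over
  \<open>a\<close> lie in \<open>V\<close> or none does.\<close>

lemma card_points:
  "int (card {(a, b). a \<in> V \<and> b \<in> V \<and> s 1 b + b = val a}) = int p ^ (2 * N) + (int p - 1) * int p ^ (5 * n - 1)"
proof -
  have Q: "Q a = tr (2 * N) (val a)" for a by (simp add: Q_def Q0_def val_def tr_sum)
  have Vb: "b \<in> V \<longleftrightarrow> Q a = 0" if "s 1 b + b = val a" for a b
  proof -
    have "b + s 1 b = val a" using that by (simp only: add.commute)
    hence "s (2 * N) b = b + Q a" using s_telescope[of "2 * N" b] unfolding Q by simp
    thus ?thesis by (simp add: V_def)
  qed
  have eq: "{(a, b). a \<in> V \<and> b \<in> V \<and> s 1 b + b = val a} =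
      (SIGMA a:{a \<in> V. Q a = 0}. {b. s 1 b + b = val a})"
    using Vb by auto
  have "finite {b. s 1 b + b = c}" for c
    using card_artin_schreier[of c] p_ge_2 by (metis card.infinite not_numeral_le_zero)
  hence "card {(a, b). a \<in> V \<and> b \<in> V \<and> s 1 b + b = val a} = p * card {a \<in> V. Q a = 0}"
    unfolding eq using finite_V by (subst card_SigmaI) (simp_all add: card_artin_schreier del: One_nat_def)
  thus ?thesis using card_zeros by simp
qed

end

section \<open>The curve of the theorem\<close>

lemma CHAR_eq_2:
  assumes "CARD('k::{field,finite}) = 2 ^ d"
  shows "CHAR('k) = 2"
proof -
  have "of_nat (2 ^ d) = (0::'k)" using of_nat_card_finite_field[where ?'k = 'k] assms by simp
  hence "CHAR('k) dvd 2 ^ d" by (simp only: of_nat_eq_0_iff_char_dvd)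
  hence "CHAR('k) dvd 2" using prime_CHAR_finite_field prime_dvd_power by blast
  thus ?thesis by (intro primes_dvd_imp_eq prime_CHAR_finite_field two_is_prime_nat)
qed

lemma R_poly_monic:
  fixes t :: "'k::{field,finite}"
  assumes "p \<ge> 2" "n > 0" "even n"
  shows "degree (R_poly p n t) = p ^ (n - 1)" "lead_coeff (R_poly p n t) = 1"
proof -
  let ?a = "(\<Sum>i<n. frob_root p i t)\<^sup>2"
  have n: "n \<ge> 2" using assms by presburger
  have pn: "p ^ (n - 1) > 1" using assms(1) n by (intro one_less_power) auto
  have le: "degree (R_poly p n t) \<le> p ^ (n - 1)"
    unfolding R_poly_def
  proof (intro degree_add_le degree_sum_le)
    fix i assume "i \<in> {1..n div 2}"
    hence "2 * i - 1 \<le> n - 1" by auto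
    thus "degree (monom (1::'k) (p ^ (2 * i - 1))) \<le> p ^ (n - 1)"
      using assms(1) by (auto simp: degree_monom_eq intro!: power_increasing)
  next
    have "degree (monom ?a 1) \<le> 1" by (rule degree_monom_le)
    thus "degree (monom ?a 1) \<le> p ^ (n - 1)" using pn by linarith
  qed simp
  have "coeff (R_poly p n t) (p ^ (n - 1)) = (\<Sum>i = 1..n div 2. if i = n div 2 then 1 else 0)"
  proof -
    have "p ^ (2 * i - 1) = p ^ (n - 1) \<longleftrightarrow> i = n div 2" if "i \<in> {1..n div 2}" for i
    proof -
      have "p ^ (2 * i - 1) = p ^ (n - 1) \<longleftrightarrow> 2 * i - 1 = n - 1"
        using assms(1) by (intro power_inject_exp) auto
      also have "\<dots> \<longleftrightarrow> i = n div 2" using that assms(3) n by (auto elim!: evenE)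
      finally show ?thesis .
    qed
    hence "(\<Sum>i = 1..n div 2. coeff (monom (1::'k) (p ^ (2 * i - 1))) (p ^ (n - 1))) =
        (\<Sum>i = 1..n div 2. if i = n div 2 then 1 else 0)"
      by (intro sum.cong) auto
    thus ?thesis using pn by (simp add: R_poly_def coeff_sum)
  qed
  also have "\<dots> = 1" using n by (subst sum.delta) auto
  finally have c: "coeff (R_poly p n t) (p ^ (n - 1)) = 1" .
  hence "p ^ (n - 1) \<le> degree (R_poly p n t)" by (intro le_degree) simp
  with le show "degree (R_poly p n t) = p ^ (n - 1)" by simp
  with c show "lead_coeff (R_poly p n t) = 1" by simp
qed

theorem corollary7p8:
  fixes p n q :: nat and t :: "'k::{field,finite}"
  assumes "\<exists>e>0. p = 2 ^ e"
    and "n > 0" and "even n"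
    and "q = p ^ (4 * n)"
    and "CARD('k) = q"
    and "trace_F2 t = 1"
  shows "(\<exists>F. is_function_field_of const (artin_schreier p (R_poly p n t)) F) \<and>
         (\<forall>F. is_function_field_of const (artin_schreier p (R_poly p n t)) F \<longrightarrow>
              is_maximal const F)"
proof -
  obtain e where e: "e > 0" "p = 2 ^ e" using assms(1) by blast
  obtain h where h: "n = 2 * h" using assms(3) by (elim evenE)
  have q: "q = 2 ^ (e * (4 * n))" using assms(4) e(2) by (simp add: power_mult)
  have CHAR: "CHAR('k) = 2" using CHAR_eq_2 assms(5) q by metis
  have p2: "p \<ge> 2" using power_increasing[of 1 e "2::nat"] e by simp
  have n2: "n \<ge> 2" using assms(2,3) by presburger
  define f where "f = monom 1 1 * R_poly p n t"
  define d where "d = p ^ (n - 1) + 1"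
  have R: "R_poly p n t \<noteq> 0" using R_poly_monic(2)[OF p2 assms(2,3), of t] by auto
  have f: "degree f = d" "lead_coeff f = 1"
  proof -
    show "degree f = d" unfolding f_def d_def
      using R R_poly_monic(1)[OF p2 assms(2,3), of t]
      by (subst degree_mult_eq) (auto simp: degree_monom_eq)
    show "lead_coeff f = 1" unfolding f_def lead_coeff_mult R_poly_monic(2)[OF p2 assms(2,3)]
      by (simp add: degree_monom_eq)
  qed
  interpret C: as_curve q "e * (4 * n)" "TYPE('k)" f p d
  proof
    show "q = CARD('k)" "q = CHAR('k) ^ (e * (4 * n))" using assms(5) q CHAR by simp_all
    have "CHAR('k) dvd p" unfolding CHAR e(2) using e(1) by simp
    thus "of_nat p = (0::'k)" by (simp only: of_nat_eq_0_iff_char_dvd)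
    show "coprime p d"
    proof -
      \<comment> \<open>As \<open>n \<ge> 2\<close>, \<open>d = p ^ (n - 1) + 1\<close> is 1 modulo
        \<open>p\<close>.\<close>
      have "p dvd p ^ (n - 1)" using n2 by (intro dvd_power) simp
      thus ?thesis unfolding d_def
        by (metis coprime_1_right coprime_iff_gcd_eq_1 dvdE gcd_add_mult mult.commute add.commute)
    qed
  qed (use p2 f d_def in auto)
  have G: "artin_schreier p (R_poly p n t) = C.G"
    unfolding artin_schreier_def C.G_def by (simp only: f_def)
  interpret S: char2_form e h "to_ac t"
    using CHAR e(1) h assms(2) by unfold_locales auto
  have Sp: "S.p = p" and Sn: "S.n = n" and SN: "S.N = 4 * n"
    by (simp_all add: S.p_def S.n_def S.N_def e(2) h)
  have s: "S.s i a = a ^ (p ^ i)" for i a by (simp add: S.s_def Sp)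
  have t_fixed: "S.s S.N (to_ac t) = to_ac t"
    using C.frob_const[of t 1] by (simp add: s SN assms(4))
  have trace: "(\<Sum>j<e. S.tr S.N (to_ac t) ^ (2 ^ j)) = 1"
  proof -
    have "(THE d. CARD('k) = 2 ^ d) = e * (4 * n)"
      using assms(5) q by (intro the_equality) auto
    hence "(\<Sum>i<e * (4 * n). t ^ (2 ^ i)) = 1" using assms(6) by (simp add: trace_F2_def)
    hence "to_ac (\<Sum>i<e * (4 * n). t ^ (2 ^ i)) = 1" by simp
    thus ?thesis unfolding S.sum_powers_tr by (simp add: to_ac_sum SN)
  qed
  obtain \<epsilon> where eps: "\<epsilon> ^ 2 + \<epsilon> = S.tr S.N (to_ac t) ^ 2" "S.s 1 \<epsilon> = \<epsilon> + 1"
    using S.exists_eps[OF trace] .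
  interpret S: char2_count e h "to_ac t" \<epsilon>
    by unfold_locales (rule t_fixed eps)+
  \<comment> \<open>\<open>\<sigma>^N\<close> fixes \<open>t\<close>, so the inverse of
    \<open>\<sigma>^i\<close> acts on it as \<open>\<sigma>^(N - i)\<close>.\<close>
  have root: "to_ac (frob_root p i t) = S.s (S.N - i) (to_ac t)" if i: "i < n" for i
  proof -
    have pow: "(t ^ (p ^ (4 * n - i))) ^ (p ^ i) = t"
    proof -
      have "p ^ (4 * n - i) * p ^ i = CARD('k)" using i assms(4,5) by (simp flip: power_add)
      thus ?thesis using finite_field_power_card[of t] by (simp flip: power_mult)
    qed
    have "frob_root p i t = t ^ (p ^ (4 * n - i))"
      unfolding frob_root_def
    proof (rule the_equality)
      show "(t ^ (p ^ (4 * n - i))) ^ (p ^ i) = t" by (rule pow)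
      fix r assume "r ^ p ^ i = t"
      hence "r ^ (CHAR('k) ^ (e * i)) = (t ^ (p ^ (4 * n - i))) ^ (CHAR('k) ^ (e * i))"
        using pow by (simp add: CHAR e(2) power_mult)
      thus "r = t ^ (p ^ (4 * n - i))"
        using power_eq_imp_eq_prime_char[OF prime_CHAR_finite_field] by blast
    qed
    thus ?thesis by (simp add: s SN)
  qed
  have eval_f: "poly (map_poly to_ac f) a = S.val a" for a
  proof -
    have coef: "to_ac (\<Sum>i<n. frob_root p i t) = S.coef"
      by (simp add: S.coef_def to_ac_sum Sn root)
    have "poly (map_poly to_ac (\<Sum>i = 1..n div 2. monom 1 (p ^ (2 * i - 1)) :: 'k poly)) a =
        (\<Sum>i = 1..n div 2. a ^ (p ^ (2 * i - 1)))"
      unfolding C.ev1.map_sum by simp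
    also have "\<dots> = (\<Sum>k<h. a ^ (p ^ (2 * k + 1)))"
      by (simp add: h sum.atLeast1_atMost_eq)
    finally have "poly (map_poly to_ac (R_poly p n t)) a = (\<Sum>k<h. a ^ (p ^ (2 * k + 1))) + S.coef ^ 2 * a"
      unfolding R_poly_def C.ev1.map_add C.to_ac.eval_monom to_ac_power coef by simp
    thus ?thesis unfolding f_def C.ev1.map_mult C.to_ac.eval_monom S.val_def s
      by (simp add: distrib_left sum_distrib_left power2_eq_square mult_ac)
  qed
  have "{s \<in> C.pts. fst s ^ (q ^ 2) = fst s \<and> snd s ^ (q ^ 2) = snd s} =
      {(a, b). a \<in> S.V \<and> b \<in> S.V \<and> S.s 1 b + b = S.val a}"
  proof -
    have "q ^ 2 = p ^ (2 * S.N)" unfolding assms(4) SN by (simp add: mult.commute flip: power_mult)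
    hence V: "a ^ (q ^ 2) = a \<longleftrightarrow> a \<in> S.V" for a by (simp add: S.V_def s)
    have pts: "(a, b) \<in> C.pts \<longleftrightarrow> S.s 1 b + b = S.val a" for a b
      unfolding C.pts_def mem_Collect_eq fst_conv snd_conv eval_f s power_one_right S.diff_eq_add ..
    show ?thesis
    proof (intro equalityI subsetI)
      fix x assume "x \<in> {s \<in> C.pts. fst s ^ (q ^ 2) = fst s \<and> snd s ^ (q ^ 2) = snd s}"
      thus "x \<in> {(a, b). a \<in> S.V \<and> b \<in> S.V \<and> S.s 1 b + b = S.val a}"
        unfolding V by (cases x) (simp only: mem_Collect_eq prod.case fst_conv snd_conv pts)
    next
      fix x assume "x \<in> {(a, b). a \<in> S.V \<and> b \<in> S.V \<and> S.s 1 b + b = S.val a}"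
      thus "x \<in> {s \<in> C.pts. fst s ^ (q ^ 2) = fst s \<and> snd s ^ (q ^ 2) = snd s}"
        unfolding V by (cases x) (simp only: mem_Collect_eq prod.case fst_conv snd_conv pts)
    qed
  qed
  hence "int (card {s \<in> C.pts. fst s ^ (q ^ 2) = fst s \<and> snd s ^ (q ^ 2) = snd s}) =
      int p ^ (2 * (4 * n)) + (int p - 1) * int p ^ (5 * n - 1)"
    using S.card_points by (simp only: Sp Sn SN)
  also have "\<dots> = int q ^ 2 + (int p - 1) * (int d - 1) * int q"
  proof -
    \<comment> \<open>With \<open>d - 1 = p ^ (n - 1)\<close> and \<open>q = p ^ (4 * n)\<close> the
      excess of the count is exactly twice the genus times \<open>q\<close>.\<close>
    have "5 * n - 1 = (n - 1) + 4 * n" using n2 by simp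
    hence "int p ^ (5 * n - 1) = int p ^ (n - 1) * int p ^ (4 * n)" by (simp only: power_add)
    thus ?thesis by (simp add: d_def assms(4) mult.commute flip: power_mult)
  qed
  finally have card: "int (card {s \<in> C.pts. fst s ^ (q ^ 2) = fst s \<and> snd s ^ (q ^ 2) = snd s}) =
      int q ^ 2 + (int p - 1) * (int d - 1) * int q" .
  show ?thesis unfolding G using C.exists_function_field C.is_maximalI[OF _ card] by blast
qed

end
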